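(* Fix $d\ge2$. The number of combinatorially distinct simplicial LC (locally constructible) $d$-spheres with $N$ facets grows not faster than $2^{d^2\cdot N}$; that is, for all sufficiently large $N$ there are at most $2^{d^2 N}$ combinatorial types of simplicial LC $d$-spheres with $N$ facets.
   Context: All complexes are finite. A simplicial $d$-sphere is a simplicial complex whose underlying space is homeomorphic to the $d$-sphere; facets are its $d$-dimensional faces. Combinatorially distinct means non-isomorphic as simplicial complexes. LC: A regular CW complex is simplicial if every lower interval $[0,F]$ in its face poset is boolean. A $d$-pseudomanifold is a finite, pure $d$-dimensional, simplicial regular CW complex in which each $(d-1)$-cell belongs to at most two $d$-cells; its boundary is the smallest subcomplex containing all $(d-1)$-cells that lie in exactly one $d$-cell. For $d\ge2$, a local construction for a pure $d$-dimensional simplicial complex $C$ with $N$ facets is a sequence $T_1,\dots,T_N,\dots,T_k$ ($k\ge N$) of $d$-pseudomanifolds such that: (1) $T_1$ is a $d$-simplex; (2) for $i\le N-1$, $T_{i+1}$ is obtained from $T_i$ by gluing a new $d$-simplex to $T_i$ along one of the $(d-1)$-cells of $\partial T_i$; (3) for $i\ge N$, $T_{i+1}$ is obtained from $T_i$ by identifying a pair of $(d-1)$-cells $\sigma,\tau$ in $\partial T_i$ whose intersection contains a $(d-2)$-cell $F$ (the identification being the simplicial one that fixes $F$ pointwise); (4) $T_k=C$. $C$ is LC if a local construction for $C$ exists. *)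

theory Defs
  imports "HOL-Homology.Homology"
begin

section \<open>Regular CW complexes and their face posets\<close>

definition closed_unit_ball :: "nat \<Rightarrow> (nat \<Rightarrow> real) set" where
  "closed_unit_ball n = {x \<in> topspace (Euclidean_space n). (\<Sum>i<n. (x i)\<^sup>2) \<le> 1}"

definition open_unit_ball :: "nat \<Rightarrow> (nat \<Rightarrow> real) set" where
  "open_unit_ball n = {x \<in> topspace (Euclidean_space n). (\<Sum>i<n. (x i)\<^sup>2) < 1}"

text \<open>The characteristic map of a regular cell is a homeomorphism of the closed ball onto the
  closure of the cell. For \<open>n = 0\<close> both balls are the single point of \<open>Euclidean_space 0\<close>.\<close>

definition regular_open_cell :: "'a topology \<Rightarrow> nat \<Rightarrow> 'a set \<Rightarrow> bool" where
  "regular_open_cell X n e \<longleftrightarrow>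
     (\<exists>\<Phi>. homeomorphic_map (subtopology (Euclidean_space n) (closed_unit_ball n))
                            (subtopology X (X closure_of e)) \<Phi> \<and>
          \<Phi> ` open_unit_ball n = e)"

text \<open>A cell complex is given by its space together with the set of its open cells.\<close>

type_synonym 'a cell_complex = "'a topology \<times> 'a set set"

definition cells :: "'a cell_complex \<Rightarrow> 'a set set" where
  "cells K = snd K"

definition k_cells :: "'a cell_complex \<Rightarrow> nat \<Rightarrow> 'a set set" where
  "k_cells K k = {e \<in> cells K. regular_open_cell (fst K) k e}"

text \<open>Finite regular CW complexes; because of finiteness no condition of weak topology is needed.\<close>

definition regular_CW :: "'a cell_complex \<Rightarrow> bool" where
  "regular_CW K \<longleftrightarrow>
     Hausdorff_space (fst K) \<and>
     finite (cells K) \<and> disjoint (cells K) \<and> \<Union> (cells K) = topspace (fst K) \<and>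
     (\<forall>e \<in> cells K. \<exists>n. e \<in> k_cells K n \<and>
        (fst K) closure_of e - e \<subseteq> (\<Union>m\<in>{..<n}. \<Union> (k_cells K m)))"

text \<open>The face poset has the empty face as its bottom element \<open>0\<close>. A closed cell is represented by
  the corresponding open cell, so the order is inclusion of closures; the closure of the empty face
  is empty.\<close>

definition faces :: "'a cell_complex \<Rightarrow> 'a set set" where
  "faces K = insert {} (cells K)"

definition face_le :: "'a cell_complex \<Rightarrow> 'a set \<Rightarrow> 'a set \<Rightarrow> bool" where
  "face_le K e f \<longleftrightarrow> (fst K) closure_of e \<subseteq> (fst K) closure_of f"

definition lower_interval :: "'a cell_complex \<Rightarrow> 'a set \<Rightarrow> 'a set set" where
  "lower_interval K F = {e \<in> faces K. face_le K e F}"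

definition order_iso ::
  "'a set \<Rightarrow> ('a \<Rightarrow> 'a \<Rightarrow> bool) \<Rightarrow> 'b set \<Rightarrow> ('b \<Rightarrow> 'b \<Rightarrow> bool) \<Rightarrow> ('a \<Rightarrow> 'b) \<Rightarrow> bool" where
  "order_iso A r B s \<phi> \<longleftrightarrow>
     bij_betw \<phi> A B \<and> (\<forall>x\<in>A. \<forall>y\<in>A. r x y \<longleftrightarrow> s (\<phi> x) (\<phi> y))"

text \<open>A cell whose lower interval is boolean of rank \<open>n\<close> has dimension \<open>n - 1\<close>, because the maximal
  chains of faces below a \<open>k\<close>-cell of a regular CW complex have length \<open>k + 1\<close>. Hence recording the
  rank \<open>k + 1\<close> below does not restrict the condition that the interval be boolean.\<close>

definition boolean_interval :: "'a cell_complex \<Rightarrow> 'a set \<Rightarrow> nat \<Rightarrow> bool" where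
  "boolean_interval K F n \<longleftrightarrow>
     (\<exists>\<phi>. order_iso (lower_interval K F) (face_le K) (Pow {..<n}) (\<subseteq>) \<phi>)"

definition simplicial_CW :: "'a cell_complex \<Rightarrow> bool" where
  "simplicial_CW K \<longleftrightarrow>
     regular_CW K \<and> (\<forall>k. \<forall>F \<in> k_cells K k. boolean_interval K F (k + 1))"

definition subcomplex :: "'a cell_complex \<Rightarrow> 'a set set \<Rightarrow> bool" where
  "subcomplex K L \<longleftrightarrow>
     L \<subseteq> faces K \<and> {} \<in> L \<and> (\<forall>f\<in>L. lower_interval K f \<subseteq> L)"


section \<open>Pseudomanifolds\<close>

definition facets_above :: "nat \<Rightarrow> 'a cell_complex \<Rightarrow> 'a set \<Rightarrow> 'a set set" where
  "facets_above d K e = {f \<in> k_cells K d. face_le K e f}"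

definition pseudomanifold :: "nat \<Rightarrow> 'a cell_complex \<Rightarrow> bool" where
  "pseudomanifold d K \<longleftrightarrow>
     simplicial_CW K \<and>
     cells K \<noteq> {} \<and> (\<forall>e \<in> cells K. facets_above d K e \<noteq> {}) \<and>
     (\<forall>e \<in> k_cells K (d - 1). card (facets_above d K e) \<le> 2)"

definition pm_boundary :: "nat \<Rightarrow> 'a cell_complex \<Rightarrow> 'a set set" where
  "pm_boundary d K =
     \<Inter> {L. subcomplex K L \<and> {e \<in> k_cells K (d - 1). card (facets_above d K e) = 1} \<subseteq> L}"

definition is_simplex :: "nat \<Rightarrow> 'a cell_complex \<Rightarrow> bool" where
  "is_simplex d K \<longleftrightarrow>
     simplicial_CW K \<and> (\<exists>F \<in> k_cells K d. \<forall>e \<in> cells K. face_le K e F)"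


section \<open>Local constructions\<close>

text \<open>Finite regular CW complexes are determined by their face posets up to cellular homeomorphism,
  so the two construction steps are described on faces.

  Gluing: \<open>\<iota>\<close> embeds \<open>T\<close> into \<open>T'\<close> as a subcomplex, and \<open>T'\<close> is the union of this subcomplex
  and of the closed simplex \<open>\<Delta>\<close>, which meet exactly in the closed cell of \<open>\<sigma>\<close>.\<close>

definition glue_step :: "nat \<Rightarrow> 'a cell_complex \<Rightarrow> 'b cell_complex \<Rightarrow> bool" where
  "glue_step d T T' \<longleftrightarrow>
     (\<exists>\<sigma> \<in> k_cells T (d - 1) \<inter> pm_boundary d T. \<exists>\<Delta> \<in> k_cells T' d. \<exists>\<iota>.
        order_iso (faces T) (face_le T) (\<iota> ` faces T) (face_le T') \<iota> \<and>
        subcomplex T' (\<iota> ` faces T) \<and>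
        faces T' = \<iota> ` faces T \<union> lower_interval T' \<Delta> \<and>
        \<iota> ` faces T \<inter> lower_interval T' \<Delta> = lower_interval T' (\<iota> \<sigma>))"

text \<open>Identification: \<open>\<phi>\<close> is the simplicial isomorphism from the closed cell of \<open>\<sigma>\<close> to that of \<open>\<tau>\<close>
  that is the identity on all faces of \<open>F\<close>, and \<open>T'\<close> is the quotient of \<open>T\<close> by the equivalence
  relation generated by \<open>\<phi>\<close>; \<open>q\<close> is the quotient map on faces. Closures in the quotient are the
  images of closures, which gives the order on the faces of \<open>T'\<close>.\<close>

definition identify_step :: "nat \<Rightarrow> 'a cell_complex \<Rightarrow> 'b cell_complex \<Rightarrow> bool" where
  "identify_step d T T' \<longleftrightarrow>
     (\<exists>\<sigma> \<in> k_cells T (d - 1) \<inter> pm_boundary d T. \<exists>\<tau> \<in> k_cells T (d - 1) \<inter> pm_boundary d T.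
      \<exists>F \<in> k_cells T (d - 2). \<exists>\<phi> q.
        \<sigma> \<noteq> \<tau> \<and> face_le T F \<sigma> \<and> face_le T F \<tau> \<and>
        order_iso (lower_interval T \<sigma>) (face_le T) (lower_interval T \<tau>) (face_le T) \<phi> \<and>
        (\<forall>x \<in> lower_interval T F. \<phi> x = x) \<and>
        q ` faces T = faces T' \<and>
        (\<forall>x \<in> faces T. \<forall>y \<in> faces T.
           q x = q y \<longleftrightarrow> equivclp (\<lambda>a b. a \<in> lower_interval T \<sigma> \<and> b = \<phi> a) x y) \<and>
        (\<forall>a \<in> faces T'. \<forall>b \<in> faces T'.
           face_le T' a b \<longleftrightarrow>
             (\<exists>x \<in> faces T. \<exists>y \<in> faces T. q x = a \<and> q y = b \<and> face_le T x y)))"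


section \<open>Simplicial complexes and spheres\<close>

text \<open>Finite simplicial complexes on vertices taken from \<open>\<nat>\<close>, the empty face included; every finite
  simplicial complex is isomorphic to one of these.\<close>

definition simplicial_cpx :: "nat set set \<Rightarrow> bool" where
  "simplicial_cpx C \<longleftrightarrow>
     finite C \<and> {} \<in> C \<and> (\<forall>s\<in>C. finite s \<and> (\<forall>t. t \<subseteq> s \<longrightarrow> t \<in> C))"

definition cpx_iso :: "nat set set \<Rightarrow> nat set set \<Rightarrow> bool" where
  "cpx_iso C C' \<longleftrightarrow> (\<exists>f. inj_on f (\<Union>C) \<and> (\<lambda>s. f ` s) ` C = C')"

definition cpx_facets :: "nat \<Rightarrow> nat set set \<Rightarrow> nat set set" where
  "cpx_facets d C = {s \<in> C. card s = d + 1}"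

text \<open>The underlying space, in barycentric coordinates. For a finite complex all points have
  their support in a fixed finite set, so the product topology is the usual topology.\<close>

definition underlying_space :: "nat set set \<Rightarrow> (nat \<Rightarrow> real) topology" where
  "underlying_space C =
     subtopology (powertop_real UNIV)
       {x. (\<forall>v. 0 \<le> x v) \<and> {v. x v \<noteq> 0} \<in> C \<and> (\<Sum>v\<in>{v. x v \<noteq> 0}. x v) = 1}"

definition simplicial_sphere :: "nat \<Rightarrow> nat set set \<Rightarrow> bool" where
  "simplicial_sphere d C \<longleftrightarrow>
     simplicial_cpx C \<and> underlying_space C homeomorphic_space nsphere d"

text \<open>The intermediate complexes live in the type \<open>nat \<Rightarrow> real\<close>, which has room for
  every finite CW complex. The final equation \<open>T\<^sub>k = C\<close> is isomorphism of face posets.\<close>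

definition local_construction ::
  "nat \<Rightarrow> nat set set \<Rightarrow> nat \<Rightarrow> nat \<Rightarrow> (nat \<Rightarrow> (nat \<Rightarrow> real) cell_complex) \<Rightarrow> bool" where
  "local_construction d C N k T \<longleftrightarrow>
     1 \<le> N \<and> N \<le> k \<and>
     (\<forall>i\<in>{1..k}. pseudomanifold d (T i)) \<and>
     is_simplex d (T 1) \<and>
     (\<forall>i\<in>{1..<N}. glue_step d (T i) (T (i + 1))) \<and>
     (\<forall>i\<in>{N..<k}. identify_step d (T i) (T (i + 1))) \<and>
     (\<exists>\<phi>. order_iso (faces (T k)) (face_le (T k)) C (\<subseteq>) \<phi>)"

definition LC :: "nat \<Rightarrow> nat set set \<Rightarrow> bool" where
  "LC d C \<longleftrightarrow> (\<exists>k T. local_construction d C (card (cpx_facets d C)) k T)"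

definition LC_spheres :: "nat \<Rightarrow> nat \<Rightarrow> nat set set set" where
  "LC_spheres d N = {C. simplicial_sphere d C \<and> LC d C \<and> card (cpx_facets d C) = N}"

definition LC_sphere_types :: "nat \<Rightarrow> nat \<Rightarrow> nat set set set set" where
  "LC_sphere_types d N = LC_spheres d N // {(C, C'). cpx_iso C C'}"

end

theory Submission
  imports Defs
begin

text \<open>The face poset of the final complex is the quotient of the faces of \<open>N\<close> disjoint simplices
  by the gluings of the construction. The first \<open>N - 1\<close> gluings form a tree of simplices, and a
  tree is a prefix-closed set of words: the child of \<open>w\<close> at its \<open>j\<close>-th face is \<open>w @ [j]\<close>. Each later
  gluing joins the two ends of a path of simplices around a ridge, so it is determined by the ridge
  class. A gluing that has become available stays available until one of its two facets is used.
  Hence one can decide the available gluings one at a time, with one bit each, and the order of the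
  construction is not part of the code. A tree needs at most \<open>d N + 1\<close> bits. The boundary of the tree
  has \<open>f = (d - 1) N + 2\<close> facets and \<open>d f / 2\<close> ridges, and each of the at most \<open>f / 2\<close> gluings makes
  at most \<open>d - 1\<close> new gluings available, which gives \<open>(2 d - 1) f / 2\<close> bits for the gluings. The sum
  is at most \<open>d\<^sup>2 N\<close> when \<open>N \<ge> 8\<close>.\<close>

section \<open>Exchange systems\<close>

text \<open>The obstacle is order. Writing down the sequence of identifications would cost about
  \<open>log N\<close> bits per step, superexponential in total, so the set of gluings has to
  suffice. Two properties of such a set make this work, and both pass to subsets: no facet is glued
  twice, and no simplex has two of its faces identified. By the first, the simplices around a ridge
  form a path or a cycle. By the second, the bijection of a gluing is forced: it is prescribed on
  the ridge, and the one remaining vertex has one possible image. So a ridge class offers at most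
  one gluing. Making it closes the class of its own ridge, and only the other \<open>d - 1\<close>
  ridges of the glued facet can lead to new offers. The total is \<open>d N + 1 + (2 d - 1) ((d - 1)
  N + 2) / 2 = (d^2 - (d - 1) / 2) N + 2 d\<close> bits. The surplus \<open>(d - 1) N / 2\<close>
  outweighs \<open>2 d\<close> from \<open>N = 8\<close> on, and \<open>d = 2\<close> is the case
  that needs 8.\<close>

inductive grows :: "('a set \<Rightarrow> 'a set) \<Rightarrow> 'a set \<Rightarrow> 'a set \<Rightarrow> bool" for avail G where
  base: "grows avail G G"
| step: "grows avail G M \<Longrightarrow> g \<in> avail M \<Longrightarrow> grows avail G (insert g M)"

lemma grows_subset: "grows avail G M \<Longrightarrow> G \<subseteq> M"
  by (induction rule: grows.induct) auto

text \<open>Ends the recursion of the count: a set that avoids \<open>avail G\<close> altogether can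
  only be \<open>G\<close> itself.\<close>

lemma grows_first:
  assumes "grows avail G M" "M \<noteq> G"
  obtains g where "g \<in> avail G" "g \<in> M"
  using assms
proof (induction arbitrary: thesis rule: grows.induct)
  case (step M g)
  then show ?case by (cases "M = G") auto
qed simp

text \<open>A relative antimatroid: by \<open>avail_mono\<close> a choice once possible stays
  possible unless a conflict blocks it, and \<open>valid\<close> records the conflicts. The constant
  \<open>c\<close> bounds how many choices are released by one. The instances are growing words,
  which never conflict, and gluings, which compete for facets.\<close>

locale exchange_system =
  fixes avail :: "'a set \<Rightarrow> 'a set" and valid :: "'a set \<Rightarrow> bool" and c :: nat
  assumes valid_finite: "valid M \<Longrightarrow> finite M"
    and valid_subset: "valid M \<Longrightarrow> G \<subseteq> M \<Longrightarrow> valid G"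
    and avail_disjoint: "g \<in> avail G \<Longrightarrow> g \<notin> G"
    and avail_mono: "g \<in> avail G \<Longrightarrow> G \<subseteq> G' \<Longrightarrow> g \<notin> G' \<Longrightarrow> valid (insert g G') \<Longrightarrow> g \<in> avail G'"
    and finite_new: "g \<in> avail G \<Longrightarrow> valid (insert g G) \<Longrightarrow> finite (avail (insert g G) - avail G)"
    and card_new: "g \<in> avail G \<Longrightarrow> valid (insert g G) \<Longrightarrow> card (avail (insert g G) - avail G) \<le> c"
begin

text \<open>The derivation of \<open>M\<close> is replayed behind \<open>g\<close>. Each later
  choice \<open>h\<close> is still available by \<open>avail_mono\<close>, because everything stays
  inside a valid set; a choice already made is skipped.\<close>

lemma grows_exchange:
  assumes "grows avail G M" "valid (insert g M)" "g \<in> avail G"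
  shows "grows avail (insert g G) (insert g M)"
  using assms
proof (induction rule: grows.induct)
  case base
  then show ?case by (simp add: grows.base)
next
  case (step M h)
  have v: "valid (insert g M)" "valid (insert h (insert g M))"
    using step.prems valid_subset[of "insert g (insert h M)" "insert g M"]
    by (auto simp: insert_commute[of g h M])
  have IH: "grows avail (insert g G) (insert g M)"
    using step v by auto
  show ?case
  proof (cases "h \<in> insert g M")
    case True
    then have "insert g (insert h M) = insert g M" by auto
    then show ?thesis using IH by simp
  next
    case False
    have "h \<in> avail (insert g M)"
      using avail_mono[of h M "insert g M"] step.hyps False v by auto
    then show ?thesis using grows.step[OF IH, of h] insert_commute[of g h M] by simp
  qed
qed

text \<open>The fate of one available element \<open>a\<close> is decided at a time: either it is never chosen, or,
  by the exchange property, it can be chosen first.\<close>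

lemma card_grows_restricted:
  assumes "finite A" "A \<subseteq> avail G" "card A + c * (n - card G) \<le> k"
  shows "finite {M. grows avail G M \<and> valid M \<and> card M \<le> n \<and> M \<inter> avail G \<subseteq> A} \<and>
         card {M. grows avail G M \<and> valid M \<and> card M \<le> n \<and> M \<inter> avail G \<subseteq> A} \<le> 2 ^ k"
  using assms
\<comment> \<open>\<open>A\<close> holds the available elements still undecided; those of
  \<open>avail G - A\<close> are rejected for good. The budget pays one bit per undecided element
  and \<open>c\<close> bits per choice still possible. Rejecting \<open>a\<close> saves its own bit;
  choosing it also uses up one of the \<open>n - card G\<close> choices, which pays for the at most
  \<open>c\<close> elements it releases.\<close>
proof (induction k arbitrary: G A)
  case 0
  then have "A = {}" by auto
  then have sub: "{M. grows avail G M \<and> valid M \<and> card M \<le> n \<and> M \<inter> avail G \<subseteq> A} \<subseteq> {G}"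
    by (auto elim: grows_first)
  show ?case using finite_subset[OF sub] card_mono[OF _ sub] by simp
next
  case (Suc k)
  let ?F = "\<lambda>G A. {M. grows avail G M \<and> valid M \<and> card M \<le> n \<and> M \<inter> avail G \<subseteq> A}"
  show ?case
  proof (cases "A = {}")
    case True
    then have sub: "?F G A \<subseteq> {G}"
      by (auto elim: grows_first)
    have "card (?F G A) \<le> 1" using card_mono[OF _ sub] by simp
    also have "(1::nat) \<le> 2 ^ Suc k" by simp
    finally show ?thesis using finite_subset[OF sub] by simp
  next
    case False
    then obtain a where a: "a \<in> A" by auto
    let ?G = "insert a G"
    \<comment> \<open>Rejected elements stay out, undecided ones survive only while available, and
      those released by \<open>a\<close> enter as undecided.\<close>
    let ?A = "avail ?G \<inter> ((A - {a}) \<union> (avail ?G - avail G))"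
    let ?X = "{M \<in> ?F G A. a \<in> M}"
    have c1: "card (A - {a}) = card A - 1" "card A \<ge> 1"
      using a Suc.prems(1) by (simp_all add: Suc_le_eq card_gt_0_iff False)
    have 1: "finite (?F G (A - {a})) \<and> card (?F G (A - {a})) \<le> 2 ^ k"
    proof (rule Suc.IH)
      show "card (A - {a}) + c * (n - card G) \<le> k" using Suc.prems(3) c1 by linarith
    qed (use Suc.prems in auto)
    have 2: "finite ?X \<and> card ?X \<le> 2 ^ k"
    proof (cases "?X = {}")
      case True
      show ?thesis unfolding True by simp
    next
      case False
      \<comment> \<open>The witness shows that \<open>?G\<close> is valid and
        \<open>card G < n\<close>, so that the truncated difference \<open>n - card G\<close> really
        drops by one.\<close>
      then obtain M0 where M0: "grows avail G M0" "valid M0" "card M0 \<le> n" "a \<in> M0" by auto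
      have sub: "?G \<subseteq> M0" using M0 grows_subset by auto
      have v: "valid ?G" using valid_subset M0(2) sub by blast
      have aG: "a \<in> avail G" using a Suc.prems by auto
      have "finite G" using valid_finite[OF v] by simp
      then have cG: "card ?G = Suc (card G)" using avail_disjoint[OF aG] by simp
      have "card ?G \<le> n" using card_mono[OF valid_finite[OF M0(2)] sub] M0(3) by simp
      then have n: "n - card G = Suc (n - card ?G)" using cG by simp
      have fin: "finite ?A" using Suc.prems(1) finite_new[OF aG v] by auto
      have "card ?A \<le> card ((A - {a}) \<union> (avail ?G - avail G))"
        using Suc.prems(1) finite_new[OF aG v] by (intro card_mono) auto
      also have "\<dots> \<le> card A - 1 + c"
        using card_Un_le[of "A - {a}" "avail ?G - avail G"] card_new[OF aG v] c1 by linarith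
      finally have cA: "card ?A \<le> card A - 1 + c" .
      have le: "card ?A + c * (n - card ?G) \<le> k"
        using Suc.prems(3) cA c1 unfolding n by simp
      have IH: "finite (?F ?G ?A) \<and> card (?F ?G ?A) \<le> 2 ^ k"
        by (rule Suc.IH[OF fin _ le]) simp
      have "?X \<subseteq> ?F ?G ?A"
      proof
        fix M assume M: "M \<in> ?X"
        then have "grows avail ?G M"
          using grows_exchange[of G M a] aG by (auto simp: insert_absorb)
        then show "M \<in> ?F ?G ?A" using M avail_disjoint[of a ?G] by auto
      qed
      then show ?thesis using IH finite_subset card_mono le_trans by meson
    qed
    have sub: "?F G A \<subseteq> ?F G (A - {a}) \<union> ?X" by auto
    have fin: "finite (?F G (A - {a}) \<union> ?X)" using 1 2 by simp
    have "card (?F G A) \<le> card (?F G (A - {a}) \<union> ?X)" by (rule card_mono[OF fin sub])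
    also have "\<dots> \<le> card (?F G (A - {a})) + card ?X" by (rule card_Un_le)
    also have "\<dots> \<le> 2 ^ Suc k" using 1 2 by simp
    finally show ?thesis using finite_subset[OF sub fin] by simp
  qed
qed

lemma card_grows:
  assumes "finite (avail G)" "card (avail G) + c * (n - card G) \<le> k"
  shows "finite {M. grows avail G M \<and> valid M \<and> card M \<le> n}"
    and "card {M. grows avail G M \<and> valid M \<and> card M \<le> n} \<le> 2 ^ k"
proof -
  have "{M. grows avail G M \<and> valid M \<and> card M \<le> n \<and> M \<inter> avail G \<subseteq> avail G}
      = {M. grows avail G M \<and> valid M \<and> card M \<le> n}" by auto
  with card_grows_restricted[OF assms(1) _ assms(2)]
  show "finite {M. grows avail G M \<and> valid M \<and> card M \<le> n}"
    and "card {M. grows avail G M \<and> valid M \<and> card M \<le> n} \<le> 2 ^ k" by simp_all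
qed

end

section \<open>Trees of simplices as sets of words\<close>

text \<open>The letter \<open>j\<close> names the facet opposite the vertex label \<open>j\<close>.
  A child keeps the labels of its parent on the shared facet, so in a nonempty \<open>w\<close> the
  facet opposite \<open>last w\<close> faces the parent and takes no child.\<close>

definition children :: "nat \<Rightarrow> nat list set \<Rightarrow> nat list set" where
  "children d W = {w @ [j] |w j. w \<in> W \<and> j \<le> d \<and> (w \<noteq> [] \<longrightarrow> last w \<noteq> j)} - W"

text \<open>A word in \<open>children d G\<close> is nonempty, so one of its \<open>d + 1\<close>
  facets faces its parent and only \<open>d\<close> words are released. Words never block each
  other, hence finiteness is all that \<open>valid\<close> has to say.\<close>

lemma exchange_system_children: "exchange_system (children d) finite d"
proof
  fix g :: "nat list" and G assume g: "g \<in> children d G"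
  then have ne: "g \<noteq> []" "last g \<le> d" by (auto simp: children_def)
  have sub: "children d (insert g G) - children d G \<subseteq> (\<lambda>j. g @ [j]) ` ({..d} - {last g})"
    using ne by (fastforce simp: children_def)
  then show "finite (children d (insert g G) - children d G)"
    by (rule finite_subset) simp
  have "card (children d (insert g G) - children d G) \<le> card ((\<lambda>j. g @ [j]) ` ({..d} - {last g}))"
    using sub by (rule card_mono[rotated]) simp
  also have "\<dots> \<le> card ({..d} - {last g})" by (rule card_image_le) simp
  also have "\<dots> = d" using ne by simp
  finally show "card (children d (insert g G) - children d G) \<le> d" .
qed (auto simp: children_def dest: finite_subset)

text \<open>The root offers \<open>d + 1\<close> children and each of the other \<open>N - 1\<close>
  words releases at most \<open>d\<close>: the budget is \<open>d + 1 + d * (N - 1)\<close>.\<close>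

lemma card_trees:
  assumes "1 \<le> N"
  shows "finite {W. grows (children d) {[]} W \<and> finite W \<and> card W \<le> N}"
    and "card {W. grows (children d) {[]} W \<and> finite W \<and> card W \<le> N} \<le> 2 ^ (d * N + 1)"
proof -
  have eq: "children d {[]} = (\<lambda>j. [j]) ` {..d}" by (auto simp: children_def)
  have fin: "finite (children d {[]})" unfolding eq by simp
  have "card (children d {[]}) \<le> Suc d" unfolding eq using card_image_le[of "{..d}"] by force
  moreover have "d * (N - 1) + d = d * N" using assms by (cases N) auto
  ultimately have le: "card (children d {[]}) + d * (N - card {[] :: nat list}) \<le> d * N + 1"
    by simp
  show "finite {W. grows (children d) {[]} W \<and> finite W \<and> card W \<le> N}"
    "card {W. grows (children d) {[]} W \<and> finite W \<and> card W \<le> N} \<le> 2 ^ (d * N + 1)"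
    using exchange_system.card_grows[OF exchange_system_children fin le] by simp_all
qed

section \<open>Gluings of simplices\<close>

text \<open>A new edge merges only the classes of its ends: a path that uses it joins
  \<open>x\<close> to an end before that and, as \<open>R\<close> is symmetric, \<open>y\<close> to
  an end after it.\<close>

lemma rtrancl_insert_pair:
  assumes "sym R" "(x, y) \<in> (R \<union> {(p, q), (q, p)})\<^sup>*"
  shows "(x, y) \<in> R\<^sup>* \<or>
    ((x, p) \<in> R\<^sup>* \<or> (x, q) \<in> R\<^sup>*) \<and> ((y, p) \<in> R\<^sup>* \<or> (y, q) \<in> R\<^sup>*)"
  using assms(2)
proof (induction rule: rtrancl_induct)
  case (step y z)
  have "sym (R\<^sup>*)" using assms(1) by (rule sym_rtrancl)
  show ?case
  proof (cases "(y, z) \<in> R")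
    case True
    then have "(z, y) \<in> R" using assms(1) by (auto dest: symD)
    with True step.IH show ?thesis
      by (meson converse_rtrancl_into_rtrancl rtrancl.rtrancl_into_rtrancl)
  next
    case False
    then have "y = p \<and> z = q \<or> y = q \<and> z = p" using step.hyps by auto
    then show ?thesis using step.IH by auto
  qed
qed simp

text \<open>A node carries at most two flags, so a matching of flags links the nodes into paths and
  cycles; such a component has at most two unmatched flags, the ends of a path.\<close>

lemma card_unmatched_flags:
  fixes nd :: "'f \<Rightarrow> 'n"
  assumes "finite Q" "\<And>q. q \<in> Q \<Longrightarrow> card q = 2 \<and> q \<subseteq> Fl"
    and "\<And>q r. q \<in> Q \<Longrightarrow> r \<in> Q \<Longrightarrow> q \<noteq> r \<Longrightarrow> q \<inter> r = {}"
    and nd: "\<And>n. finite {\<phi> \<in> Fl. nd \<phi> = n} \<and> card {\<phi> \<in> Fl. nd \<phi> = n} \<le> 2"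
  shows "finite {\<phi> \<in> Fl. \<phi> \<notin> \<Union>Q \<and> (nd \<phi>, x) \<in> {(nd a, nd b) |a b. {a, b} \<in> Q}\<^sup>*} \<and>
         card {\<phi> \<in> Fl. \<phi> \<notin> \<Union>Q \<and> (nd \<phi>, x) \<in> {(nd a, nd b) |a b. {a, b} \<in> Q}\<^sup>*} \<le> 2"
  using assms(1-3)
proof (induction Q arbitrary: x)
  case empty
  then show ?case using nd[of x] by simp
next
  case (insert e Q)
  let ?R = "\<lambda>Q. {(nd a, nd b) |a b. {a, b} \<in> Q}"
  let ?U = "\<lambda>Q x. {\<phi> \<in> Fl. \<phi> \<notin> \<Union>Q \<and> (nd \<phi>, x) \<in> (?R Q)\<^sup>*}"
  obtain a b where ab: "e = {a, b}" "a \<noteq> b" using insert.prems(1)[of e] by (auto simp: card_2_iff)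
  have abF: "a \<in> Fl" "b \<in> Fl" using insert.prems(1)[of e] ab by auto
  have abQ: "a \<notin> \<Union>Q" "b \<notin> \<Union>Q" using insert.prems(2)[of e] insert.hyps(2) ab by blast+
  have IH: "finite (?U Q x) \<and> card (?U Q x) \<le> 2" for x
    using insert.prems by (intro insert.IH) auto
  have sym: "sym (?R Q)" by (auto simp: sym_def) (metis insert_commute)
  have R: "?R (insert e Q) = ?R Q \<union> {(nd a, nd b), (nd b, nd a)}"
    unfolding ab(1) by (auto simp: doubleton_eq_iff)
  have symr: "(u, v) \<in> (?R Q)\<^sup>* \<longleftrightarrow> (v, u) \<in> (?R Q)\<^sup>*" for u v
    using sym_rtrancl[OF sym] by (auto dest: symD)
  have step: "(u, x) \<in> (?R Q)\<^sup>* \<or>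
      ((u, nd a) \<in> (?R Q)\<^sup>* \<or> (u, nd b) \<in> (?R Q)\<^sup>*) \<and> ((x, nd a) \<in> (?R Q)\<^sup>* \<or> (x, nd b) \<in> (?R Q)\<^sup>*)"
    if "(u, x) \<in> (?R (insert e Q))\<^sup>*" for u
    using rtrancl_insert_pair[OF sym] that unfolding R by blast
  show ?case
  proof (cases "(x, nd a) \<in> (?R Q)\<^sup>* \<or> (x, nd b) \<in> (?R Q)\<^sup>*")
    case True
    \<comment> \<open>The new pair merges the classes of \<open>nd a\<close> and
      \<open>nd b\<close>. Each had at most two unmatched flags and gives up \<open>a\<close> or
      \<open>b\<close>, so at most \<open>1 + 1\<close> remain; the bound does not ask whether the
      two classes were distinct.\<close>
    let ?Y = "(?U Q (nd a) - {a}) \<union> (?U Q (nd b) - {b})"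
    have "(u, nd a) \<in> (?R Q)\<^sup>* \<or> (u, nd b) \<in> (?R Q)\<^sup>*" if "(u, x) \<in> (?R (insert e Q))\<^sup>*" for u
      using step[OF that] True by (meson rtrancl_trans)
    then have sub: "?U (insert e Q) x \<subseteq> ?Y"
      unfolding ab(1) by blast
    have "a \<in> ?U Q (nd a)" "b \<in> ?U Q (nd b)" using abF abQ by auto
    then have "card (?U Q (nd a) - {a}) \<le> 1" "card (?U Q (nd b) - {b}) \<le> 1"
      using IH[of "nd a"] IH[of "nd b"] by (auto simp: card_Diff_singleton)
    then have "card ?Y \<le> 2" using card_Un_le[of "?U Q (nd a) - {a}" "?U Q (nd b) - {b}"] by linarith
    moreover have "finite ?Y" using IH by blast
    ultimately show ?thesis using finite_subset[OF sub] card_mono[OF _ sub] le_trans by blast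
  next
    case False
    then have sub: "?U (insert e Q) x \<subseteq> ?U Q x"
      using step by blast
    show ?thesis using IH[of x] finite_subset[OF sub] card_mono[OF _ sub] le_trans by blast
  qed
qed

text \<open>The node \<open>(w, A)\<close> is the face with vertex labels \<open>A \<subseteq> {..d}\<close> of the \<open>d\<close>-simplex \<open>w\<close>. A gluing
  is the symmetric relation that it induces on nodes, so that its two orientations coincide; its
  slots are the two facets of simplices that it identifies.\<close>

type_synonym node = "nat list \<times> nat set"

definition glue :: "nat list \<Rightarrow> nat set \<Rightarrow> nat list \<Rightarrow> (nat \<Rightarrow> nat) \<Rightarrow> node rel" where
  "glue w S v f = (\<Union>A\<in>Pow S. {((w, A), (v, f ` A)), ((v, f ` A), (w, A))})"

text \<open>\<open>w \<noteq> v\<close> reflects regularity: gluing two facets of one simplex would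
  identify two faces of a single cell.\<close>

definition gluing_data ::
  "nat \<Rightarrow> nat list set \<Rightarrow> nat list \<Rightarrow> nat set \<Rightarrow> nat list \<Rightarrow> (nat \<Rightarrow> nat) \<Rightarrow> bool" where
  "gluing_data d W w S v f \<longleftrightarrow>
     w \<in> W \<and> v \<in> W \<and> w \<noteq> v \<and> S \<subseteq> {..d} \<and> card S = d \<and> inj_on f S \<and> f ` S \<subseteq> {..d}"

definition gluings :: "nat \<Rightarrow> nat list set \<Rightarrow> node rel set" where
  "gluings d W = {glue w S v f |w S v f. gluing_data d W w S v f}"

definition slots :: "nat \<Rightarrow> node rel \<Rightarrow> node set" where
  "slots d g = {x \<in> Domain g. card (snd x) = d}"

definition used :: "nat \<Rightarrow> node rel set \<Rightarrow> node set" where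
  "used d G = \<Union> (slots d ` G)"

definition eqv :: "node rel set \<Rightarrow> node rel" where
  "eqv G = (\<Union>G)\<^sup>*"

text \<open>The second condition is the pseudomanifold property, that a facet is glued at most once;
  the third is regularity, that the quotient map is injective on every simplex. Unlike a topological
  condition on the quotient, all of this is inherited by subsets.\<close>

definition valid :: "nat \<Rightarrow> nat list set \<Rightarrow> node rel set \<Rightarrow> bool" where
  "valid d W G \<longleftrightarrow>
     G \<subseteq> gluings d W \<and>
     (\<forall>g\<in>G. \<forall>h\<in>G. g \<noteq> h \<longrightarrow> slots d g \<inter> slots d h = {}) \<and>
     (\<forall>v\<in>W. \<forall>A B. A \<subseteq> {..d} \<and> B \<subseteq> {..d} \<and> ((v, A), (v, B)) \<in> eqv G \<longrightarrow> A = B)"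

definition joins ::
  "nat \<Rightarrow> nat list set \<Rightarrow> node rel set \<Rightarrow> nat list \<Rightarrow> nat set \<Rightarrow> nat list \<Rightarrow> (nat \<Rightarrow> nat) \<Rightarrow>
   nat set \<Rightarrow> bool" where
  "joins d W G w S v f A \<longleftrightarrow>
     gluing_data d W w S v f \<and> (w, S) \<notin> used d G \<and> (v, f ` S) \<notin> used d G \<and>
     A \<subseteq> S \<and> card A = d - 1 \<and> (\<forall>B. B \<subseteq> A \<longrightarrow> ((w, B), (v, f ` B)) \<in> eqv G)"

definition ridge_gluings :: "nat \<Rightarrow> nat list set \<Rightarrow> node rel set \<Rightarrow> node rel set" where
  "ridge_gluings d W G = {glue w S v f |w S v f. \<exists>A. joins d W G w S v f A}"

text \<open>A flag is a door of the walk around a ridge: the simplex \<open>w\<close> is entered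
  through one facet containing \<open>A\<close> and left through the other. \<open>flag_node\<close>
  forgets the door and keeps the simplex with its copy of the ridge.\<close>

definition ridge_flags :: "nat \<Rightarrow> nat list set \<Rightarrow> (node \<times> nat set) set" where
  "ridge_flags d W = {((w, S), A) |w S A. w \<in> W \<and> S \<subseteq> {..d} \<and> card S = d \<and> A \<subseteq> S \<and> card A = d - 1}"

definition flag_node :: "node \<times> nat set \<Rightarrow> node" where
  "flag_node \<phi> = (fst (fst \<phi>), snd \<phi>)"

lemma mem_glue:
  "(x, y) \<in> glue w S v f \<longleftrightarrow>
     (\<exists>A\<subseteq>S. x = (w, A) \<and> y = (v, f ` A) \<or> x = (v, f ` A) \<and> y = (w, A))"
  by (auto simp: glue_def)

lemma mem_glue_forward:
  "w \<noteq> v \<Longrightarrow> ((w, A), (v, B)) \<in> glue w S v f \<longleftrightarrow> A \<subseteq> S \<and> B = f ` A"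
  by (auto simp: mem_glue)

lemma sym_glue: "sym (glue w S v f)"
  by (auto simp: sym_def mem_glue)

lemma glue_cong: "(\<And>x. x \<in> S \<Longrightarrow> f x = h x) \<Longrightarrow> glue w S v f = glue w S v h"
  unfolding glue_def by (intro SUP_cong refl) (auto intro!: image_cong)

lemma glue_swap:
  assumes "inj_on f S"
  shows "glue v (f ` S) w (inv_into S f) = glue w S v f"
proof -
  have inv: "inv_into S f ` f ` A = A" if "A \<subseteq> S" for A
    using that assms by (simp add: inv_into_image_cancel)
  have "Pow (f ` S) = (\<lambda>A. f ` A) ` Pow S" by (simp add: image_Pow_surj)
  then have "glue v (f ` S) w (inv_into S f)
      = (\<Union>A\<in>Pow S. {((v, f ` A), (w, inv_into S f ` f ` A)), ((w, inv_into S f ` f ` A), (v, f ` A))})"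
    unfolding glue_def by simp
  also have "\<dots> = glue w S v f"
    unfolding glue_def by (intro SUP_cong refl) (auto simp: inv)
  finally show ?thesis .
qed

lemma slots_glue:
  assumes "gluing_data d W w S v f"
  shows "slots d (glue w S v f) = {(w, S), (v, f ` S)}"
proof -
  have S: "finite S" "card S = d" using assms by (auto simp: gluing_data_def finite_subset)
  have "card (f ` A) = card A" if "A \<subseteq> S" for A
    using assms that by (auto simp: gluing_data_def intro!: card_image intro: inj_on_subset)
  moreover have "A = S" if "A \<subseteq> S" "card A = d" for A
    using that S card_subset_eq by metis
  ultimately have "(\<exists>y. (x, y) \<in> glue w S v f) \<and> card (snd x) = d \<longleftrightarrow> x = (w, S) \<or> x = (v, f ` S)" for x
    using S(2) unfolding mem_glue by (cases x) (metis order_refl snd_conv)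
  then show ?thesis unfolding slots_def Domain_iff by blast
qed

lemma gluing_data_swap:
  "gluing_data d W w S v f \<Longrightarrow> gluing_data d W v (f ` S) w (inv_into S f)"
  by (auto simp: gluing_data_def card_image inj_on_inv_into inv_into_into)

text \<open>A gluing has two presentations, one from each side. The one in which the given step runs
  forward is chosen here, so that later arguments have one case.\<close>

lemma gluing_step:
  assumes "g \<in> gluings d W" "((u, A), (u', B)) \<in> g"
  obtains S f where "g = glue u S u' f" "gluing_data d W u S u' f" "A \<subseteq> S" "B = f ` A"
proof -
  obtain w S v f where g: "g = glue w S v f" "gluing_data d W w S v f"
    using assms(1) by (auto simp: gluings_def)
  from assms(2) obtain C where C: "C \<subseteq> S"
    "u = w \<and> A = C \<and> u' = v \<and> B = f ` C \<or> u = v \<and> A = f ` C \<and> u' = w \<and> B = C"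
    unfolding g(1) mem_glue by auto
  from C(2) show thesis
  proof
    assume "u = w \<and> A = C \<and> u' = v \<and> B = f ` C"
    then show thesis using that[of S f] g C(1) by simp
  next
    assume u: "u = v \<and> A = f ` C \<and> u' = w \<and> B = C"
    have inj: "inj_on f S" using g(2) by (simp add: gluing_data_def)
    show thesis
    proof (rule that[of "f ` S" "inv_into S f"])
      show "A \<subseteq> f ` S" "B = inv_into S f ` A"
        using u C(1) by (auto simp: inv_into_image_cancel[OF inj C(1)])
    qed (use u g glue_swap[OF inj] gluing_data_swap[OF g(2)] in simp_all)
  qed
qed

lemma gluing_stepE:
  assumes "g \<in> gluings d W" "(x, y) \<in> g"
  obtains S f where "g = glue (fst x) S (fst y) f" "gluing_data d W (fst x) S (fst y) f"
    "snd x \<subseteq> S" "snd y = f ` snd x"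
  using gluing_step[of g d W "fst x" "snd x" "fst y" "snd y"] assms by auto

lemma gluing_single_valued:
  assumes "g \<in> gluings d W" "(x, y) \<in> g" "(x, z) \<in> g"
  shows "y = z"
proof -
  obtain S f where g: "g = glue (fst x) S (fst y) f" "gluing_data d W (fst x) S (fst y) f"
    "snd y = f ` snd x"
    using gluing_stepE[OF assms(1,2)] by metis
  have "((fst x, snd x), (fst z, snd z)) \<in> glue (fst x) S (fst y) f" using assms(3) g(1) by simp
  then have "fst z = fst y" "snd z = f ` snd x"
    using g(2) unfolding mem_glue gluing_data_def by (auto simp del: prod.collapse)
  then show ?thesis using g(3) by (simp add: prod_eq_iff)
qed

lemma gluing_step_card:
  assumes "g \<in> gluings d W" "(x, y) \<in> g"
  shows "card (snd y) = card (snd x)" "card (snd x) \<le> d"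
proof -
  obtain S f where g: "gluing_data d W (fst x) S (fst y) f" "snd x \<subseteq> S" "snd y = f ` snd x"
    using gluing_stepE[OF assms] by metis
  have "finite S" "inj_on f (snd x)"
    using g by (auto simp: gluing_data_def finite_subset intro: inj_on_subset)
  then show "card (snd y) = card (snd x)" "card (snd x) \<le> d" using g card_mono[of S "snd x"]
    by (auto simp: gluing_data_def card_image)
qed

lemma gluing_sym:
  assumes "g \<in> gluings d W" "(x, y) \<in> g"
  shows "(y, x) \<in> g"
proof -
  obtain w S v f where "g = glue w S v f" using assms(1) by (auto simp: gluings_def)
  then show ?thesis using assms(2) symD[OF sym_glue] by metis
qed

lemma finite_gluings:
  assumes "finite W"
  shows "finite (gluings d W)"
proof -
  have "gluings d W \<subseteq> Pow ((W \<times> Pow {..d}) \<times> (W \<times> Pow {..d}))"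
    unfolding gluings_def gluing_data_def glue_def by blast
  then show ?thesis by (rule finite_subset) (use assms in simp)
qed

lemma gluing_data_glue_mem: "gluing_data d W w S v f \<Longrightarrow> glue w S v f \<in> gluings d W"
  by (auto simp: gluings_def)

section \<open>Faces of the quotient as equivalence classes\<close>

lemma eqv_refl [simp]: "(x, x) \<in> eqv G"
  by (simp add: eqv_def)

lemma eqv_trans: "(x, y) \<in> eqv G \<Longrightarrow> (y, z) \<in> eqv G \<Longrightarrow> (x, z) \<in> eqv G"
  by (auto simp: eqv_def)

lemma eqv_sym:
  assumes "G \<subseteq> gluings d W" "(x, y) \<in> eqv G"
  shows "(y, x) \<in> eqv G"
proof -
  have "sym (\<Union>G)" using assms(1) gluing_sym by (fastforce simp: sym_def)
  then show ?thesis using assms(2) unfolding eqv_def by (meson sym_rtrancl symD)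
qed

lemma eqv_mono: "G \<subseteq> H \<Longrightarrow> (x, y) \<in> eqv G \<Longrightarrow> (x, y) \<in> eqv H"
  unfolding eqv_def using rtrancl_mono[of "\<Union>G" "\<Union>H"] by auto

lemma eqv_glue: "g \<in> G \<Longrightarrow> (x, y) \<in> g \<Longrightarrow> (x, y) \<in> eqv G"
  unfolding eqv_def by auto

lemma eqv_card:
  assumes "G \<subseteq> gluings d W" "(x, y) \<in> eqv G"
  shows "card (snd y) = card (snd x)"
  using assms(2) unfolding eqv_def
  by (induction rule: rtrancl_induct) (use assms(1) gluing_step_card in fastforce)+

text \<open>Gluings move only faces with at most \<open>d\<close> labels, so a full simplex is alone
  in its class.\<close>

lemma eqv_facet:
  assumes "G \<subseteq> gluings d W" "(x, y) \<in> eqv G" "card (snd x) = Suc d"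
  shows "y = x"
  using assms(2) unfolding eqv_def
  by (induction rule: rtrancl_induct)
    (use assms(1,3) gluing_step_card in \<open>fastforce simp: Suc_le_eq\<close>)+

text \<open>The smaller face travels along the same chain of gluings. This makes the order on
  classes independent of the representative.\<close>

lemma eqv_transport:
  assumes "G \<subseteq> gluings d W" "((w, A), y) \<in> eqv G" "B \<subseteq> A"
  shows "\<exists>D\<subseteq>snd y. ((w, B), (fst y, D)) \<in> eqv G"
  using assms(2) unfolding eqv_def
proof (induction rule: rtrancl_induct)
  case base
  then show ?case using assms(3) by auto
next
  case (step y z)
  then obtain D where D: "D \<subseteq> snd y" "((w, B), (fst y, D)) \<in> (\<Union>G)\<^sup>*" by auto
  obtain g where g: "g \<in> G" "(y, z) \<in> g" using step by auto
  obtain S f where f: "g = glue (fst y) S (fst z) f" "snd y \<subseteq> S" "snd z = f ` snd y"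
    using gluing_stepE[OF subsetD[OF assms(1) g(1)] g(2)] by metis
  have "((fst y, D), (fst z, f ` D)) \<in> g"
    unfolding f(1) mem_glue using f(2) D(1) by (intro exI[of _ D]) simp
  then have "((fst y, D), (fst z, f ` D)) \<in> \<Union>G" by (rule UnionI[OF g(1)])
  then have "((w, B), (fst z, f ` D)) \<in> (\<Union>G)\<^sup>*" by (rule rtrancl_into_rtrancl[OF D(2)])
  moreover have "f ` D \<subseteq> snd z" using f D by auto
  ultimately show ?case by blast
qed

lemma valid_subset: "valid d W M \<Longrightarrow> G \<subseteq> M \<Longrightarrow> valid d W G"
  unfolding valid_def by (meson eqv_mono subset_eq)

lemma validD: "valid d W G \<Longrightarrow> G \<subseteq> gluings d W"
  by (simp add: valid_def)

lemma valid_disjoint: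
  "valid d W G \<Longrightarrow> g \<in> G \<Longrightarrow> h \<in> G \<Longrightarrow> x \<in> slots d g \<Longrightarrow> x \<in> slots d h \<Longrightarrow> g = h"
  unfolding valid_def by blast

lemma valid_regular:
  "valid d W G \<Longrightarrow> v \<in> W \<Longrightarrow> A \<subseteq> {..d} \<Longrightarrow> B \<subseteq> {..d} \<Longrightarrow> ((v, A), (v, B)) \<in> eqv G \<Longrightarrow> A = B"
  by (auto simp: valid_def)

lemma joins_swap:
  assumes "joins d W G w S v f A" "G \<subseteq> gluings d W"
  shows "joins d W G v (f ` S) w (inv_into S f) (f ` A)"
proof -
  have dat: "gluing_data d W w S v f" and A: "A \<subseteq> S" "card A = d - 1"
    using assms by (auto simp: joins_def)
  have inj: "inj_on f S" using dat by (simp add: gluing_data_def)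
  have inv: "inv_into S f ` f ` B = B" if "B \<subseteq> S" for B
    using inv_into_image_cancel[OF inj that] .
  have "((v, B), (w, inv_into S f ` B)) \<in> eqv G" if B: "B \<subseteq> f ` A" for B
  proof -
    obtain C where C: "C \<subseteq> A" "B = f ` C" using B by (auto simp: subset_image_iff)
    then have "inv_into S f ` B = C" using inv A by auto
    then show ?thesis using C assms eqv_sym[OF assms(2)] by (auto simp: joins_def)
  qed
  moreover have "card (f ` A) = d - 1" using A card_image inj_on_subset[OF inj] by metis
  ultimately show ?thesis
    using assms(1) gluing_data_swap[OF dat] A inv[of S] by (auto simp: joins_def)
qed

section \<open>The path of simplices around a ridge\<close>

lemma flag_node_simp [simp]: "flag_node ((w, S), A) = (w, A)"
  by (simp add: flag_node_def)

lemma finite_ridge_flags: "finite W \<Longrightarrow> finite (ridge_flags d W)"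
  by (rule finite_subset[of _ "(W \<times> Pow {..d}) \<times> Pow {..d}"]) (auto simp: ridge_flags_def)

text \<open>A ridge uses \<open>d - 1\<close> of the \<open>d + 1\<close> labels of its simplex;
  adding either missing label gives one of the two facets through it.\<close>

lemma card_flags_at_node:
  assumes "1 \<le> d"
  shows "finite {\<phi> \<in> ridge_flags d W. flag_node \<phi> = n} \<and>
         card {\<phi> \<in> ridge_flags d W. flag_node \<phi> = n} \<le> 2"
proof -
  let ?F = "{\<phi> \<in> ridge_flags d W. flag_node \<phi> = n}"
  obtain w A where n: "n = (w, A)" by (cases n)
  show ?thesis
  proof (cases "A \<subseteq> {..d} \<and> card A = d - 1")
    case True
    have sub: "?F \<subseteq> (\<lambda>j. ((w, insert j A), A)) ` ({..d} - A)"
    proof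
      fix \<phi> assume "\<phi> \<in> ?F"
      then have "\<phi> \<in> ridge_flags d W" and eq: "flag_node \<phi> = (w, A)" unfolding n by auto
      then obtain w' S A' where "\<phi> = ((w', S), A')" "S \<subseteq> {..d}" "card S = d" "A' \<subseteq> S"
        unfolding ridge_flags_def by blast
      with eq have S: "\<phi> = ((w, S), A)" "S \<subseteq> {..d}" "card S = d" "A \<subseteq> S" by simp_all
      have fin: "finite S" using S by (auto intro: finite_subset)
      then have "card (S - A) = 1" using S True assms card_Diff_subset[of A S] finite_subset by auto
      then obtain j where "S - A = {j}" by (auto simp: card_1_singleton_iff)
      then have "S = insert j A" "j \<in> {..d} - A" using S by auto
      then show "\<phi> \<in> (\<lambda>j. ((w, insert j A), A)) ` ({..d} - A)" using S by auto
    qed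
    have "card ({..d} - A) = 2"
      using True assms card_Diff_subset[of A "{..d}"] finite_subset[of A "{..d}"] by auto
    then have "card ((\<lambda>j. ((w, insert j A), A)) ` ({..d} - A)) \<le> 2"
      using card_image_le[of "{..d} - A" "\<lambda>j. ((w, insert j A), A)"] by simp
    moreover have "card ?F \<le> card ((\<lambda>j. ((w, insert j A), A)) ` ({..d} - A))"
      by (rule card_mono[OF _ sub]) simp
    moreover have "finite ?F" by (rule finite_subset[OF sub]) simp
    ultimately show ?thesis by simp
  next
    case False
    have "A \<subseteq> {..d} \<and> card A = d - 1" if "\<phi> \<in> ?F" for \<phi>
    proof -
      have \<phi>: "\<phi> \<in> ridge_flags d W" "flag_node \<phi> = (w, A)" using that unfolding n by auto
      then obtain w' S A' where "\<phi> = ((w', S), A')" "S \<subseteq> {..d}" "A' \<subseteq> S" "card A' = d - 1"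
        unfolding ridge_flags_def by blast
      with \<phi>(2) show ?thesis by auto
    qed
    then have empty: "?F = {}" using False by blast
    show ?thesis unfolding empty by simp
  qed
qed

lemma card_free_flags_in_class:
  assumes "1 \<le> d" "finite W" "valid d W G" "card (snd x) = d - 1"
  shows "card {\<phi> \<in> ridge_flags d W. fst \<phi> \<notin> used d G \<and> (flag_node \<phi>, x) \<in> eqv G} \<le> 2"
proof -
  note G = validD[OF assms(3)]
  \<comment> \<open>A pair in \<open>Q\<close> consists of two facets identified by some
    \<open>g\<close> together with ridges in them that the same \<open>g\<close> identifies.\<close>
  define Q where "Q = {{(x, A), (y, B)} |x y A B. \<exists>g\<in>G. (x, y) \<in> g \<and> card (snd x) = d \<and>
    ((fst x, A), (fst y, B)) \<in> g \<and> card A = d - 1}"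
  have step: "((x, A), (y, B)) \<in> ridge_flags d W \<times> ridge_flags d W \<and> x \<noteq> y \<and>
      x \<in> slots d g \<and> y \<in> slots d g"
    if g: "g \<in> G" "(x, y) \<in> g" "card (snd x) = d" "((fst x, A), (fst y, B)) \<in> g" "card A = d - 1"
    for x y A B g
  proof -
    obtain S f where f: "g = glue (fst x) S (fst y) f" "gluing_data d W (fst x) S (fst y) f"
      "A \<subseteq> S" "B = f ` A"
      using gluing_stepE[OF subsetD[OF G g(1)] g(4)] by (metis fst_conv snd_conv)
    have "snd x \<subseteq> S \<and> snd y = f ` snd x"
      using f(2) g(2) mem_glue_forward[of "fst x" "fst y" "snd x" "snd y" S f]
      unfolding f(1) gluing_data_def by simp
    moreover have "finite S" "card S = d" using f by (auto simp: gluing_data_def finite_subset)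
    ultimately have S: "snd x = S" "snd y = f ` S" using g(3) card_subset_eq[of S "snd x"] by auto
    have "card (f ` S) = d" "card B = d - 1"
      using f g by (auto simp: gluing_data_def card_image inj_on_subset)
    then show ?thesis
      using f(2-4) S g(3,5) unfolding f(1) slots_glue[OF f(2)] ridge_flags_def gluing_data_def
      by (cases x, cases y) auto
  qed
  have QF: "card q = 2 \<and> q \<subseteq> ridge_flags d W" if qQ: "q \<in> Q" for q
  proof -
    obtain x y A B g where q: "q = {(x, A), (y, B)}" "g \<in> G" "(x, y) \<in> g" "card (snd x) = d"
      "((fst x, A), (fst y, B)) \<in> g" "card A = d - 1"
      using qQ unfolding Q_def mem_Collect_eq by metis
    show ?thesis using step[OF q(2-6)] unfolding q(1) by simp
  qed
  have QI: "{(x, A), (y, B)} \<in> Q"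
    if "g \<in> G" "(x, y) \<in> g" "card (snd x) = d" "((fst x, A), (fst y, B)) \<in> g" "card A = d - 1"
    for g x y A B
    using that unfolding Q_def by blast
  have Qfin: "finite Q"
    by (rule finite_subset[of _ "Pow (ridge_flags d W)"])
      (use QF finite_ridge_flags[OF assms(2)] in auto)
  have Qpartner: "\<exists>g y B. g \<in> G \<and> q = {(x, A), (y, B)} \<and> x \<in> slots d g \<and> (x, y) \<in> g \<and>
      ((fst x, A), (fst y, B)) \<in> g" if "q \<in> Q" "(x, A) \<in> q" for q x A
  proof -
    obtain x1 y1 A1 B1 g where q: "q = {(x1, A1), (y1, B1)}" "g \<in> G" "(x1, y1) \<in> g"
      "card (snd x1) = d" "((fst x1, A1), (fst y1, B1)) \<in> g" "card A1 = d - 1"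
      using \<open>q \<in> Q\<close> unfolding Q_def mem_Collect_eq by metis
    have "(y1, x1) \<in> g" "((fst y1, B1), (fst x1, A1)) \<in> g"
      using q G gluing_sym by blast+
    moreover have "x1 \<in> slots d g" "y1 \<in> slots d g" using step[OF q(2-6)] by auto
    moreover have "x = x1 \<and> A = A1 \<or> x = y1 \<and> A = B1" using that(2) q(1) by simp
    moreover have "q = {(y1, B1), (x1, A1)}" using q(1) by (rule trans[OF _ insert_commute])
    ultimately show ?thesis using q(1-3,5) by metis
  qed
  \<comment> \<open>A flag determines its facet, validity the gluing that uses this facet, and
    single-valuedness the partner facet and the partner ridge.\<close>
  have Qdisj: "q \<inter> r = {}" if qr: "q \<in> Q" "r \<in> Q" "q \<noteq> r" for q r
  proof (rule ccontr)
    assume "q \<inter> r \<noteq> {}"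
    then obtain x A where xA: "(x, A) \<in> q" "(x, A) \<in> r" by auto
    obtain g y B where g: "g \<in> G" "q = {(x, A), (y, B)}" "x \<in> slots d g" "(x, y) \<in> g"
      "((fst x, A), (fst y, B)) \<in> g" using Qpartner[OF qr(1) xA(1)] by blast
    obtain h z C where h: "h \<in> G" "r = {(x, A), (z, C)}" "x \<in> slots d h" "(x, z) \<in> h"
      "((fst x, A), (fst z, C)) \<in> h" using Qpartner[OF qr(2) xA(2)] by blast
    have gh: "g = h" by (rule valid_disjoint[OF assms(3) g(1) h(1) g(3) h(3)])
    have "y = z" using gluing_single_valued[OF subsetD[OF G h(1)]] g(4) h(4) gh by blast
    moreover then have "B = C"
      using gluing_single_valued[OF subsetD[OF G h(1)] h(5)] g(5) gh by blast
    ultimately show False using g h qr(3) by simp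
  qed
  have eqvR: "(n, x) \<in> {(flag_node a, flag_node b) |a b. {a, b} \<in> Q}\<^sup>*"
    if "(n, x) \<in> eqv G" for n
    using that unfolding eqv_def
  proof (induction rule: converse_rtrancl_induct)
    case (step m n)
    have card: "card (snd n) = d - 1" using eqv_card[OF G, of n x] step(2) assms(4)
      unfolding eqv_def by auto
    obtain g where g: "g \<in> G" "(m, n) \<in> g" using step by auto
    obtain S f where f: "g = glue (fst m) S (fst n) f" "gluing_data d W (fst m) S (fst n) f"
      "snd m \<subseteq> S" "snd n = f ` snd m"
      using gluing_stepE[OF subsetD[OF G g(1)] g(2)] by metis
    have cm: "card (snd m) = d - 1" using card gluing_step_card(1)[of g d W m n] g G by auto
    have "((fst m, S), (fst n, f ` S)) \<in> g" using f by (auto simp: mem_glue)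
    moreover have "card S = d" using f by (simp add: gluing_data_def)
    ultimately have "{((fst m, S), snd m), ((fst n, f ` S), snd n)} \<in> Q"
      using QI[of g "(fst m, S)" "(fst n, f ` S)" "snd m" "snd n"] g cm by simp
    then have "(flag_node ((fst m, S), snd m), flag_node ((fst n, f ` S), snd n))
        \<in> {(flag_node a, flag_node b) |a b. {a, b} \<in> Q}"
      by blast
    then have "(m, n) \<in> {(flag_node a, flag_node b) |a b. {a, b} \<in> Q}" by simp
    then show ?case using step.IH by (rule converse_rtrancl_into_rtrancl)
  qed simp
  have free: "\<phi> \<notin> \<Union>Q" if unused: "fst \<phi> \<notin> used d G" for \<phi>
  proof
    assume "\<phi> \<in> \<Union>Q"
    then obtain q where "q \<in> Q" "(fst \<phi>, snd \<phi>) \<in> q" by auto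
    then obtain g where "g \<in> G" "fst \<phi> \<in> slots d g" using Qpartner by blast
    then show False using unused by (auto simp: used_def)
  qed
  have sub: "{\<phi> \<in> ridge_flags d W. fst \<phi> \<notin> used d G \<and> (flag_node \<phi>, x) \<in> eqv G} \<subseteq>
    {\<phi> \<in> ridge_flags d W. \<phi> \<notin> \<Union>Q \<and>
      (flag_node \<phi>, x) \<in> {(flag_node a, flag_node b) |a b. {a, b} \<in> Q}\<^sup>*}"
    using eqvR free by blast
  have "finite {\<phi> \<in> ridge_flags d W. \<phi> \<notin> \<Union>Q \<and>
      (flag_node \<phi>, x) \<in> {(flag_node a, flag_node b) |a b. {a, b} \<in> Q}\<^sup>*} \<and>
    card {\<phi> \<in> ridge_flags d W. \<phi> \<notin> \<Union>Q \<and>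
      (flag_node \<phi>, x) \<in> {(flag_node a, flag_node b) |a b. {a, b} \<in> Q}\<^sup>*} \<le> 2"
    by (rule card_unmatched_flags[OF Qfin QF Qdisj card_flags_at_node[OF assms(1)]])
  then show ?thesis using card_mono[OF _ sub] le_trans by blast
qed

lemma joins_flags:
  assumes "joins d W G w S v f A"
  shows "((w, S), A) \<in> ridge_flags d W" "((v, f ` S), f ` A) \<in> ridge_flags d W"
    "(w, S) \<notin> used d G" "(v, f ` S) \<notin> used d G"
    "((w, S), A) \<noteq> ((v, f ` S), f ` A)" "((w, A), (v, f ` A)) \<in> eqv G"
proof -
  have dat: "w \<in> W" "v \<in> W" "w \<noteq> v" "S \<subseteq> {..d}" "card S = d" "f ` S \<subseteq> {..d}" "inj_on f S"
    and A: "A \<subseteq> S" "card A = d - 1"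
    using assms unfolding joins_def gluing_data_def by blast+
  have "card (f ` S) = card S" "card (f ` A) = card A"
    using dat(7) inj_on_subset[OF dat(7) A(1)] by (simp_all add: card_image)
  then show "((w, S), A) \<in> ridge_flags d W" "((v, f ` S), f ` A) \<in> ridge_flags d W"
    "(w, S) \<notin> used d G" "(v, f ` S) \<notin> used d G"
    "((w, S), A) \<noteq> ((v, f ` S), f ` A)" "((w, A), (v, f ` A)) \<in> eqv G"
    using assms dat A image_mono[OF A(1), of f] unfolding joins_def ridge_flags_def by simp_all
qed

text \<open>On \<open>A\<close> both maps send a vertex into its own class, and \<open>v\<close> has
  only one vertex in that class by regularity. The single vertex of \<open>S - A\<close> must go to
  the single label left in the common image.\<close>

lemma joins_glue_eq:
  assumes "valid d W G" "joins d W G w S v f A" "joins d W G w S v f' A" "f ` S = f' ` S" "1 \<le> d"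
  shows "glue w S v f = glue w S v f'"
proof (rule glue_cong)
  have dat: "inj_on f S" "inj_on f' S" "S \<subseteq> {..d}" "card S = d" "f ` S \<subseteq> {..d}" "v \<in> W"
    and A: "A \<subseteq> S" "card A = d - 1"
    using assms by (auto simp: joins_def gluing_data_def)
  have onA: "f x = f' x" if "x \<in> A" for x
  proof -
    have "((w, {x}), (v, f ` {x})) \<in> eqv G" "((w, {x}), (v, f' ` {x})) \<in> eqv G"
      using assms(2,3) that unfolding joins_def by blast+
    then have "((v, f ` {x}), (v, f' ` {x})) \<in> eqv G"
      using eqv_sym[OF validD[OF assms(1)]] eqv_trans by blast
    moreover have "f ` {x} \<subseteq> f ` S" "f' ` {x} \<subseteq> f' ` S" using that A(1) by auto
    then have "f ` {x} \<subseteq> {..d}" "f' ` {x} \<subseteq> {..d}"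
      using dat(5) assms(4) by (simp_all only: order_trans)
    ultimately have "f ` {x} = f' ` {x}" by (intro valid_regular[OF assms(1) dat(6)])
    then show ?thesis by simp
  qed
  have "finite A" using A dat by (meson finite_atMost finite_subset)
  then have "card (S - A) = 1" using A dat(4) assms(5) card_Diff_subset[of A S] by auto
  then obtain u where u: "S - A = {u}" by (auto simp: card_1_singleton_iff)
  have "f ` (S - A) = f ` S - f ` A" "f' ` (S - A) = f' ` S - f' ` A"
    using inj_on_image_set_diff[OF dat(1) _ A(1), of S] inj_on_image_set_diff[OF dat(2) _ A(1), of S]
    by simp_all
  moreover have "f ` A = f' ` A" using onA by (auto intro: image_cong)
  ultimately have "f ` (S - A) = f' ` (S - A)" using assms(4) by simp
  then have "f u = f' u" using u by simp
  then show "f x = f' x" if "x \<in> S" for x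
  proof (cases "x \<in> A")
    case False
    then have "x \<in> S - A" using that by simp
    then show ?thesis using \<open>f u = f' u\<close> unfolding u by simp
  qed (rule onA)
qed

text \<open>The class has at most two free flags and each gluing needs two of them. So both gluings
  close the same path, in the same or in opposite directions, and \<open>joins_glue_eq\<close>
  compares them after a swap if needed.\<close>

lemma joins_in_class_unique:
  assumes "1 \<le> d" "finite W" "valid d W G"
    and "joins d W G w S v f A" "joins d W G w' S' v' f' A'"
    and "((w, A), (w', A')) \<in> eqv G"
  shows "glue w S v f = glue w' S' v' f'"
proof -
  note G = validD[OF assms(3)]
  let ?X = "{\<phi> \<in> ridge_flags d W. fst \<phi> \<notin> used d G \<and> (flag_node \<phi>, (w, A)) \<in> eqv G}"
  let ?a = "((w, S), A)" and ?b = "((v, f ` S), f ` A)"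
    and ?a' = "((w', S'), A')" and ?b' = "((v', f' ` S'), f' ` A')"
  have c: "card ?X \<le> 2"
    by (rule card_free_flags_in_class[OF assms(1-3)]) (use assms(4) in \<open>auto simp: joins_def\<close>)
  have fin: "finite ?X" using finite_ridge_flags[OF assms(2)] by simp
  note j = joins_flags[OF assms(4)] and j' = joins_flags[OF assms(5)]
  have cls: "((v, f ` A), (w, A)) \<in> eqv G" "((w', A'), (w, A)) \<in> eqv G"
    "((v', f' ` A'), (w, A)) \<in> eqv G"
    using eqv_sym[OF G] j(6) j'(6) assms(6) eqv_trans by blast+
  have sub: "{?a, ?b} \<subseteq> ?X" "{?a', ?b'} \<subseteq> ?X"
    using j(1-4) j'(1-4) cls by auto
  have "card {?a, ?b} = 2" "card {?a', ?b'} = 2" using j(5) j'(5) by auto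
  then have "{?a, ?b} = ?X" "{?a', ?b'} = ?X"
    using card_seteq[OF fin sub(1)] card_seteq[OF fin sub(2)] c by auto
  then have "{?a', ?b'} = {?a, ?b}" by simp
  then have "?a' = ?a \<and> ?b' = ?b \<or> ?a' = ?b \<and> ?b' = ?a"
    by (simp only: doubleton_eq_iff)
  then show ?thesis
  proof
    assume "?a' = ?a \<and> ?b' = ?b"
    then have "w' = w" "S' = S" "A' = A" "v' = v" "f ` S = f' ` S" by auto
    then show ?thesis using joins_glue_eq[OF assms(3) assms(4) _ _ assms(1), of f'] assms(5) by simp
  next
    assume "?a' = ?b \<and> ?b' = ?a"
    then have eq: "w' = v" "S' = f ` S" "A' = f ` A" "v' = w" "f' ` f ` S = S" by auto
    have inj: "inj_on f S" using assms(4) by (auto simp: joins_def gluing_data_def)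
    have "joins d W G v (f ` S) w (inv_into S f) (f ` A)" by (rule joins_swap[OF assms(4) G])
    moreover have "joins d W G v (f ` S) w f' (f ` A)" using assms(5) eq by simp
    moreover have "inv_into S f ` f ` S = f' ` f ` S"
      using eq inv_into_image_cancel[OF inj] by simp
    ultimately have "glue v (f ` S) w (inv_into S f) = glue v (f ` S) w f'"
      by (rule joins_glue_eq[OF assms(3) _ _ _ assms(1)])
    then show ?thesis using eq glue_swap[OF inj] by simp
  qed
qed

section \<open>Availability of ridge gluings and its exchange property\<close>

lemma ridge_gluings_subset: "ridge_gluings d W G \<subseteq> gluings d W"
  unfolding ridge_gluings_def gluings_def joins_def by blast

lemma ridge_gluings_unused:
  assumes "g \<in> ridge_gluings d W G"
  shows "slots d g \<inter> used d G = {}" "g \<notin> G"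
proof -
  obtain w S v f A where g: "g = glue w S v f" "joins d W G w S v f A"
    using assms by (auto simp: ridge_gluings_def)
  have "slots d g = {(w, S), (v, f ` S)}"
    using g slots_glue[of d W w S v f] by (simp add: joins_def)
  then show "slots d g \<inter> used d G = {}" "g \<notin> G" using g by (auto simp: joins_def used_def)
qed

text \<open>Identifications persist when \<open>G\<close> grows, so only the freedom of the two
  facets can be lost; disjointness of slots in \<open>insert g G'\<close> says that nobody in
  \<open>G'\<close> has taken them.\<close>

lemma ridge_gluings_mono:
  assumes "g \<in> ridge_gluings d W G" "G \<subseteq> G'" "g \<notin> G'" "valid d W (insert g G')"
  shows "g \<in> ridge_gluings d W G'"
proof -
  obtain w S v f A where g: "g = glue w S v f" "joins d W G w S v f A"
    using assms by (auto simp: ridge_gluings_def)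
  have "slots d g = {(w, S), (v, f ` S)}"
    using g slots_glue[of d W w S v f] by (simp add: joins_def)
  moreover have "slots d g \<inter> used d G' = {}"
    using assms(3) valid_disjoint[OF assms(4), of g] unfolding used_def by fast
  ultimately have "joins d W G' w S v f A"
    using g(2) eqv_mono[OF assms(2)] unfolding joins_def by auto
  then show ?thesis using g(1) unfolding ridge_gluings_def by blast
qed

text \<open>A chain that is not one of \<open>G\<close> has a step of \<open>g\<close>, and at that
  step it stands at a face that \<open>g\<close> moves. This locates the place where
  \<open>g\<close> helped.\<close>

lemma eqv_insert_cases:
  assumes "(x, y) \<in> eqv (insert g G)"
  shows "(x, y) \<in> eqv G \<or> (\<exists>z\<in>Domain g. (x, z) \<in> eqv (insert g G))"
  using assms unfolding eqv_def
proof (induction rule: rtrancl_induct)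
  case (step y z)
  from step.IH show ?case
  proof
    assume xy: "(x, y) \<in> (\<Union>G)\<^sup>*"
    show ?thesis
    proof (cases "(y, z) \<in> \<Union>G")
      case True
      then show ?thesis using xy by (meson rtrancl.rtrancl_into_rtrancl)
    next
      case False
      then have "y \<in> Domain g" using step.hyps by auto
      then show ?thesis using step.hyps(1) by blast
    qed
  qed blast
qed simp

text \<open>The class of the ridge along which \<open>g\<close> is glued is a path in \<open>G\<close> with the two slots of \<open>g\<close>
  at its ends, and \<open>g\<close> closes it to a cycle. So it meets \<open>g\<close> nowhere else and has no free flags
  afterwards.\<close>

lemma ridge_class_closed:
  assumes "1 \<le> d" "finite W" "valid d W (insert g G)"
    and g: "g = glue w S v f" "joins d W G w S v f A"
    and "(y, (w, A)) \<in> eqv (insert g G)" "\<phi> \<in> ridge_flags d W" "flag_node \<phi> = y"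
  shows "fst \<phi> \<in> used d (insert g G)"
proof (rule ccontr)
  assume unused: "fst \<phi> \<notin> used d (insert g G)"
  have v: "valid d W G" using valid_subset[OF assms(3)] by blast
  note G = validD[OF v] and G' = validD[OF assms(3)]
  let ?X = "{\<phi> \<in> ridge_flags d W. fst \<phi> \<notin> used d G \<and> (flag_node \<phi>, (w, A)) \<in> eqv G}"
  let ?a = "((w, S), A)" and ?b = "((v, f ` S), f ` A)"
  have dat: "gluing_data d W w S v f" and A: "A \<subseteq> S" "card A = d - 1"
    using g(2) by (auto simp: joins_def)
  have inj: "inj_on f S" using dat by (simp add: gluing_data_def)
  have c: "card ?X \<le> 2"
    by (rule card_free_flags_in_class[OF assms(1,2) v]) (use A in simp)
  have fin: "finite ?X" using finite_ridge_flags[OF assms(2)] by simp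
  note j = joins_flags[OF g(2)]
  have "((v, f ` A), (w, A)) \<in> eqv G" using eqv_sym[OF G j(6)] .
  then have sub: "{?a, ?b} \<subseteq> ?X" using j by auto
  have "card {?a, ?b} = 2" using j(5) by auto
  \<comment> \<open>The bound of two free flags is attained by the two ends that \<open>g\<close>
    joins, so there is no third.\<close>
  then have X: "?X = {?a, ?b}" using card_seteq[OF fin sub] c by auto
  have "(y, (w, A)) \<in> eqv G"
    using assms(6) unfolding eqv_def
  proof (induction rule: converse_rtrancl_induct)
    case (step x y)
    have yA: "(y, (w, A)) \<in> eqv G" using step.IH by (simp add: eqv_def)
    show ?case
    proof (cases "(x, y) \<in> \<Union>G")
      case True
      then show ?thesis using step.IH by (rule converse_rtrancl_into_rtrancl)
    next
      case False
      then have "(x, y) \<in> g" using step.hyps by auto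
      then obtain C where C: "C \<subseteq> S" "x = (w, C) \<and> y = (v, f ` C) \<or> x = (v, f ` C) \<and> y = (w, C)"
        unfolding g(1) mem_glue by blast
      have inj_C: "inj_on f C" using inj_on_subset[OF inj C(1)] .
      have "card C = d - 1"
        using eqv_card[OF G yA] C(2) A(2) card_image[OF inj_C] by auto
      then have fl: "((w, S), C) \<in> ridge_flags d W" "((v, f ` S), f ` C) \<in> ridge_flags d W"
        using dat C(1) card_image[OF inj_C] card_image[OF inj]
        by (auto simp: ridge_flags_def gluing_data_def)
      \<comment> \<open>The flag of \<open>g\<close> at the face already known to be in the class is
        free before \<open>g\<close> is made. It must be one of the two in \<open>?X\<close>, so
        within this class \<open>g\<close> acts only at \<open>A\<close>.\<close>
      from C(2) have "C = A"
      proof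
        assume "x = (w, C) \<and> y = (v, f ` C)"
        then have "((v, f ` S), f ` C) \<in> ?X" using fl yA j by simp
        then have "f ` C = f ` A" using X dat by (auto simp: gluing_data_def)
        then show ?thesis using inj_on_image_eq_iff[OF inj C(1) A(1)] by simp
      next
        assume "x = (v, f ` C) \<and> y = (w, C)"
        then have "((w, S), C) \<in> ?X" using fl yA j by simp
        then show ?thesis using X dat by (auto simp: gluing_data_def)
      qed
      then have "(x, (w, A)) \<in> eqv G"
        using C(2) \<open>((v, f ` A), (w, A)) \<in> eqv G\<close> by auto
      then show ?thesis by (simp add: eqv_def)
    qed
  qed simp
  then have "\<phi> \<in> ?X" using assms(7,8) unused by (auto simp: used_def)
  then have "\<phi> \<in> {?a, ?b}" by (simp only: X)
  then have "fst \<phi> = (w, S) \<or> fst \<phi> = (v, f ` S)" by auto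
  then have "fst \<phi> \<in> slots d g" using slots_glue[OF dat] g(1) by auto
  then show False using unused by (auto simp: used_def)
qed

text \<open>The ends joined by a new \<open>h\<close> were not equivalent before, so their chain
  runs through \<open>g\<close>, at a face with \<open>d - 1\<close> labels: a ridge
  \<open>C\<close> of the glued facet. It is not \<open>A\<close>, whose class is closed by
  \<open>g\<close>.\<close>

lemma new_ridge_gluing_cases:
  assumes "1 \<le> d" "finite W" "valid d W (insert g G)"
    and g: "g = glue w S v f" "joins d W G w S v f A"
    and h: "h \<in> ridge_gluings d W (insert g G) - ridge_gluings d W G"
  shows "\<exists>B \<in> {B. B \<subseteq> S \<and> card B = d - 1} - {A}. \<exists>w' S' v' f' A'. h = glue w' S' v' f' \<and>
    joins d W (insert g G) w' S' v' f' A' \<and> ((w', A'), (w, B)) \<in> eqv (insert g G)"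
proof -
  have v: "valid d W G" using valid_subset[OF assms(3)] by blast
  note G = validD[OF v] and G' = validD[OF assms(3)]
  obtain w' S' v' f' A' where h': "h = glue w' S' v' f'" "joins d W (insert g G) w' S' v' f' A'"
    using h by (auto simp: ridge_gluings_def)
  have A': "card A' = d - 1" and dat': "gluing_data d W w' S' v' f'" and A'S: "A' \<subseteq> S'"
    and dat: "gluing_data d W w S v f"
    using h'(2) g(2) by (auto simp: joins_def)
  note j = joins_flags[OF h'(2)]
  \<comment> \<open>Had \<open>G\<close> already identified the two ridges, their faces would be
    identified as well, and by regularity in no other way than by \<open>f'\<close>; then
    \<open>h\<close> would have been available before.\<close>
  have "((w', A'), (v', f' ` A')) \<notin> eqv G"
  proof
    assume path: "((w', A'), (v', f' ` A')) \<in> eqv G"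
    have "((w', B), (v', f' ` B)) \<in> eqv G" if B: "B \<subseteq> A'" for B
    proof -
      obtain D where D: "D \<subseteq> f' ` A'" "((w', B), (v', D)) \<in> eqv G"
        using eqv_transport[OF G path B] by auto
      have "((w', B), (v', f' ` B)) \<in> eqv (insert g G)" using h'(2) B by (auto simp: joins_def)
      moreover have "((v', D), (w', B)) \<in> eqv (insert g G)"
        using eqv_mono[of G "insert g G"] eqv_sym[OF G'] D(2) by blast
      ultimately have "((v', D), (v', f' ` B)) \<in> eqv (insert g G)" using eqv_trans by blast
      moreover have "D \<subseteq> f' ` S'" "f' ` B \<subseteq> f' ` S'" using D(1) B A'S by blast+
      moreover have "f' ` S' \<subseteq> {..d}" "v' \<in> W" using dat' by (simp_all add: gluing_data_def)
      ultimately have "D = f' ` B"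
        by (intro valid_regular[OF assms(3), of v']) (simp_all only: order_trans)
      then show ?thesis using D by simp
    qed
    then have "joins d W G w' S' v' f' A'"
      using h'(2) by (auto simp: joins_def used_def)
    then have "h \<in> ridge_gluings d W G" using h'(1) unfolding ridge_gluings_def by blast
    then show False using h by simp
  qed
  then obtain z where z: "z \<in> Domain g" "((w', A'), z) \<in> eqv (insert g G)"
    using eqv_insert_cases[OF j(6)] by metis
  then obtain C where C: "C \<subseteq> S" "z = (w, C) \<or> z = (v, f ` C)"
    unfolding g(1) Domain_iff mem_glue by blast
  have "((v, f ` C), (w, C)) \<in> g" using C(1) unfolding g(1) mem_glue by blast
  then have "((v, f ` C), (w, C)) \<in> eqv (insert g G)" by (rule eqv_glue[rotated]) simp
  then have zC: "((w', A'), (w, C)) \<in> eqv (insert g G)"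
    using z(2) C(2) eqv_trans by metis
  have "card C = d - 1" using eqv_card[OF G' zC] A' by simp
  moreover have "C \<noteq> A"
    using ridge_class_closed[OF assms(1-3) g _ j(1)] zC j(3) by auto
  ultimately show ?thesis using C(1) h' zC by blast
qed

text \<open>The released gluings inject into the ridges of \<open>S\<close> other than
  \<open>A\<close>: each closes the class of such a ridge by \<open>new_ridge_gluing_cases\<close>,
  and a class offers one gluing by \<open>joins_in_class_unique\<close>.\<close>

lemma exchange_system_ridge_gluings:
  assumes "1 \<le> d" "finite W"
  shows "exchange_system (ridge_gluings d W) (valid d W) (d - 1)"
proof
  show "finite M" if "valid d W M" for M
    using finite_subset[OF validD[OF that] finite_gluings[OF assms(2)]] .
  show "valid d W G" if "valid d W M" "G \<subseteq> M" for M G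
    using valid_subset that .
  show "g \<notin> G" if "g \<in> ridge_gluings d W G" for g G
    using ridge_gluings_unused(2)[OF that] .
  show "g \<in> ridge_gluings d W G'" if "g \<in> ridge_gluings d W G" "G \<subseteq> G'" "g \<notin> G'"
    "valid d W (insert g G')" for g G G'
    using ridge_gluings_mono[OF that] .
next
  fix g G
  let ?N = "ridge_gluings d W (insert g G) - ridge_gluings d W G"
  assume gG: "g \<in> ridge_gluings d W G" and v: "valid d W (insert g G)"
  show "finite ?N"
    using finite_subset[OF ridge_gluings_subset finite_gluings[OF assms(2)]] by blast
  obtain w S v f A where g: "g = glue w S v f" "joins d W G w S v f A"
    using gG by (auto simp: ridge_gluings_def)
  have S: "finite S" "card S = d" "A \<subseteq> S" "card A = d - 1"
    using g(2) by (auto simp: joins_def gluing_data_def finite_subset)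
  define P where "P h B \<longleftrightarrow> B \<in> {B. B \<subseteq> S \<and> card B = d - 1} - {A} \<and>
    (\<exists>w' S' v' f' A'. h = glue w' S' v' f' \<and>
      joins d W (insert g G) w' S' v' f' A' \<and> ((w', A'), (w, B)) \<in> eqv (insert g G))" for h B
  have "\<exists>B. P h B" if "h \<in> ?N" for h
    using new_ridge_gluing_cases[OF assms v g that] unfolding P_def by blast
  then obtain b where b: "P h (b h)" if "h \<in> ?N" for h by metis
  have "inj_on b ?N"
  proof (rule inj_onI)
    fix h k assume hk: "h \<in> ?N" "k \<in> ?N" "b h = b k"
    obtain w1 S1 v1 f1 A1 where 1: "h = glue w1 S1 v1 f1" "joins d W (insert g G) w1 S1 v1 f1 A1"
      "((w1, A1), (w, b h)) \<in> eqv (insert g G)"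
      using b[OF hk(1)] unfolding P_def by blast
    obtain w2 S2 v2 f2 A2 where 2: "k = glue w2 S2 v2 f2" "joins d W (insert g G) w2 S2 v2 f2 A2"
      "((w2, A2), (w, b h)) \<in> eqv (insert g G)"
      using b[OF hk(2)] unfolding P_def hk(3) by blast
    have "((w1, A1), (w2, A2)) \<in> eqv (insert g G)"
      using eqv_trans[OF 1(3) eqv_sym[OF validD[OF v] 2(3)]] .
    then show "h = k" using joins_in_class_unique[OF assms v 1(2) 2(2)] 1(1) 2(1) by simp
  qed
  then have "card ?N = card (b ` ?N)" by (rule card_image[symmetric])
  also have "\<dots> \<le> card ({B. B \<subseteq> S \<and> card B = d - 1} - {A})"
  proof (rule card_mono)
    show "finite ({B. B \<subseteq> S \<and> card B = d - 1} - {A})" using S(1) by simp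
    show "b ` ?N \<subseteq> {B. B \<subseteq> S \<and> card B = d - 1} - {A}"
      using b unfolding P_def by blast
  qed
  also have "card ({B. B \<subseteq> S \<and> card B = d - 1} - {A}) = d - 1"
  proof -
    have "card {B. B \<subseteq> S \<and> card B = d - 1} = d choose (d - 1)"
      using n_subsets[OF S(1), of "d - 1"] S(2) by simp
    also have "\<dots> = d" using binomial_symmetric[of 1 d] assms(1) by simp
    finally show ?thesis using S by simp
  qed
  finally show "card ?N \<le> d - 1" .
qed

section \<open>Counting facets and available gluings\<close>

lemma card_used:
  assumes "finite W" "valid d W G"
  shows "card (used d G) = 2 * card G" "used d G \<subseteq> W \<times> {S. S \<subseteq> {..d} \<and> card S = d}"
proof -
  have fin: "finite G" using finite_subset[OF validD[OF assms(2)] finite_gluings[OF assms(1)]] .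
  have sl: "card (slots d g) = 2 \<and> slots d g \<subseteq> W \<times> {S. S \<subseteq> {..d} \<and> card S = d}" if gG: "g \<in> G" for g
  proof -
    obtain w S v f where g: "g = glue w S v f" "gluing_data d W w S v f"
      using validD[OF assms(2)] gG unfolding gluings_def by blast
    have "card (f ` S) = d" using g(2) by (auto simp: gluing_data_def card_image)
    then show ?thesis using g(2) unfolding g(1) slots_glue[OF g(2)] by (simp add: gluing_data_def)
  qed
  have "card (\<Union> (slots d ` G)) = (\<Sum>g\<in>G. card (slots d g))"
  proof (rule card_UN_disjoint[OF fin])
    show "\<forall>g\<in>G. finite (slots d g)" using sl by (metis card.infinite zero_neq_numeral)
    show "\<forall>g\<in>G. \<forall>h\<in>G. g \<noteq> h \<longrightarrow> slots d g \<inter> slots d h = {}"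
      using assms(2) by (auto simp: valid_def)
  qed
  then show "card (used d G) = 2 * card G" using sl by (simp add: used_def)
  show "used d G \<subseteq> W \<times> {S. S \<subseteq> {..d} \<and> card S = d}" using sl by (auto simp: used_def)
qed

lemma card_slots_total:
  assumes "finite W"
  shows "finite (W \<times> {S. S \<subseteq> {..d} \<and> card S = d})"
    "card (W \<times> {S. S \<subseteq> {..d} \<and> card S = d}) = card W * (d + 1)"
proof -
  have "card {S. S \<subseteq> {..d} \<and> card S = d} = d + 1"
    using n_subsets[of "{..d}" d] binomial_symmetric[of 1 "Suc d"] by simp
  then show "card (W \<times> {S. S \<subseteq> {..d} \<and> card S = d}) = card W * (d + 1)"
    by (simp add: card_cartesian_product)
  show "finite (W \<times> {S. S \<subseteq> {..d} \<and> card S = d})" using assms by simp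
qed

lemma card_valid_le:
  assumes "finite W" "valid d W G"
  shows "2 * card G \<le> card W * (d + 1)"
  using card_mono[OF card_slots_total(1)[OF assms(1)] card_used(2)[OF assms]]
  unfolding card_used(1)[OF assms] card_slots_total(2)[OF assms(1)] .

text \<open>Each available gluing closes a path with two ends, and distinct gluings close distinct paths.\<close>

lemma card_ridge_gluings:
  assumes "1 \<le> d" "finite W" "valid d W G"
  shows "2 * card (ridge_gluings d W G) \<le> d * (card W * (d + 1) - 2 * card G)"
proof -
  note G = validD[OF assms(3)]
  let ?R = "ridge_gluings d W G"
  let ?F = "{\<phi> \<in> ridge_flags d W. fst \<phi> \<notin> used d G}"
  let ?T = "W \<times> {S. S \<subseteq> {..d} \<and> card S = d}"
  \<comment> \<open>Since \<open>g\<close> has a presentation from each of its two sides, this one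
    existential collects the flags at both ends of its path.\<close>
  define \<Phi> where "\<Phi> g = {\<phi> \<in> ?F. \<exists>w S v f A. g = glue w S v f \<and> joins d W G w S v f A \<and>
    \<phi> = ((w, S), A)}" for g
  have finR: "finite ?R" using finite_subset[OF ridge_gluings_subset finite_gluings[OF assms(2)]] .
  have finF: "finite ?F" using finite_ridge_flags[OF assms(2)] by simp
  have fin\<Phi>: "finite (\<Phi> g)" for g unfolding \<Phi>_def by (rule finite_subset[OF _ finF]) blast
  have two: "2 \<le> card (\<Phi> g)" if gR: "g \<in> ?R" for g
  proof -
    obtain w S v f A where g: "g = glue w S v f" "joins d W G w S v f A"
      using gR unfolding ridge_gluings_def by blast
    note j = joins_flags[OF g(2)]
    have "inj_on f S" using g(2) by (auto simp: joins_def gluing_data_def)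
    then have "g = glue v (f ` S) w (inv_into S f)" using glue_swap g(1) by simp
    then have "((v, f ` S), f ` A) \<in> \<Phi> g"
      using joins_swap[OF g(2) G] j(2,4) unfolding \<Phi>_def by auto
    moreover have "((w, S), A) \<in> \<Phi> g" using g j(1,3) unfolding \<Phi>_def by auto
    ultimately have "card {((w, S), A), ((v, f ` S), f ` A)} \<le> card (\<Phi> g)"
      by (intro card_mono[OF fin\<Phi>]) simp
    then show ?thesis using j(5) by simp
  qed
  have disj: "\<Phi> g \<inter> \<Phi> h = {}" if gh: "g \<noteq> h" for g h
  proof (rule ccontr)
    assume "\<Phi> g \<inter> \<Phi> h \<noteq> {}"
    then obtain w S A v f v' f' where "g = glue w S v f" "joins d W G w S v f A"
      "h = glue w S v' f'" "joins d W G w S v' f' A"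
      unfolding \<Phi>_def by blast
    then show False using gh joins_in_class_unique[OF assms, of w S v f A w S v' f' A] by simp
  qed
  have "2 * card ?R \<le> (\<Sum>g\<in>?R. card (\<Phi> g))"
    using sum_mono[of ?R "\<lambda>_. 2" "\<lambda>g. card (\<Phi> g)"] two by simp
  also have "\<dots> = card (\<Union> (\<Phi> ` ?R))"
    using card_UN_disjoint[OF finR, of \<Phi>] fin\<Phi> disj by simp
  also have "\<dots> \<le> card ?F"
    by (rule card_mono[OF finF]) (auto simp: \<Phi>_def)
  also have "?F = Sigma (?T - used d G) (\<lambda>x. {A. A \<subseteq> snd x \<and> card A = d - 1})"
    by (auto simp: ridge_flags_def)
  also have "card \<dots> = (\<Sum>x\<in>?T - used d G. card {A. A \<subseteq> snd x \<and> card A = d - 1})"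
  proof (rule card_SigmaI)
    show "finite (?T - used d G)" using card_slots_total(1)[OF assms(2), of d] by (rule finite_Diff)
    show "\<forall>x\<in>?T - used d G. finite {A. A \<subseteq> snd x \<and> card A = d - 1}"
    proof
      fix x assume "x \<in> ?T - used d G"
      then have "snd x \<subseteq> {..d}" by auto
      then have "finite (snd x)" by (rule finite_subset) simp
      then show "finite {A. A \<subseteq> snd x \<and> card A = d - 1}" by simp
    qed
  qed
  also have "\<dots> = (\<Sum>x\<in>?T - used d G. d)"
  proof (rule sum.cong[OF refl])
    fix x assume "x \<in> ?T - used d G"
    then have "snd x \<subseteq> {..d}" "card (snd x) = d" by auto
    moreover from this(1) have "finite (snd x)" by (rule finite_subset) simp
    ultimately show "card {A. A \<subseteq> snd x \<and> card A = d - 1} = d"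
      using n_subsets[of "snd x" "d - 1"] binomial_symmetric[of 1 d] assms(1) by simp
  qed
  also have "\<dots> = d * (card W * (d + 1) - 2 * card G)"
    using card_Diff_subset[OF finite_subset[OF card_used(2)[OF assms(2,3)] card_slots_total(1)[OF assms(2)]]
        card_used(2)[OF assms(2,3)]]
    unfolding card_used(1)[OF assms(2,3)] card_slots_total(2)[OF assms(2)] by simp
  finally show ?thesis .
qed

section \<open>Counting codes\<close>

text \<open>The new vertex of \<open>u\<close> takes over the label of the vertex opposite the
  shared facet, so the bijection is always \<open>id\<close>. The words alone then determine the
  tree gluings, and no bits are spent on bijections.\<close>

definition tree_gluing :: "nat \<Rightarrow> nat list \<Rightarrow> node rel" where
  "tree_gluing d u = glue (butlast u) ({..d} - {last u}) u id"

definition tree_gluings :: "nat \<Rightarrow> nat list set \<Rightarrow> node rel set" where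
  "tree_gluings d W = tree_gluing d ` (W - {[]})"

definition codes :: "nat \<Rightarrow> nat \<Rightarrow> (nat list set \<times> node rel set) set" where
  "codes d N = {(W, M). grows (children d) {[]} W \<and> finite W \<and> card W = N \<and>
     grows (ridge_gluings d W) (tree_gluings d W) M \<and> valid d W M}"

lemma fst_Domain_glue: "fst ` Domain (glue w S v f) = {w, v}"
  by (force simp: Domain_iff mem_glue image_iff)

text \<open>A gluing is a symmetric relation, so it only reveals the unordered pair of its
  simplices; the child is the longer of the two words.\<close>

lemma inj_on_tree_gluing: "inj_on (tree_gluing d) (W - {[]})"
proof (rule inj_onI)
  fix u u' assume u: "u \<in> W - {[]}" "u' \<in> W - {[]}" "tree_gluing d u = tree_gluing d u'"
  have "{butlast u, u} = {butlast u', u'}"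
    using arg_cong[OF u(3), of "\<lambda>g. fst ` Domain g"] unfolding tree_gluing_def fst_Domain_glue .
  then have "u = u' \<or> u = butlast u' \<and> u' = butlast u" by (auto simp: doubleton_eq_iff)
  moreover have "length (butlast u) < length u" "length (butlast u') < length u'" using u by auto
  ultimately show "u = u'" by force
qed

lemma grows_children_Nil: "grows (children d) {[]} W \<Longrightarrow> [] \<in> W"
  using grows_subset by blast

lemma card_tree_gluings:
  assumes "grows (children d) {[]} W" "finite W"
  shows "card (tree_gluings d W) = card W - 1"
  unfolding tree_gluings_def
  using card_image[OF inj_on_tree_gluing, of d W] grows_children_Nil[OF assms(1)] assms(2) by simp

text \<open>The tree leaves \<open>f = (d + 1) * card W - 2 * (card W - 1) = (d - 1) * card W +
  2\<close> facets free. The exponent is the budget \<open>d f / 2 + (d - 1) f / 2\<close>: gluings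
  available at the start, and \<open>d - 1\<close> for each of at most \<open>f / 2\<close>
  choices.\<close>

lemma card_codes_over_tree:
  assumes "1 \<le> d" "grows (children d) {[]} W" "finite W"
  shows "finite {M. grows (ridge_gluings d W) (tree_gluings d W) M \<and> valid d W M}"
    and "card {M. grows (ridge_gluings d W) (tree_gluings d W) M \<and> valid d W M}
      \<le> 2 ^ ((2 * d - 1) * ((d - 1) * card W + 2) div 2)"
proof -
  let ?G = "tree_gluings d W"
  let ?X = "{M. grows (ridge_gluings d W) ?G M \<and> valid d W M}"
  \<comment> \<open>Each gluing, those of the tree included, takes two facets of the
    \<open>card W\<close> simplices.\<close>
  let ?n = "card W * (d + 1) div 2"
  have "finite ?X \<and> card ?X \<le> 2 ^ ((2 * d - 1) * ((d - 1) * card W + 2) div 2)"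
  proof (cases "?X = {}")
    case True
    show ?thesis unfolding True by simp
  next
    case False
    then obtain M where "grows (ridge_gluings d W) ?G M" "valid d W M" by blast
    \<comment> \<open>A code over \<open>W\<close>, if there is one, contains the tree gluings and
      thereby shows that they are valid, as the count of available gluings requires.\<close>
    then have v: "valid d W ?G" using grows_subset valid_subset by metis
    have cW: "1 \<le> card W"
      using grows_children_Nil[OF assms(2)] assms(3) by (metis One_nat_def Suc_leI card_gt_0_iff empty_iff)
    have cG: "card ?G = card W - 1" using card_tree_gluings[OF assms(2,3)] .
    have f: "card W * (d + 1) - 2 * card ?G = (d - 1) * card W + 2"
    proof -
      have "card W * (d + 1) = (d - 1) * card W + 2 * card W"
        using assms(1) by (cases d) (simp_all add: algebra_simps)
      then show ?thesis using cG cW by simp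
    qed
    have X: "?X = {M. grows (ridge_gluings d W) ?G M \<and> valid d W M \<and> card M \<le> ?n}"
      using card_valid_le[OF assms(3), of d] by force
    let ?R = "ridge_gluings d W ?G"
    have a: "2 * card ?R \<le> d * ((d - 1) * card W + 2)"
      using card_ridge_gluings[OF assms(1,3) v] unfolding f .
    have "2 * (?n - card ?G) \<le> (d - 1) * card W + 2" unfolding f[symmetric] by simp
    then have "(d - 1) * (2 * (?n - card ?G)) \<le> (d - 1) * ((d - 1) * card W + 2)"
      by (rule mult_le_mono2)
    moreover have "2 * (r + c * m) = 2 * r + c * (2 * m)" for r c m :: nat
      by (simp add: algebra_simps)
    ultimately have "2 * (card ?R + (d - 1) * (?n - card ?G)) \<le> (d + (d - 1)) * ((d - 1) * card W + 2)"
      using a unfolding add_mult_distrib by simp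
    moreover have "d + (d - 1) = 2 * d - 1" using assms(1) by simp
    moreover have "x \<le> y div 2" if "2 * x \<le> y" for x y :: nat using that by simp
    ultimately have k: "card ?R + (d - 1) * (?n - card ?G) \<le> (2 * d - 1) * ((d - 1) * card W + 2) div 2"
      by metis
    have finR: "finite ?R" using finite_subset[OF ridge_gluings_subset finite_gluings[OF assms(3)]] .
    show ?thesis
      unfolding X using exchange_system.card_grows[OF exchange_system_ridge_gluings[OF assms(1,3)] finR k]
      by blast
  qed
  then show "finite ?X" "card ?X \<le> 2 ^ ((2 * d - 1) * ((d - 1) * card W + 2) div 2)"
    by simp_all
qed

lemma card_codes:
  assumes "2 \<le> d" "8 \<le> N"
  shows "finite (codes d N)" "card (codes d N) \<le> 2 ^ (d\<^sup>2 * N)"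
proof -
  let ?T = "{W. grows (children d) {[]} W \<and> finite W \<and> card W = N}"
  let ?X = "\<lambda>W. {M. grows (ridge_gluings d W) (tree_gluings d W) M \<and> valid d W M}"
  let ?k = "(2 * d - 1) * ((d - 1) * N + 2) div 2"
  have eq: "codes d N = Sigma ?T ?X" by (auto simp: codes_def)
  have sub: "?T \<subseteq> {W. grows (children d) {[]} W \<and> finite W \<and> card W \<le> N}" by auto
  have fT: "finite ?T" using finite_subset[OF sub card_trees(1)] assms(2) by simp
  have cT: "card ?T \<le> 2 ^ (d * N + 1)"
    using card_mono[OF card_trees(1) sub] card_trees(2)[of N d] assms(2) by simp
  have X: "finite (?X W)" "card (?X W) \<le> 2 ^ ?k" if "W \<in> ?T" for W
    using card_codes_over_tree[of d W] that assms(1) by auto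
  show "finite (codes d N)" unfolding eq using fT X by (intro finite_SigmaI) auto
  have "card (codes d N) = (\<Sum>W\<in>?T. card (?X W))"
    unfolding eq using fT X by (intro card_SigmaI) auto
  also have "\<dots> \<le> card ?T * 2 ^ ?k"
    using sum_bounded_above[of ?T "\<lambda>W. card (?X W)" "2 ^ ?k"] X(2) by simp
  also have "\<dots> \<le> 2 ^ (d * N + 1) * 2 ^ ?k" using cT by simp
  also have "\<dots> = 2 ^ (d * N + 1 + ?k)" by (simp add: power_add)
  also have "\<dots> \<le> 2 ^ (d\<^sup>2 * N)"
  proof (rule power_increasing)
    obtain e where e: "d = e + 2" using assms(1) by (metis add.commute le_Suc_ex)
    have "2 * (d * N + 1 + ?k) \<le> 2 * (d * N + 1) + (2 * d - 1) * ((d - 1) * N + 2)" by simp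
    also have "\<dots> = 2 * (e + 2) * N + 2 + (2 * e + 3) * ((e + 1) * N + 2)"
      unfolding e by (simp add: algebra_simps)
    also have "\<dots> = (2 * e * e + 7 * e + 7) * N + (4 * e + 8)" by (simp add: algebra_simps)
    \<comment> \<open>After doubling, the constant term is \<open>4 d\<close> and the missing part
      of the linear term is \<open>(d - 1) N\<close>, in terms of \<open>e = d - 2\<close>. This is
      where \<open>N \<ge> 8\<close> enters, with equality at \<open>d = 2\<close>.\<close>
    also have "4 * e + 8 \<le> (e + 1) * 8" by simp
    also have "\<dots> \<le> (e + 1) * N" using assms(2) by (intro mult_le_mono) auto
    also have "(2 * e * e + 7 * e + 7) * N + (e + 1) * N = 2 * (d\<^sup>2 * N)"
      unfolding e by (simp add: algebra_simps power2_eq_square)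
    finally show "d * N + 1 + ?k \<le> d\<^sup>2 * N" by simp
  qed simp
  finally show "card (codes d N) \<le> 2 ^ (d\<^sup>2 * N)" .
qed

section \<open>Face posets of simplicial complexes\<close>

lemma order_iso_inv:
  assumes "order_iso A r B s \<phi>"
  shows "order_iso B s A r (inv_into A \<phi>)"
proof -
  have b: "bij_betw \<phi> A B" using assms by (simp add: order_iso_def)
  then have "inv_into A \<phi> x \<in> A" "\<phi> (inv_into A \<phi> x) = x" if "x \<in> B" for x
    using that by (auto simp: bij_betw_def inv_into_into f_inv_into_f)
  then show ?thesis
    using assms bij_betw_inv_into[OF b] unfolding order_iso_def by metis
qed

lemma order_iso_comp:
  assumes "order_iso A r B s \<phi>" "order_iso B s C t \<psi>"
  shows "order_iso A r C t (\<lambda>x. \<psi> (\<phi> x))"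
proof -
  have b: "bij_betw \<phi> A B" "bij_betw \<psi> B C" using assms by (simp_all add: order_iso_def)
  have "bij_betw (\<lambda>x. \<psi> (\<phi> x)) A C" using bij_betw_trans[OF b] by (simp add: o_def)
  moreover have "\<phi> x \<in> B" if "x \<in> A" for x using bij_betwE[OF b(1)] that by blast
  ultimately show ?thesis using assms unfolding order_iso_def by metis
qed

lemma order_iso_restrict:
  assumes "order_iso A r B s \<phi>" "A' \<subseteq> A"
  shows "order_iso A' r (\<phi> ` A') s \<phi>"
  using assms inj_on_subset[of \<phi> A A'] unfolding order_iso_def bij_betw_def by blast

text \<open>Atoms go to atoms, and \<open>x \<in> A\<close> is the order relation between
  \<open>{x}\<close> and \<open>A\<close>. This turns the poset isomorphisms in the construction
  steps into bijections of vertex labels.\<close>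

lemma order_iso_Pow:
  assumes "order_iso (Pow S) (\<subseteq>) (Pow S') (\<subseteq>) \<psi>"
  obtains f where "bij_betw f S S'" "\<And>A. A \<subseteq> S \<Longrightarrow> \<psi> A = f ` A"
proof -
  have b: "bij_betw \<psi> (Pow S) (Pow S')" and le: "\<And>A B. A \<subseteq> S \<Longrightarrow> B \<subseteq> S \<Longrightarrow> A \<subseteq> B \<longleftrightarrow> \<psi> A \<subseteq> \<psi> B"
    using assms by (auto simp: order_iso_def)
  have in_Pow: "\<psi> A \<subseteq> S'" if "A \<subseteq> S" for A using bij_betwE[OF b] that by blast
  have onto: "\<exists>C\<subseteq>S. \<psi> C = D" if D: "D \<subseteq> S'" for D
    using bij_betw_imp_surj_on[OF b] D by (metis PowD PowI imageE)
  have empty: "\<psi> {} = {}"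
  proof -
    obtain C where "C \<subseteq> S" "\<psi> C = {}" using onto[of "{}"] by auto
    then show ?thesis using le[of "{}" C] by simp
  qed
  have inj: "A = B" if "A \<subseteq> S" "B \<subseteq> S" "\<psi> A = \<psi> B" for A B
    using le[of A B] le[of B A] that by auto
  have atom: "\<exists>y. \<psi> {x} = {y}" if x: "x \<in> S" for x
  proof -
    have "\<psi> {x} \<noteq> {}" using inj[of "{x}" "{}"] empty x by auto
    then obtain y where y: "y \<in> \<psi> {x}" by blast
    then obtain C where C: "C \<subseteq> S" "\<psi> C = {y}" using onto[of "{y}"] in_Pow[of "{x}"] x by auto
    then have "C \<subseteq> {x}" using le[of C "{x}"] x y by simp
    moreover have "C \<noteq> {}" using C empty by auto
    ultimately have "C = {x}" by auto
    then show ?thesis using C by blast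
  qed
  then obtain f where f: "\<And>x. x \<in> S \<Longrightarrow> \<psi> {x} = {f x}" by metis
  have mem: "f x \<in> \<psi> A \<longleftrightarrow> x \<in> A" if "x \<in> S" "A \<subseteq> S" for x A
    using le[of "{x}" A] f[OF that(1)] that by auto
  have surj: "\<exists>x\<in>S. f x = y" if "y \<in> S'" for y
  proof -
    obtain C where C: "C \<subseteq> S" "\<psi> C = {y}" using onto[of "{y}"] \<open>y \<in> S'\<close> by auto
    then have "C \<noteq> {}" using empty by auto
    then obtain x where "x \<in> C" by blast
    then show ?thesis using mem[of x C] C by auto
  qed
  have eq: "\<psi> A = f ` A" if A: "A \<subseteq> S" for A
  proof
    show "f ` A \<subseteq> \<psi> A" using mem A by auto
    show "\<psi> A \<subseteq> f ` A"
    proof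
      fix y assume y: "y \<in> \<psi> A"
      then obtain x where "x \<in> S" "f x = y" using surj in_Pow[OF A] by blast
      then show "y \<in> f ` A" using mem[of x A] y A by auto
    qed
  qed
  have "f x = f x' \<longrightarrow> x = x'" if "x \<in> S" "x' \<in> S" for x x'
    using f[OF that(1)] f[OF that(2)] inj[of "{x}" "{x'}"] that by auto
  moreover have "f x \<in> S'" if "x \<in> S" for x using f[OF that] in_Pow[of "{x}"] that by simp
  ultimately have "bij_betw f S S'" using surj unfolding bij_betw_def inj_on_def by blast
  then show thesis using that eq by blast
qed

section \<open>Dimension, antisymmetry and boundary read off from the face poset\<close>

context
  fixes T :: "'a cell_complex"
  assumes T: "simplicial_CW T"
begin

lemma cell_subset_topspace: "e \<in> faces T \<Longrightarrow> e \<subseteq> topspace (fst T)"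
proof -
  have "\<Union> (cells T) = topspace (fst T)" using T unfolding simplicial_CW_def regular_CW_def by blast
  then show "e \<in> faces T \<Longrightarrow> e \<subseteq> topspace (fst T)" unfolding faces_def by blast
qed

lemma lower_interval_empty: "lower_interval T {} = {{}}"
proof
  show "lower_interval T {} \<subseteq> {{}}"
  proof
    fix e assume "e \<in> lower_interval T {}"
    then have "e \<in> faces T" "(fst T) closure_of e \<subseteq> {}"
      by (auto simp: lower_interval_def face_le_def)
    then have "e \<subseteq> {}"
      using closure_of_subset[OF cell_subset_topspace] by (metis order_trans)
    then show "e \<in> {{}}" by simp
  qed
qed (auto simp: lower_interval_def face_le_def faces_def)

lemma card_lower_interval:
  assumes "e \<in> k_cells T k"
  shows "card (lower_interval T e) = 2 ^ (k + 1)"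
proof -
  obtain \<phi> where "bij_betw \<phi> (lower_interval T e) (Pow {..<k + 1})"
    using T assms unfolding simplicial_CW_def boolean_interval_def order_iso_def by blast
  from bij_betw_same_card[OF this] show ?thesis by (simp add: card_Pow)
qed

text \<open>A boolean interval of rank \<open>k + 1\<close> has at least two elements, while only
  the empty face lies below the empty face.\<close>

lemma empty_not_cell: "{} \<notin> cells T"
proof
  assume "{} \<in> cells T"
  then obtain n where "{} \<in> k_cells T n" using T unfolding simplicial_CW_def regular_CW_def by blast
  from card_lower_interval[OF this] show False by (simp add: lower_interval_empty)
qed

text \<open>The size of the interval below a cell stands in for invariance of dimension, so that
  dimensions can be compared through maps of face posets alone.\<close>

lemma k_cells_iff: "e \<in> k_cells T k \<longleftrightarrow> e \<in> faces T \<and> card (lower_interval T e) = 2 ^ (k + 1)"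
proof
  assume "e \<in> k_cells T k"
  then show "e \<in> faces T \<and> card (lower_interval T e) = 2 ^ (k + 1)"
    using card_lower_interval by (auto simp: k_cells_def faces_def)
next
  assume e: "e \<in> faces T \<and> card (lower_interval T e) = 2 ^ (k + 1)"
  then have "e \<noteq> {}" by (auto simp: lower_interval_empty)
  then have "e \<in> cells T" using e by (auto simp: faces_def)
  then obtain n where n: "e \<in> k_cells T n" using T unfolding simplicial_CW_def regular_CW_def by blast
  then have "(2::nat) ^ (n + 1) = 2 ^ (k + 1)" using card_lower_interval e by metis
  then have "n = k" by simp
  then show "e \<in> k_cells T k" using n by simp
qed

lemma face_le_refl: "face_le T e e"
  by (simp add: face_le_def)

lemma face_le_trans: "face_le T e f \<Longrightarrow> face_le T f g \<Longrightarrow> face_le T e g"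
  by (auto simp: face_le_def)

text \<open>\<open>face_le\<close> compares closures, and distinct cells might a priori have equal
  ones. Both cells lie in the boolean interval below \<open>f\<close>, which is
  antisymmetric.\<close>

lemma face_le_antisym:
  assumes "e \<in> faces T" "f \<in> faces T" "face_le T e f" "face_le T f e"
  shows "e = f"
proof (cases "f = {}")
  case True
  then have "e \<in> lower_interval T {}" using assms by (simp add: lower_interval_def)
  then show ?thesis using True by (simp add: lower_interval_empty)
next
  case False
  then have "f \<in> cells T" using assms by (simp add: faces_def)
  then obtain n where "f \<in> k_cells T n" using T unfolding simplicial_CW_def regular_CW_def by blast
  then obtain \<phi> where \<phi>: "order_iso (lower_interval T f) (face_le T) (Pow {..<n + 1}) (\<subseteq>) \<phi>"
    using T unfolding simplicial_CW_def boolean_interval_def by blast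
  have ef: "e \<in> lower_interval T f" "f \<in> lower_interval T f"
    using assms face_le_refl by (auto simp: lower_interval_def)
  then have "\<phi> e = \<phi> f" using \<phi> assms(3,4) unfolding order_iso_def by blast
  then show ?thesis using \<phi> ef by (auto simp: order_iso_def bij_betw_def inj_on_def)
qed

text \<open>The boundary is an intersection of subcomplexes, so it is tested against
  \<open>?L\<close>, the subcomplex generated by the free \<open>(d - 1)\<close>-cells. A
  \<open>(d - 1)\<close>-cell below a free one has an interval of the same size and therefore equals
  it.\<close>

lemma boundary_facets_above:
  assumes "1 \<le> d" "e \<in> k_cells T (d - 1)" "e \<in> pm_boundary d T"
  shows "card (facets_above d T e) = 1"
proof -
  let ?b = "{e \<in> k_cells T (d - 1). card (facets_above d T e) = 1}"
  let ?L = "{e \<in> faces T. e = {} \<or> (\<exists>b\<in>?b. face_le T e b)}"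
  have "subcomplex T ?L"
  proof -
    have "lower_interval T f \<subseteq> ?L" if f: "f \<in> ?L" for f
    proof (cases "f = {}")
      case True
      then show ?thesis using f by (simp add: lower_interval_empty)
    next
      case False
      then obtain b where "b \<in> ?b" "face_le T f b" using f by blast
      then show ?thesis using face_le_trans by (auto simp: lower_interval_def)
    qed
    then show ?thesis by (auto simp: subcomplex_def faces_def)
  qed
  moreover have "?b \<subseteq> ?L" using k_cells_iff face_le_refl by auto
  ultimately have "e \<in> ?L" using assms(3) unfolding pm_boundary_def by blast
  moreover have "e \<noteq> {}" using assms(2) empty_not_cell by (auto simp: k_cells_def)
  ultimately obtain b where b: "b \<in> ?b" "face_le T e b" by blast
  have sub: "lower_interval T e \<subseteq> lower_interval T b"
    using face_le_trans b(2) by (auto simp: lower_interval_def)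
  have c: "card (lower_interval T e) = 2 ^ (d - 1 + 1)" "card (lower_interval T b) = 2 ^ (d - 1 + 1)"
    using card_lower_interval assms(2) b(1) by blast+
  then have "finite (lower_interval T b)" by (intro card_ge_0_finite) simp
  then have "lower_interval T e = lower_interval T b" using card_subset_eq sub c by metis
  moreover have "b \<in> lower_interval T b"
    using b(1) k_cells_iff face_le_refl by (auto simp: lower_interval_def)
  ultimately have "face_le T b e" "b \<in> faces T" by (auto simp: lower_interval_def)
  then have "e = b" using face_le_antisym b assms(2) k_cells_iff by blast
  then show ?thesis using b by simp
qed

lemma simplex_chart:
  assumes "\<Delta> \<in> k_cells T d"
  obtains \<theta> where "order_iso (Pow {..d}) (\<subseteq>) (lower_interval T \<Delta>) (face_le T) \<theta>"
proof -
  obtain \<phi> where "order_iso (lower_interval T \<Delta>) (face_le T) (Pow {..<d + 1}) (\<subseteq>) \<phi>"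
    using T assms unfolding simplicial_CW_def boolean_interval_def by blast
  from order_iso_inv[OF this] that show thesis by (simp add: lessThan_Suc_atMost)
qed

lemma lower_interval_chart:
  assumes "order_iso (Pow V) (\<subseteq>) (lower_interval T \<Delta>) (face_le T) \<theta>" "B \<subseteq> V"
  shows "lower_interval T (\<theta> B) = \<theta> ` Pow B"
proof -
  have b: "bij_betw \<theta> (Pow V) (lower_interval T \<Delta>)"
    and le: "\<And>A B. A \<subseteq> V \<Longrightarrow> B \<subseteq> V \<Longrightarrow> A \<subseteq> B \<longleftrightarrow> face_le T (\<theta> A) (\<theta> B)"
    using assms by (auto simp: order_iso_def)
  have mem: "\<theta> A \<in> faces T" "face_le T (\<theta> A) \<Delta>" if "A \<subseteq> V" for A
    using bij_betwE[OF b] that by (auto simp: lower_interval_def)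
  show ?thesis
  proof
    show "lower_interval T (\<theta> B) \<subseteq> \<theta> ` Pow B"
    proof
      fix e assume e: "e \<in> lower_interval T (\<theta> B)"
      then have "e \<in> lower_interval T \<Delta>"
        using mem(2)[OF assms(2)] face_le_trans by (auto simp: lower_interval_def)
      then obtain A where "A \<subseteq> V" "e = \<theta> A" using bij_betw_imp_surj_on[OF b] by blast
      then show "e \<in> \<theta> ` Pow B" using le[of A B] assms(2) e by (auto simp: lower_interval_def)
    qed
    show "\<theta> ` Pow B \<subseteq> lower_interval T (\<theta> B)"
    proof
      fix e assume "e \<in> \<theta> ` Pow B"
      then obtain A where "A \<subseteq> B" "e = \<theta> A" by blast
      then show "e \<in> lower_interval T (\<theta> B)"
        using le[of A B] assms(2) mem(1)[of A] by (simp add: lower_interval_def)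
    qed
  qed
qed

end

section \<open>Quotient models of cell complexes\<close>

definition nodes :: "nat \<Rightarrow> nat list set \<Rightarrow> node set" where
  "nodes d W = W \<times> Pow {..d}"

text \<open>\<open>p\<close> is the quotient map from disjoint labelled simplices to the faces of
  \<open>T\<close>. The third condition recovers the order of \<open>T\<close> from inclusion of
  labels, which is why \<open>W\<close> and \<open>G\<close> determine the poset; the fourth is
  regularity.\<close>

definition model ::
  "nat \<Rightarrow> 'a cell_complex \<Rightarrow> nat list set \<Rightarrow> node rel set \<Rightarrow> (node \<Rightarrow> 'a set) \<Rightarrow> bool" where
  "model d T W G p \<longleftrightarrow>
     p ` nodes d W = faces T \<and>
     (\<forall>x\<in>nodes d W. \<forall>y\<in>nodes d W. p x = p y \<longleftrightarrow> (x, y) \<in> eqv G) \<and>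
     (\<forall>w\<in>W. \<forall>B\<subseteq>{..d}. lower_interval T (p (w, B)) = (\<lambda>A. p (w, A)) ` Pow B) \<and>
     (\<forall>w\<in>W. inj_on (\<lambda>A. p (w, A)) (Pow {..d}))"

lemma model_image: "model d T W G p \<Longrightarrow> p ` nodes d W = faces T"
  by (simp add: model_def)

lemma model_eq:
  "model d T W G p \<Longrightarrow> x \<in> nodes d W \<Longrightarrow> y \<in> nodes d W \<Longrightarrow> p x = p y \<longleftrightarrow> (x, y) \<in> eqv G"
  by (simp add: model_def)

lemma model_lower:
  "model d T W G p \<Longrightarrow> w \<in> W \<Longrightarrow> B \<subseteq> {..d} \<Longrightarrow>
     lower_interval T (p (w, B)) = (\<lambda>A. p (w, A)) ` Pow B"
  by (simp add: model_def)

lemma model_inj: "model d T W G p \<Longrightarrow> w \<in> W \<Longrightarrow> inj_on (\<lambda>A. p (w, A)) (Pow {..d})"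
  by (simp add: model_def)

lemma model_mem:
  assumes "model d T W G p" "x \<in> nodes d W"
  shows "p x \<in> faces T"
  using imageI[OF assms(2), of p] model_image[OF assms(1)] by simp

lemma mem_nodes: "(w, A) \<in> nodes d W \<longleftrightarrow> w \<in> W \<and> A \<subseteq> {..d}"
  by (simp add: nodes_def)

lemma gluing_nodes:
  assumes "g \<in> gluings d W" "(x, y) \<in> g"
  shows "x \<in> nodes d W" "y \<in> nodes d W"
proof -
  obtain S f where "gluing_data d W (fst x) S (fst y) f" "snd x \<subseteq> S" "snd y = f ` snd x"
    using gluing_stepE[OF assms] by metis
  then have "fst x \<in> W" "snd x \<subseteq> {..d}" "fst y \<in> W" "snd y \<subseteq> {..d}"
    unfolding gluing_data_def by (simp_all, blast+)
  then show "x \<in> nodes d W" "y \<in> nodes d W" using mem_nodes by (metis prod.collapse)+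
qed

lemma eqv_respects:
  assumes "\<And>g x y. g \<in> G \<Longrightarrow> (x, y) \<in> g \<Longrightarrow> p x = p y" "(x, y) \<in> eqv G"
  shows "p x = p y"
  using assms(2) unfolding eqv_def
proof (induction rule: rtrancl_induct)
  case (step y z)
  then obtain g where "g \<in> G" "(y, z) \<in> g" by blast
  then show ?case using step.IH assms(1)[of g y z] by simp
qed simp

lemma model_face_le:
  assumes "model d T W G p" "w \<in> W" "B \<subseteq> {..d}" "x \<in> nodes d W"
  shows "face_le T (p x) (p (w, B)) \<longleftrightarrow> (\<exists>A\<subseteq>B. p x = p (w, A))"
proof -
  have "p x \<in> faces T" using model_mem[OF assms(1,4)] .
  then have "face_le T (p x) (p (w, B)) \<longleftrightarrow> p x \<in> lower_interval T (p (w, B))"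
    by (simp add: lower_interval_def)
  then show ?thesis unfolding model_lower[OF assms(1-3)] by blast
qed

lemma model_order_iso_lower:
  assumes "model d T W G p" "w \<in> W" "B \<subseteq> {..d}"
  shows "order_iso (Pow B) (\<subseteq>) (lower_interval T (p (w, B))) (face_le T) (\<lambda>A. p (w, A))"
proof -
  have inj: "inj_on (\<lambda>A. p (w, A)) (Pow {..d})" using model_inj[OF assms(1,2)] .
  have "A \<subseteq> C \<longleftrightarrow> face_le T (p (w, A)) (p (w, C))" if AC: "A \<subseteq> B" "C \<subseteq> B" for A C
  proof -
    have sub: "A \<subseteq> {..d}" "C \<subseteq> {..d}" using AC assms(3) by auto
    then have "face_le T (p (w, A)) (p (w, C)) \<longleftrightarrow> (\<exists>D\<subseteq>C. p (w, A) = p (w, D))"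
      using model_face_le[OF assms(1,2)] assms(2) by (simp add: mem_nodes)
    moreover have "p (w, A) = p (w, D) \<longleftrightarrow> A = D" if "D \<subseteq> C" for D
      using inj_on_eq_iff[OF inj, of A D] sub that by auto
    ultimately show ?thesis by blast
  qed
  moreover have "inj_on (\<lambda>A. p (w, A)) (Pow B)" using inj assms(3) by (meson Pow_mono inj_on_subset)
  ultimately show ?thesis
    unfolding order_iso_def bij_betw_def using model_lower[OF assms] by auto
qed

lemma model_card_lower:
  assumes "model d T W G p" "w \<in> W" "B \<subseteq> {..d}"
  shows "card (lower_interval T (p (w, B))) = 2 ^ card B"
proof -
  have "finite B" using assms(3) by (rule finite_subset) simp
  moreover have "bij_betw (\<lambda>A. p (w, A)) (Pow B) (lower_interval T (p (w, B)))"
    using model_order_iso_lower[OF assms] by (simp add: order_iso_def)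
  ultimately show ?thesis using bij_betw_same_card card_Pow by metis
qed

lemma model_k_cell:
  assumes "simplicial_CW T" "model d T W G p" "w \<in> W" "B \<subseteq> {..d}"
  shows "p (w, B) \<in> k_cells T k \<longleftrightarrow> card B = k + 1"
proof -
  have "p (w, B) \<in> faces T" using model_mem[OF assms(2)] assms(3,4) by (simp add: mem_nodes)
  moreover have "(2::nat) ^ card B = 2 ^ (k + 1) \<longleftrightarrow> card B = k + 1"
    by (rule power_inject_exp) simp
  ultimately show ?thesis using k_cells_iff[OF assms(1)] model_card_lower[OF assms(2-4)] by metis
qed

lemma model_k_cellE:
  assumes "simplicial_CW T" "model d T W G p" "e \<in> k_cells T k"
  obtains w B where "w \<in> W" "B \<subseteq> {..d}" "card B = k + 1" "e = p (w, B)"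
proof -
  have "e \<in> faces T" using assms(1,3) k_cells_iff by blast
  then obtain w B where wB: "w \<in> W" "B \<subseteq> {..d}" "e = p (w, B)"
    using model_image[OF assms(2)] mem_nodes by (metis imageE surj_pair)
  then show thesis using that model_k_cell[OF assms(1,2) wB(1,2)] assms(3) by metis
qed

text \<open>A used facet lies below the top faces of two simplices, and these are different cells by
  \<open>eqv_facet\<close>. This connects the boundary of \<open>T\<close> with free slots.\<close>

lemma model_unused:
  assumes "simplicial_CW T" "model d T W G p" "G \<subseteq> gluings d W" "w \<in> W" "S \<subseteq> {..d}"
    and "card (facets_above d T (p (w, S))) = 1"
  shows "(w, S) \<notin> used d G"
proof
  assume "(w, S) \<in> used d G"
  then obtain g y where g: "g \<in> G" "((w, S), y) \<in> g"
    unfolding used_def slots_def by blast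
  obtain v B where y: "y = (v, B)" by (cases y)
  have gl: "g \<in> gluings d W" using assms(3) g by blast
  have yn: "v \<in> W" "B \<subseteq> {..d}" using gluing_nodes(2)[OF gl g(2)] y mem_nodes by auto
  have "w \<noteq> v" using gluing_stepE[OF gl g(2)] y unfolding gluing_data_def by auto
  have "((w, S), (v, B)) \<in> eqv G" using eqv_glue[OF g] y by simp
  then have eq: "p (w, S) = p (v, B)"
    using model_eq[OF assms(2), of "(w, S)" "(v, B)"] assms(4,5) yn by (simp add: mem_nodes)
  have "p (w, {..d}) \<in> facets_above d T (p (w, S))"
    using model_k_cell[OF assms(1,2,4), of "{..d}" d] assms(4,5)
      model_face_le[OF assms(2,4), of "{..d}" "(w, S)"]
    by (auto simp: facets_above_def mem_nodes)
  moreover have "p (v, {..d}) \<in> facets_above d T (p (w, S))"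
    using model_k_cell[OF assms(1,2) yn(1), of "{..d}" d] yn
      model_face_le[OF assms(2) yn(1), of "{..d}" "(v, B)"]
    unfolding eq by (auto simp: facets_above_def mem_nodes)
  ultimately have "p (w, {..d}) = p (v, {..d})"
    using assms(6) by (auto simp: card_1_singleton_iff)
  then have "((w, {..d}), (v, {..d})) \<in> eqv G"
    using model_eq[OF assms(2)] assms(4) yn(1) by (simp add: mem_nodes)
  then show False using eqv_facet[OF assms(3)] \<open>w \<noteq> v\<close> by fastforce
qed

text \<open>The regularity clause of \<open>valid\<close> comes for free from injectivity of the
  model on each simplex.\<close>

lemma model_valid:
  assumes "model d T W G p" "G \<subseteq> gluings d W"
    and "\<And>g h. g \<in> G \<Longrightarrow> h \<in> G \<Longrightarrow> g \<noteq> h \<Longrightarrow> slots d g \<inter> slots d h = {}"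
  shows "valid d W G"
proof -
  have "A = B" if "v \<in> W" "A \<subseteq> {..d}" "B \<subseteq> {..d}" "((v, A), (v, B)) \<in> eqv G" for v A B
  proof -
    have "p (v, A) = p (v, B)" using model_eq[OF assms(1)] that by (simp add: mem_nodes)
    then show ?thesis using model_inj[OF assms(1) that(1)] that(2,3) by (auto dest: inj_onD)
  qed
  then show ?thesis using assms(2,3) by (auto simp: valid_def)
qed

lemma valid_insertI:
  assumes "model d T W (insert g G) p" "valid d W G" "g \<in> gluings d W" "slots d g \<inter> used d G = {}"
  shows "valid d W (insert g G)"
proof (rule model_valid[OF assms(1)])
  show "insert g G \<subseteq> gluings d W" using assms(2,3) validD by blast
  show "slots d h \<inter> slots d k = {}" if "h \<in> insert g G" "k \<in> insert g G" "h \<noteq> k" for h k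
  proof -
    have sub: "slots d k \<subseteq> used d G" if "k \<in> G" for k using that by (auto simp: used_def)
    have "slots d h \<inter> slots d k = {}" if "h \<in> G" "k \<in> G"
      using assms(2) that \<open>h \<noteq> k\<close> by (simp add: valid_def)
    then show ?thesis using that sub assms(4) by blast
  qed
qed

text \<open>Any choice \<open>q\<close> of representatives works, because both maps have the classes
  of \<open>eqv G\<close> as fibres and both orders are inclusion of labels.\<close>

lemma model_order_iso:
  assumes "model d T W G p" "model d T' W G p'"
  shows "\<exists>\<phi>. order_iso (faces T) (face_le T) (faces T') (face_le T') \<phi>"
proof -
  define q where "q = inv_into (nodes d W) p"
  have q: "q e \<in> nodes d W" "p (q e) = e" if "e \<in> faces T" for e
    using that model_image[OF assms(1)] by (auto simp: q_def inv_into_into f_inv_into_f)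
  have eq: "p' x = p' y \<longleftrightarrow> p x = p y" if "x \<in> nodes d W" "y \<in> nodes d W" for x y
    using that model_eq[OF assms(1)] model_eq[OF assms(2)] by simp
  have "inj_on (\<lambda>e. p' (q e)) (faces T)"
    by (rule inj_onI) (use q eq in metis)
  moreover have "(\<lambda>e. p' (q e)) ` faces T = faces T'"
  proof
    show "(\<lambda>e. p' (q e)) ` faces T \<subseteq> faces T'" using q(1) model_image[OF assms(2)] by blast
    show "faces T' \<subseteq> (\<lambda>e. p' (q e)) ` faces T"
    proof
      fix e assume "e \<in> faces T'"
      then obtain x where x: "x \<in> nodes d W" "e = p' x" using model_image[OF assms(2)] by blast
      then have "p x \<in> faces T" using model_image[OF assms(1)] by blast
      moreover from q[OF this] have "p' (q (p x)) = e" using eq[of "q (p x)" x] x by simp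
      ultimately show "e \<in> (\<lambda>e. p' (q e)) ` faces T" by blast
    qed
  qed
  moreover have "face_le T e f \<longleftrightarrow> face_le T' (p' (q e)) (p' (q f))"
    if ef: "e \<in> faces T" "f \<in> faces T" for e f
  proof -
    obtain w B where wB: "q f = (w, B)" by (cases "q f")
    then have wB': "w \<in> W" "B \<subseteq> {..d}" using q(1)[OF ef(2)] mem_nodes by auto
    have sub: "(w, A) \<in> nodes d W" if "A \<subseteq> B" for A using that wB' by (auto simp: mem_nodes)
    have "face_le T e f \<longleftrightarrow> (\<exists>A\<subseteq>B. p (q e) = p (w, A))"
      using model_face_le[OF assms(1) wB' q(1)[OF ef(1)]] q(2) ef wB by metis
    also have "\<dots> \<longleftrightarrow> (\<exists>A\<subseteq>B. p' (q e) = p' (w, A))"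
      using eq[OF q(1)[OF ef(1)] sub] by blast
    also have "\<dots> \<longleftrightarrow> face_le T' (p' (q e)) (p' (q f))"
      using model_face_le[OF assms(2) wB' q(1)[OF ef(1)]] wB by metis
    finally show ?thesis .
  qed
  ultimately show ?thesis unfolding order_iso_def bij_betw_def by blast
qed

section \<open>Models of the tree phase\<close>

lemma model_simplex:
  assumes "is_simplex d T"
  shows "\<exists>p. model d T {[]} {} p"
proof -
  obtain F where T: "simplicial_CW T" and F: "F \<in> k_cells T d" "\<And>e. e \<in> cells T \<Longrightarrow> face_le T e F"
    using assms unfolding is_simplex_def by blast
  have all: "lower_interval T F = faces T"
    using F(2) by (auto simp: lower_interval_def faces_def face_le_def)
  obtain \<theta> where \<theta>: "order_iso (Pow {..d}) (\<subseteq>) (lower_interval T F) (face_le T) \<theta>"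
    using simplex_chart[OF T F(1)] .
  have b: "bij_betw \<theta> (Pow {..d}) (faces T)" using \<theta> all by (simp add: order_iso_def)
  have "model d T {[]} {} (\<lambda>x. \<theta> (snd x))"
    unfolding model_def
  proof (intro conjI ballI allI impI)
    show "(\<lambda>x. \<theta> (snd x)) ` nodes d {[]} = faces T"
    proof -
      have "snd ` nodes d {[]} = Pow {..d}" by (simp add: nodes_def)
      then have "\<theta> ` snd ` nodes d {[]} = faces T" using bij_betw_imp_surj_on[OF b] by simp
      then show ?thesis by (simp add: image_image)
    qed
    show "\<theta> (snd x) = \<theta> (snd y) \<longleftrightarrow> (x, y) \<in> eqv {}" if "x \<in> nodes d {[]}" "y \<in> nodes d {[]}" for x y
      using that inj_on_eq_iff[OF bij_betw_imp_inj_on[OF b]] by (auto simp: nodes_def eqv_def)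
    show "lower_interval T (\<theta> (snd (w, B))) = (\<lambda>A. \<theta> (snd (w, A))) ` Pow B"
      if "w \<in> {[]}" "B \<subseteq> {..d}" for w :: "nat list" and B
      using lower_interval_chart[OF T \<theta> that(2)] by simp
    show "inj_on (\<lambda>A. \<theta> (snd (w, A))) (Pow {..d})" for w :: "nat list"
      using bij_betw_imp_inj_on[OF b] by simp
  qed
  then show ?thesis by blast
qed

lemma order_iso_image:
  assumes "bij_betw h V V'"
  shows "order_iso (Pow V) (\<subseteq>) (Pow V') (\<subseteq>) (\<lambda>A. h ` A)"
  unfolding order_iso_def
proof (intro conjI ballI)
  show "bij_betw (\<lambda>A. h ` A) (Pow V) (Pow V')" by (rule bij_betw_Pow[OF assms])
  show "A \<subseteq> B \<longleftrightarrow> h ` A \<subseteq> h ` B" if "A \<in> Pow V" "B \<in> Pow V" for A B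
    using inj_on_image_mem_iff[OF bij_betw_imp_inj_on[OF assms]] that by blast
qed

text \<open>A chart may be composed with any permutation of the labels. The bijection that
  \<open>\<alpha>\<close> induces from \<open>S\<close> to \<open>S'\<close> becomes such a
  permutation by sending the missing label \<open>j\<close> to \<open>j'\<close>.\<close>

lemma extend_chart:
  assumes "order_iso (Pow V) (\<subseteq>) X r \<theta>" "order_iso (Pow S) (\<subseteq>) (Pow S') (\<subseteq>) \<alpha>"
    and "V = insert j S" "j \<notin> S" "V = insert j' S'" "j' \<notin> S'"
  obtains \<theta>' where "order_iso (Pow V) (\<subseteq>) X r \<theta>'" "\<And>A. A \<subseteq> S \<Longrightarrow> \<theta>' A = \<theta> (\<alpha> A)"
proof -
  obtain f where f: "bij_betw f S S'" "\<And>A. A \<subseteq> S \<Longrightarrow> \<alpha> A = f ` A"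
    using order_iso_Pow[OF assms(2)] by metis
  define h where "h = f(j := j')"
  have hS: "h x = f x" if "x \<in> S" for x using that assms(4) by (auto simp: h_def)
  have "bij_betw h S S'" using f(1) bij_betw_cong[of S h f S'] hS by simp
  moreover have "h j = j'" by (simp add: h_def)
  ultimately have "bij_betw h (insert j S) (insert j' S')"
    using notIn_Un_bij_betw[of j S h S'] assms(4,6) by simp
  then have "bij_betw h V V" using assms(3,5) by simp
  from order_iso_comp[OF order_iso_image[OF this] assms(1)]
  have "order_iso (Pow V) (\<subseteq>) X r (\<lambda>A. \<theta> (h ` A))" .
  moreover have "\<theta> (h ` A) = \<theta> (\<alpha> A)" if "A \<subseteq> S" for A
  proof -
    have "h ` A = f ` A" using hS that by (intro image_cong) auto
    then show ?thesis using f(2)[OF that] by simp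
  qed
  ultimately show thesis using that by blast
qed

lemma card_facet_complement:
  assumes "S \<subseteq> {..d}" "card S = d"
  obtains j where "{..d} = insert j S" "j \<notin> S" "j \<le> d" "S = {..d} - {j}"
proof -
  have "finite S" using assms(1) by (rule finite_subset) simp
  then have "card ({..d} - S) = 1" using assms card_Diff_subset[of S "{..d}"] by simp
  then obtain j where j: "{..d} - S = {j}" by (auto simp: card_1_singleton_iff)
  show thesis
  proof (rule that[of j])
    show "{..d} = insert j S" "j \<notin> S" "S = {..d} - {j}" using j assms(1) by blast+
    show "j \<le> d" using j by blast
  qed
qed

lemma lower_interval_embedding:
  assumes "order_iso (faces T) (face_le T) (\<iota> ` faces T) (face_le T') \<iota>"
    "subcomplex T' (\<iota> ` faces T)" "e \<in> faces T"
  shows "lower_interval T' (\<iota> e) = \<iota> ` lower_interval T e"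
proof
  have le: "face_le T x y \<longleftrightarrow> face_le T' (\<iota> x) (\<iota> y)" if "x \<in> faces T" "y \<in> faces T" for x y
    using assms(1) that by (simp add: order_iso_def)
  show "lower_interval T' (\<iota> e) \<subseteq> \<iota> ` lower_interval T e"
  proof
    fix x assume x: "x \<in> lower_interval T' (\<iota> e)"
    then have "x \<in> \<iota> ` faces T" using assms(2,3) unfolding subcomplex_def by blast
    then obtain y where y: "y \<in> faces T" "x = \<iota> y" by blast
    then have "face_le T y e" using le[OF y(1) assms(3)] x by (simp add: lower_interval_def)
    then show "x \<in> \<iota> ` lower_interval T e" using y by (simp add: lower_interval_def)
  qed
  show "\<iota> ` lower_interval T e \<subseteq> lower_interval T' (\<iota> e)"
  proof
    fix x assume "x \<in> \<iota> ` lower_interval T e"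
    then obtain y where y: "y \<in> faces T" "face_le T y e" "x = \<iota> y"
      by (auto simp: lower_interval_def)
    moreover have "x \<in> faces T'" using assms(2) y by (auto simp: subcomplex_def)
    ultimately show "x \<in> lower_interval T' (\<iota> e)"
      using le[OF y(1) assms(3)] by (simp add: lower_interval_def)
  qed
qed

lemma tree_gluings_insert: "u \<noteq> [] \<Longrightarrow> tree_gluings d (insert u W) = insert (tree_gluing d u) (tree_gluings d W)"
  by (simp add: tree_gluings_def insert_Diff_if)

lemma tree_gluing_used:
  assumes "u \<in> W" "u \<noteq> []" "last u \<le> d"
  shows "(butlast u, {..d} - {last u}) \<in> used d (tree_gluings d W)"
    "(u, {..d} - {last u}) \<in> used d (tree_gluings d W)"
proof -
  let ?S = "{..d} - {last u}"
  have g: "tree_gluing d u \<in> tree_gluings d W" using assms by (simp add: tree_gluings_def)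
  have "((butlast u, ?S), (u, id ` ?S)) \<in> tree_gluing d u"
    "((u, id ` ?S), (butlast u, ?S)) \<in> tree_gluing d u"
    unfolding tree_gluing_def mem_glue by blast+
  moreover have "card ?S = d" using assms(3) by simp
  ultimately have "(butlast u, ?S) \<in> slots d (tree_gluing d u)" "(u, ?S) \<in> slots d (tree_gluing d u)"
    by (auto simp: slots_def Domain_iff)
  then show "(butlast u, ?S) \<in> used d (tree_gluings d W)" "(u, ?S) \<in> used d (tree_gluings d W)"
    using g unfolding used_def by blast+
qed

lemma grows_children_last:
  assumes "grows (children d) {[]} W" "u \<in> W" "u \<noteq> []"
  shows "last u \<le> d"
  using assms by (induction rule: grows.induct) (auto simp: children_def)

text \<open>Old and new faces coincide only inside the closed cell along which the simplex is
  attached, where \<open>glue\<close> makes the labels agree. So the classes change just by the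
  links between \<open>(w, A)\<close> and \<open>(u, A)\<close> for
  \<open>A \<subseteq> S\<close>.\<close>

lemma model_insert_simplex:
  assumes m: "model d T W G p" and G: "G \<subseteq> gluings d W" and u: "u \<notin> W"
    and w: "w \<in> W" "S \<subseteq> {..d}" "card S = d"
    and T': "simplicial_CW T'"
    and \<iota>: "order_iso (faces T) (face_le T) (\<iota> ` faces T) (face_le T') \<iota>"
      "subcomplex T' (\<iota> ` faces T)"
    and \<theta>: "order_iso (Pow {..d}) (\<subseteq>) (lower_interval T' \<Delta>) (face_le T') \<theta>"
    and F: "faces T' = \<iota> ` faces T \<union> lower_interval T' \<Delta>"
      "\<iota> ` faces T \<inter> lower_interval T' \<Delta> = lower_interval T' (\<iota> (p (w, S)))"
    and glue: "\<And>A. A \<subseteq> S \<Longrightarrow> \<theta> A = \<iota> (p (w, A))"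
  shows "model d T' (insert u W) (insert (glue w S u id) G)
    (\<lambda>x. if fst x = u then \<theta> (snd x) else \<iota> (p x))"
proof -
  let ?g = "glue w S u id"
  let ?p = "\<lambda>x. if fst x = u then \<theta> (snd x) else \<iota> (p x)"
  have \<theta>b: "bij_betw \<theta> (Pow {..d}) (lower_interval T' \<Delta>)" using \<theta> by (simp add: order_iso_def)
  have \<iota>inj: "inj_on \<iota> (faces T)" using \<iota>(1) by (auto simp: order_iso_def bij_betw_def)
  have nu: "fst x \<noteq> u" if "x \<in> nodes d W" for x using that u by (auto simp: nodes_def)
  have nodes: "nodes d (insert u W) = nodes d W \<union> {u} \<times> Pow {..d}" by (auto simp: nodes_def)
  have p\<iota>: "?p ` nodes d W = \<iota> ` faces T"
  proof -
    have "?p ` nodes d W = (\<lambda>x. \<iota> (p x)) ` nodes d W" using nu by (intro image_cong) auto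
    then show ?thesis using model_image[OF m] by (simp add: image_image[symmetric])
  qed
  have p\<theta>: "?p ` ({u} \<times> Pow {..d}) = lower_interval T' \<Delta>"
  proof -
    have "?p ` ({u} \<times> Pow {..d}) = (\<lambda>x. \<theta> (snd x)) ` ({u} \<times> Pow {..d})" by (intro image_cong) auto
    also have "\<dots> = \<theta> ` snd ` ({u} \<times> Pow {..d})" by (simp only: image_image)
    also have "\<dots> = \<theta> ` Pow {..d}" by simp
    finally show ?thesis using bij_betw_imp_surj_on[OF \<theta>b] by simp
  qed
  have link: "((w, A), (u, A)) \<in> eqv (insert ?g G)" "((u, A), (w, A)) \<in> eqv (insert ?g G)"
    if "A \<subseteq> S" for A
  proof -
    have "((w, A), (u, id ` A)) \<in> ?g" "((u, id ` A), (w, A)) \<in> ?g"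
      using that unfolding mem_glue by blast+
    then show "((w, A), (u, A)) \<in> eqv (insert ?g G)" "((u, A), (w, A)) \<in> eqv (insert ?g G)"
      using eqv_glue[of ?g "insert ?g G"] by simp_all
  qed
  have old: "(x, y) \<in> eqv (insert ?g G)" if "x \<in> nodes d W" "y \<in> nodes d W" "p x = p y" for x y
    using that model_eq[OF m] eqv_mono[of G "insert ?g G"] by blast
  \<comment> \<open>The common face lies below \<open>\<iota> (p (w, S))\<close>, hence is
    \<open>\<theta> B\<close> for some \<open>B \<subseteq> S\<close>; injectivity of
    \<open>\<theta>\<close> gives \<open>A = B\<close>.\<close>
  have mixed: "(x, (w, A)) \<in> eqv (insert ?g G) \<and> A \<subseteq> S"
    if x: "x \<in> nodes d W" and A: "A \<subseteq> {..d}" and eq: "\<iota> (p x) = \<theta> A" for x A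
  proof -
    have "\<theta> A \<in> lower_interval T' \<Delta>" using bij_betwE[OF \<theta>b] A by blast
    moreover have "\<theta> A \<in> \<iota> ` faces T" using model_mem[OF m x] eq[symmetric] by simp
    ultimately have "\<theta> A \<in> lower_interval T' (\<iota> (p (w, S)))" using F(2) by blast
    also have "\<dots> = \<iota> ` lower_interval T (p (w, S))"
      using lower_interval_embedding[OF \<iota>] model_mem[OF m] w by (simp add: mem_nodes)
    also have "\<dots> = (\<lambda>B. \<iota> (p (w, B))) ` Pow S"
      using model_lower[OF m w(1,2)] by (simp add: image_image)
    finally obtain B where B: "B \<subseteq> S" "\<theta> A = \<iota> (p (w, B))" by blast
    then have "\<theta> A = \<theta> B" using glue by simp
    then have AB: "A = B"
      using inj_on_eq_iff[OF bij_betw_imp_inj_on[OF \<theta>b], of A B] A B(1) w(2) by blast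
    have wB: "(w, B) \<in> nodes d W" using B(1) w by (auto simp: mem_nodes)
    have "p x = p (w, B)"
      using inj_onD[OF \<iota>inj _ model_mem[OF m x] model_mem[OF m wB]] eq B(2) by simp
    then show ?thesis using old[OF x wB] AB B(1) by simp
  qed
  have to_eqv: "(x, y) \<in> eqv (insert ?g G)"
    if xy: "x \<in> nodes d (insert u W)" "y \<in> nodes d (insert u W)" and eq: "?p x = ?p y" for x y
  proof -
    have x: "x \<in> nodes d W \<or> x \<in> {u} \<times> Pow {..d}" and y: "y \<in> nodes d W \<or> y \<in> {u} \<times> Pow {..d}"
      using xy unfolding nodes by blast+
    show ?thesis
    proof (cases "x \<in> nodes d W"; cases "y \<in> nodes d W")
      assume n: "x \<in> nodes d W" "y \<in> nodes d W"
      then have "\<iota> (p x) = \<iota> (p y)" using eq nu by simp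
      then have "p x = p y" using inj_onD[OF \<iota>inj] model_mem[OF m] n by blast
      then show ?thesis using old n by blast
    next
      assume n: "x \<in> nodes d W" "y \<notin> nodes d W"
      then obtain A where A: "y = (u, A)" "A \<subseteq> {..d}" using y by blast
      then have "\<iota> (p x) = \<theta> A" using eq nu[OF n(1)] by simp
      from mixed[OF n(1) A(2) this] show ?thesis using link(1) eqv_trans A(1) by blast
    next
      assume n: "x \<notin> nodes d W" "y \<in> nodes d W"
      then obtain A where A: "x = (u, A)" "A \<subseteq> {..d}" using x by blast
      then have e: "\<iota> (p y) = \<theta> A" using eq nu[OF n(2)] by simp
      have "A \<subseteq> S" using mixed[OF n(2) A(2) e] by blast
      have wA: "(w, A) \<in> nodes d W" using \<open>A \<subseteq> S\<close> w by (auto simp: mem_nodes)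
      have "\<iota> (p (w, A)) = \<iota> (p y)" using e glue[OF \<open>A \<subseteq> S\<close>] by simp
      then have "p (w, A) = p y" using inj_onD[OF \<iota>inj] model_mem[OF m] wA n by blast
      then have "((w, A), y) \<in> eqv (insert ?g G)" using old wA n by blast
      then show ?thesis using link(2)[OF \<open>A \<subseteq> S\<close>] eqv_trans A(1) by blast
    next
      assume "x \<notin> nodes d W" "y \<notin> nodes d W"
      then obtain A B where AB: "x = (u, A)" "A \<subseteq> {..d}" "y = (u, B)" "B \<subseteq> {..d}" using x y by blast
      then have "A = B"
        using eq inj_on_eq_iff[OF bij_betw_imp_inj_on[OF \<theta>b], of A B] by simp
      then show ?thesis using AB by simp
    qed
  qed
  have from_eqv: "?p x = ?p y" if "(x, y) \<in> eqv (insert ?g G)" for x y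
  proof (rule eqv_respects[OF _ that])
    fix h x y assume h: "h \<in> insert ?g G" "(x, y) \<in> h"
    show "?p x = ?p y"
    proof (cases "h \<in> G")
      case True
      then have n: "x \<in> nodes d W" "y \<in> nodes d W" using gluing_nodes G h(2) by blast+
      moreover have "(x, y) \<in> eqv G" using eqv_glue[OF True h(2)] .
      ultimately have "p x = p y" using model_eq[OF m] by blast
      then show ?thesis using nu n by simp
    next
      case False
      then have "(x, y) \<in> ?g" using h by simp
      then obtain A where A: "A \<subseteq> S" "x = (w, A) \<and> y = (u, A) \<or> x = (u, A) \<and> y = (w, A)"
        unfolding mem_glue by auto
      have "w \<noteq> u" using w u by blast
      then show ?thesis using A glue[OF A(1)] by auto
    qed
  qed
  show ?thesis
    unfolding model_def
  proof (intro conjI ballI allI impI)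
    show "?p ` nodes d (insert u W) = faces T'" unfolding nodes image_Un p\<iota> p\<theta> F(1) ..
    show "?p x = ?p y \<longleftrightarrow> (x, y) \<in> eqv (insert ?g G)"
      if "x \<in> nodes d (insert u W)" "y \<in> nodes d (insert u W)" for x y
      using to_eqv[OF that] from_eqv by blast
    show "lower_interval T' (?p (v, B)) = (\<lambda>A. ?p (v, A)) ` Pow B"
      if v: "v \<in> insert u W" and B: "B \<subseteq> {..d}" for v B
    proof (cases "v = u")
      case True
      then show ?thesis using lower_interval_chart[OF T' \<theta> B] by simp
    next
      case False
      then have "v \<in> W" using v by simp
      then have "lower_interval T' (\<iota> (p (v, B))) = \<iota> ` (\<lambda>A. p (v, A)) ` Pow B"
        using lower_interval_embedding[OF \<iota>] model_mem[OF m] model_lower[OF m _ B] B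
        by (simp add: mem_nodes)
      then show ?thesis using False by (simp add: image_image)
    qed
    show "inj_on (\<lambda>A. ?p (v, A)) (Pow {..d})" if v: "v \<in> insert u W" for v
    proof (cases "v = u")
      case True
      then show ?thesis using bij_betw_imp_inj_on[OF \<theta>b] by simp
    next
      case False
      then have vW: "v \<in> W" using v by simp
      have "inj_on (\<lambda>A. \<iota> (p (v, A))) (Pow {..d})"
      proof (rule inj_onI)
        fix A B assume AB: "A \<in> Pow {..d}" "B \<in> Pow {..d}" "\<iota> (p (v, A)) = \<iota> (p (v, B))"
        then have "p (v, A) = p (v, B)"
          using inj_onD[OF \<iota>inj AB(3)] model_mem[OF m] vW by (simp add: mem_nodes)
        then show "A = B" using inj_onD[OF model_inj[OF m vW]] AB by blast
      qed
      then show ?thesis using False by simp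
    qed
  qed
qed

lemma model_glue_step:
  assumes "1 \<le> d" "pseudomanifold d T" "pseudomanifold d T'" "glue_step d T T'"
    and m: "model d T W (tree_gluings d W) p" and v: "valid d W (tree_gluings d W)"
    and gr: "grows (children d) {[]} W"
  shows "\<exists>u\<in>children d W. \<exists>p'. model d T' (insert u W) (tree_gluings d (insert u W)) p' \<and>
    valid d (insert u W) (tree_gluings d (insert u W))"
proof -
  have T: "simplicial_CW T" and T': "simplicial_CW T'" using assms(2,3) by (auto simp: pseudomanifold_def)
  let ?G = "tree_gluings d W"
  note G = validD[OF v]
  obtain \<sigma> \<Delta> \<iota> where \<sigma>: "\<sigma> \<in> k_cells T (d - 1)" "\<sigma> \<in> pm_boundary d T" and \<Delta>: "\<Delta> \<in> k_cells T' d"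
    and \<iota>: "order_iso (faces T) (face_le T) (\<iota> ` faces T) (face_le T') \<iota>"
      "subcomplex T' (\<iota> ` faces T)"
    and F: "faces T' = \<iota> ` faces T \<union> lower_interval T' \<Delta>"
      "\<iota> ` faces T \<inter> lower_interval T' \<Delta> = lower_interval T' (\<iota> \<sigma>)"
    using assms(4) unfolding glue_step_def
    by (elim bexE exE conjE IntE) (rule that; assumption)
  obtain w S where w: "w \<in> W" "S \<subseteq> {..d}" "card S = d - 1 + 1" "\<sigma> = p (w, S)"
    using model_k_cellE[OF T m \<sigma>(1)] .
  have cS: "card S = d" using w(3) assms(1) by simp
  have unused: "(w, S) \<notin> used d ?G"
    using model_unused[OF T m G w(1,2)] boundary_facets_above[OF T assms(1) \<sigma>] w(4) by simp
  obtain j where j: "{..d} = insert j S" "j \<notin> S" "j \<le> d" "S = {..d} - {j}"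
    using card_facet_complement[OF w(2) cS] .
  define u where "u = w @ [j]"
  have un: "u \<noteq> []" "butlast u = w" "last u = j" by (simp_all add: u_def)
  have uW: "u \<notin> W"
    using tree_gluing_used(1)[of u W d] unused unfolding un j(4)[symmetric] using un(1) j(3) by blast
  have "last w \<noteq> j" if "w \<noteq> []"
  proof
    assume "last w = j"
    then show False
      using tree_gluing_used(2)[OF w(1) that grows_children_last[OF gr w(1) that]] unused
      unfolding j(4)[symmetric] by (simp only: j(4)[symmetric])
  qed
  then have uc: "u \<in> children d W" using w(1) j(3) uW by (auto simp: children_def u_def)
  obtain \<theta>0 where \<theta>0: "order_iso (Pow {..d}) (\<subseteq>) (lower_interval T' \<Delta>) (face_le T') \<theta>0"
    using simplex_chart[OF T' \<Delta>] .
  have b0: "bij_betw \<theta>0 (Pow {..d}) (lower_interval T' \<Delta>)" using \<theta>0 by (simp add: order_iso_def)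
  have \<sigma>f: "\<sigma> \<in> faces T" using \<sigma>(1) k_cells_iff[OF T] by blast
  have low: "lower_interval T' (\<iota> \<sigma>) = \<iota> ` lower_interval T \<sigma>"
    using lower_interval_embedding[OF \<iota> \<sigma>f] .
  have "\<sigma> \<in> lower_interval T \<sigma>" using \<sigma>f by (simp add: lower_interval_def face_le_def)
  then have "\<iota> \<sigma> \<in> lower_interval T' \<Delta>" using low F(2) by blast
  then obtain S0 where S0: "S0 \<subseteq> {..d}" "\<iota> \<sigma> = \<theta>0 S0"
    using bij_betw_imp_surj_on[OF b0] by blast
  have subl: "lower_interval T \<sigma> \<subseteq> faces T" by (auto simp: lower_interval_def)
  have \<iota>low: "order_iso (lower_interval T \<sigma>) (face_le T) (lower_interval T' (\<iota> \<sigma>)) (face_le T') \<iota>"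
    using order_iso_restrict[OF \<iota>(1) subl] unfolding low .
  have low0: "lower_interval T' (\<iota> \<sigma>) = \<theta>0 ` Pow S0"
    using lower_interval_chart[OF T' \<theta>0 S0(1)] S0(2) by simp
  have \<theta>0S: "order_iso (Pow S0) (\<subseteq>) (lower_interval T' (\<iota> \<sigma>)) (face_le T') \<theta>0"
    using order_iso_restrict[OF \<theta>0 Pow_mono[OF S0(1)]] unfolding low0 .
  \<comment> \<open>\<open>\<theta>0\<close> is an arbitrary chart; \<open>?\<alpha>\<close>
    translates the labels of \<open>w\<close> on the shared facet into those of
    \<open>\<theta>0\<close>, and \<open>extend_chart\<close> corrects the chart
    accordingly.\<close>
  let ?\<alpha> = "\<lambda>A. inv_into (Pow S0) \<theta>0 (\<iota> (p (w, A)))"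
  have pw: "order_iso (Pow S) (\<subseteq>) (lower_interval T \<sigma>) (face_le T) (\<lambda>A. p (w, A))"
    using model_order_iso_lower[OF m w(1,2)] w(4) by simp
  have \<alpha>: "order_iso (Pow S) (\<subseteq>) (Pow S0) (\<subseteq>) ?\<alpha>"
    using order_iso_comp[OF order_iso_comp[OF pw \<iota>low] order_iso_inv[OF \<theta>0S]] .
  obtain f where "bij_betw f S S0" using order_iso_Pow[OF \<alpha>] by metis
  then have "card S0 = d" using bij_betw_same_card cS by metis
  then obtain j' where j': "{..d} = insert j' S0" "j' \<notin> S0"
    using card_facet_complement[OF S0(1)] by metis
  obtain \<theta> where \<theta>: "order_iso (Pow {..d}) (\<subseteq>) (lower_interval T' \<Delta>) (face_le T') \<theta>"
    "\<And>A. A \<subseteq> S \<Longrightarrow> \<theta> A = \<theta>0 (?\<alpha> A)"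
    using extend_chart[OF \<theta>0 \<alpha> j(1,2) j'] by metis
  have glue: "\<theta> A = \<iota> (p (w, A))" if "A \<subseteq> S" for A
  proof -
    have "p (w, A) \<in> lower_interval T \<sigma>" using model_lower[OF m w(1,2)] w(4) that by simp
    then have "\<iota> (p (w, A)) \<in> \<theta>0 ` Pow S0" using low low0 by blast
    then show ?thesis using \<theta>(2)[OF that] by (simp add: f_inv_into_f)
  qed
  have tu: "tree_gluing d u = glue w S u id" using un j(4) by (simp add: tree_gluing_def)
  have ti: "tree_gluings d (insert u W) = insert (glue w S u id) ?G"
    using tree_gluings_insert[OF un(1)] tu by simp
  have "\<exists>p'. model d T' (insert u W) (tree_gluings d (insert u W)) p'"
    unfolding ti using model_insert_simplex[OF m G uW w(1,2) cS T' \<iota> \<theta>(1) F(1) _ glue] F(2) w(4)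
    by blast
  then obtain p' where p': "model d T' (insert u W) (insert (glue w S u id) ?G) p'"
    unfolding ti by blast
  have gsub: "gluings d W \<subseteq> gluings d (insert u W)"
    unfolding gluings_def gluing_data_def by blast
  have dat: "gluing_data d (insert u W) w S u id"
    using w(1,2) cS uW by (auto simp: gluing_data_def)
  have "valid d (insert u W) (insert (glue w S u id) ?G)"
  proof (rule model_valid[OF p'])
    show "insert (glue w S u id) ?G \<subseteq> gluings d (insert u W)"
      using G gsub gluing_data_glue_mem[OF dat] by blast
    have new: "slots d (glue w S u id) \<inter> slots d h = {}" if h: "h \<in> ?G" for h
    proof -
      have "(w, S) \<notin> slots d h" using unused h by (auto simp: used_def)
      moreover have "(u, S) \<notin> slots d h"
      proof
        assume "(u, S) \<in> slots d h"
        then obtain y where "((u, S), y) \<in> h" unfolding slots_def by blast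
        then have "(u, S) \<in> nodes d W" using gluing_nodes(1) G h by blast
        then show False using uW by (simp add: mem_nodes)
      qed
      ultimately show ?thesis unfolding slots_glue[OF dat] by simp
    qed
    show "slots d h \<inter> slots d k = {}"
      if "h \<in> insert (glue w S u id) ?G" "k \<in> insert (glue w S u id) ?G" "h \<noteq> k" for h k
    proof -
      have "slots d h \<inter> slots d k = {}" if "h \<in> ?G" "k \<in> ?G"
        using v that \<open>h \<noteq> k\<close> by (simp add: valid_def)
      then show ?thesis using that new by blast
    qed
  qed
  then show ?thesis using uc p' unfolding ti[symmetric] by blast
qed

section \<open>Models of the identification phase\<close>

lemma equivclp_isolated:
  assumes "equivclp R a b" "\<And>c. \<not> R a c" "\<And>c. \<not> R c a"
  shows "b = a"
  using assms(1)
proof (induction rule: equivclp_induct)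
  case (step y z)
  then show ?case using assms(2,3) by blast
qed simp

text \<open>In labels, the relation generated by \<open>\<phi>\<close> is one more gluing. The hard
  point is that the quotient stays injective on every simplex: \<open>identify_step\<close> does not
  say so, and it is forced by counting faces in \<open>T'\<close>, a simplicial
  pseudomanifold.\<close>

lemma model_identify_step:
  assumes "2 \<le> d" "pseudomanifold d T" "pseudomanifold d T'" "identify_step d T T'"
    and m: "model d T W G p" and v: "valid d W G"
  shows "\<exists>g\<in>ridge_gluings d W G. \<exists>p'. model d T' W (insert g G) p' \<and> valid d W (insert g G)"
proof -
  have T: "simplicial_CW T" and T': "simplicial_CW T'" using assms(2,3) by (auto simp: pseudomanifold_def)
  have d1: "1 \<le> d" using assms(1) by simp
  note G = validD[OF v]
  obtain \<sigma> \<tau> F \<phi> q where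
    \<sigma>: "\<sigma> \<in> k_cells T (d - 1)" "\<sigma> \<in> pm_boundary d T" and
    \<tau>: "\<tau> \<in> k_cells T (d - 1)" "\<tau> \<in> pm_boundary d T" and
    F: "F \<in> k_cells T (d - 2)" "\<sigma> \<noteq> \<tau>" "face_le T F \<sigma>" and
    \<phi>: "order_iso (lower_interval T \<sigma>) (face_le T) (lower_interval T \<tau>) (face_le T) \<phi>" and
    fixF: "\<forall>x \<in> lower_interval T F. \<phi> x = x" and
    qimg: "q ` faces T = faces T'" and
    qeq: "\<forall>x \<in> faces T. \<forall>y \<in> faces T.
      q x = q y \<longleftrightarrow> equivclp (\<lambda>a b. a \<in> lower_interval T \<sigma> \<and> b = \<phi> a) x y" and
    qle: "\<forall>a \<in> faces T'. \<forall>b \<in> faces T'. face_le T' a b \<longleftrightarrow>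
      (\<exists>x \<in> faces T. \<exists>y \<in> faces T. q x = a \<and> q y = b \<and> face_le T x y)"
    using assms(4) unfolding identify_step_def
    by (elim bexE exE conjE IntE) (rule that; assumption)
  let ?R = "\<lambda>a b. a \<in> lower_interval T \<sigma> \<and> b = \<phi> a"
  have q_mem: "q x \<in> faces T'" if "x \<in> faces T" for x using qimg that by blast
  have q_eq: "q x = q y \<longleftrightarrow> equivclp ?R x y" if "x \<in> faces T" "y \<in> faces T" for x y
    by (rule bspec[OF bspec[OF qeq that(1)] that(2)])
  have q_leD: "\<exists>x\<in>faces T. \<exists>y\<in>faces T. q x = a \<and> q y = b \<and> face_le T x y"
    if "a \<in> faces T'" "b \<in> faces T'" "face_le T' a b" for a b
    using bspec[OF bspec[OF qle that(1)] that(2)] that(3) by (rule iffD1)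
  have q_leI: "face_le T' (q x) (q y)" if "x \<in> faces T" "y \<in> faces T" "face_le T x y" for x y
    by (rule iffD2[OF bspec[OF bspec[OF qle q_mem[OF that(1)]] q_mem[OF that(2)]]]) (use that in blast)
  obtain w S where w: "w \<in> W" "S \<subseteq> {..d}" "card S = d - 1 + 1" "\<sigma> = p (w, S)"
    using model_k_cellE[OF T m \<sigma>(1)] .
  obtain v' S' where v': "v' \<in> W" "S' \<subseteq> {..d}" "card S' = d - 1 + 1" "\<tau> = p (v', S')"
    using model_k_cellE[OF T m \<tau>(1)] .
  have cS: "card S = d" "card S' = d" using w(3) v'(3) d1 by simp_all
  have unused: "(w, S) \<notin> used d G" "(v', S') \<notin> used d G"
    using model_unused[OF T m G w(1,2)] boundary_facets_above[OF T d1 \<sigma>] w(4)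
      model_unused[OF T m G v'(1,2)] boundary_facets_above[OF T d1 \<tau>] v'(4) by simp_all
  have low\<sigma>: "lower_interval T \<sigma> = (\<lambda>A. p (w, A)) ` Pow S"
    using model_lower[OF m w(1,2)] w(4) by simp
  have low\<tau>: "lower_interval T \<tau> = (\<lambda>A. p (v', A)) ` Pow S'"
    using model_lower[OF m v'(1,2)] v'(4) by simp
  have pw: "order_iso (Pow S) (\<subseteq>) (lower_interval T \<sigma>) (face_le T) (\<lambda>A. p (w, A))"
    using model_order_iso_lower[OF m w(1,2)] w(4) by simp
  have pv: "order_iso (Pow S') (\<subseteq>) (lower_interval T \<tau>) (face_le T) (\<lambda>A. p (v', A))"
    using model_order_iso_lower[OF m v'(1,2)] v'(4) by simp
  \<comment> \<open>\<open>?\<psi>\<close> is \<open>\<phi>\<close> read in the labels of the two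
    facets; it is induced by a bijection \<open>f\<close> of vertices.\<close>
  let ?\<psi> = "\<lambda>A. inv_into (Pow S') (\<lambda>A. p (v', A)) (\<phi> (p (w, A)))"
  obtain f where f: "bij_betw f S S'" "\<And>A. A \<subseteq> S \<Longrightarrow> ?\<psi> A = f ` A"
    using order_iso_Pow[OF order_iso_comp[OF order_iso_comp[OF pw \<phi>] order_iso_inv[OF pv]]] by metis
  have fS: "f ` S = S'" "inj_on f S" using f(1) by (auto simp: bij_betw_def)
  have \<phi>_mem: "\<phi> c \<in> lower_interval T \<tau>" if "c \<in> lower_interval T \<sigma>" for c
    using \<phi> that bij_betwE unfolding order_iso_def by blast
  have \<phi>f: "\<phi> (p (w, A)) = p (v', f ` A)" if A: "A \<subseteq> S" for A
  proof -
    have "p (w, A) \<in> lower_interval T \<sigma>" using low\<sigma> A by blast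
    then have "\<phi> (p (w, A)) \<in> (\<lambda>A. p (v', A)) ` Pow S'"
      using \<phi>_mem unfolding low\<tau> by blast
    from f_inv_into_f[OF this] show ?thesis using f(2)[OF A] by simp
  qed
  have pair_nodes: "(w, C) \<in> nodes d W" "(v', f ` C) \<in> nodes d W" if "C \<subseteq> S" for C
  proof -
    have "f ` C \<subseteq> S'" using image_mono[OF that, of f] fS(1) by simp
    then show "(w, C) \<in> nodes d W" "(v', f ` C) \<in> nodes d W"
      using that w(1,2) v'(1,2) unfolding mem_nodes by (meson order_trans)+
  qed
  let ?p = "\<lambda>x. q (p x)"
  let ?g = "glue w S v' f"
  have pm: "p x \<in> faces T" if "x \<in> nodes d W" for x using model_mem[OF m that] .
  have full: "(u, {..d}) \<in> nodes d W" if "u \<in> W" for u using that by (simp add: mem_nodes)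
  have card_eq: "card A = card B"
    if "u \<in> W" "b \<in> W" "A \<subseteq> {..d}" "B \<subseteq> {..d}" "p (u, A) = p (b, B)" for u b A B
  proof -
    have "((u, A), (b, B)) \<in> eqv G" using that model_eq[OF m, of "(u, A)" "(b, B)"] by (simp add: mem_nodes)
    from eqv_card[OF G this] show ?thesis by simp
  qed
  \<comment> \<open>A top face has \<open>d + 1\<close> labels, more than any face of
    \<open>\<sigma>\<close> or \<open>\<tau>\<close>, so the generating relation does not touch
    it.\<close>
  have iso: "b = p (u, {..d})" if u: "u \<in> W" and b: "equivclp ?R (p (u, {..d})) b" for u b
  proof (rule equivclp_isolated[OF b])
    have nl: "p (u, {..d}) \<notin> (\<lambda>A. p (b, A)) ` Pow R" if bR: "b \<in> W" "R \<subseteq> {..d}" "card R = d" for b R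
    proof
      assume "p (u, {..d}) \<in> (\<lambda>A. p (b, A)) ` Pow R"
      then obtain A where A: "A \<subseteq> R" "p (u, {..d}) = p (b, A)" by blast
      then have "A \<subseteq> {..d}" using bR(2) by blast
      then have "card {..d} = card A" using card_eq[OF u bR(1) order_refl _ A(2)] by blast
      moreover have "card A \<le> card R" using bR(2) A(1) by (intro card_mono finite_subset[of R "{..d}"]) simp_all
      ultimately show False using bR(3) by simp
    qed
    have nl\<sigma>: "p (u, {..d}) \<notin> lower_interval T \<sigma>" using nl[OF w(1,2) cS(1)] unfolding low\<sigma> .
    have nl\<tau>: "p (u, {..d}) \<notin> lower_interval T \<tau>" using nl[OF v'(1,2) cS(2)] unfolding low\<tau> .
    show "\<not> ?R (p (u, {..d})) c" for c using nl\<sigma> by blast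
    show "\<not> ?R c (p (u, {..d}))" for c using nl\<tau> \<phi>_mem by metis
  qed
  have q_full: "x = p (u, {..d})" if "u \<in> W" "x \<in> faces T" "q x = q (p (u, {..d}))" for u x
  proof (rule iso[OF that(1)])
    show "equivclp ?R (p (u, {..d})) x"
      using q_eq[OF pm[OF full[OF that(1)]] that(2)] that(3) by simp
  qed
  have low_full: "lower_interval T' (?p (u, {..d})) = (\<lambda>A. ?p (u, A)) ` Pow {..d}"
    if u: "u \<in> W" for u
  proof -
    have uf: "q (p (u, {..d})) \<in> faces T'" using q_mem[OF pm[OF full[OF u]]] .
    have "e \<in> lower_interval T' (?p (u, {..d})) \<longleftrightarrow> e \<in> q ` lower_interval T (p (u, {..d}))" for e
    proof
      assume e: "e \<in> lower_interval T' (?p (u, {..d}))"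
      then have "e \<in> faces T'" "face_le T' e (q (p (u, {..d})))" by (auto simp: lower_interval_def)
      then obtain x y where xy: "x \<in> faces T" "y \<in> faces T" "q x = e" "q y = q (p (u, {..d}))"
        "face_le T x y" using q_leD[OF _ uf, of e] by blast
      then show "e \<in> q ` lower_interval T (p (u, {..d}))"
        using q_full[OF u xy(2,4)] by (auto simp: lower_interval_def)
    next
      assume "e \<in> q ` lower_interval T (p (u, {..d}))"
      then obtain x where x: "x \<in> faces T" "face_le T x (p (u, {..d}))" "e = q x"
        by (auto simp: lower_interval_def)
      then show "e \<in> lower_interval T' (?p (u, {..d}))"
        using q_mem[OF x(1)] q_leI[OF x(1) pm[OF full[OF u]]] by (simp add: lower_interval_def)
    qed
    then have "lower_interval T' (?p (u, {..d})) = q ` lower_interval T (p (u, {..d}))" by blast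
    then show ?thesis using model_lower[OF m u, of "{..d}"] by (simp add: image_image)
  qed
  \<comment> \<open>Once \<open>q ?e\<close> is known to be a \<open>d\<close>-cell, its interval
    has \<open>2 ^ (d + 1)\<close> elements and is the image of the equally many subsets of
    \<open>{..d}\<close>, so no two of these collapse.\<close>
  have inj': "inj_on (\<lambda>A. ?p (u, A)) (Pow {..d})" if u: "u \<in> W" for u
  proof -
    let ?e = "p (u, {..d})"
    have e: "?e \<in> faces T" using pm[OF full[OF u]] .
    have eT: "q ?e \<in> faces T'" using q_mem[OF e] .
    have "?e \<in> k_cells T d" using model_k_cell[OF T m u, of "{..d}" d] by simp
    then have "?e \<noteq> {}" using empty_not_cell[OF T] by (auto simp: k_cells_def)
    \<comment> \<open>Otherwise \<open>q ?e\<close> is the empty face and equals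
      \<open>q {}\<close>, although \<open>?e\<close> is nonempty and alone in its class.\<close>
    have "q ?e \<in> cells T'"
    proof (rule ccontr)
      assume "q ?e \<notin> cells T'"
      then have "q ?e = {}" using eT by (simp add: faces_def)
      moreover have "{} \<in> faces T'" by (simp add: faces_def)
      ultimately have lowe: "lower_interval T' (q ?e) = {q ?e}" using lower_interval_empty[OF T'] by simp
      have "q {} \<in> lower_interval T' (q ?e)"
      proof -
        have "{} \<in> faces T" "face_le T {} ?e" by (simp_all add: faces_def face_le_def)
        then show ?thesis using q_mem q_leI[OF _ e] by (simp add: lower_interval_def)
      qed
      then have "q {} = q ?e" using lowe by simp
      then have "{} = ?e" using q_full[OF u, of "{}"] by (simp add: faces_def)
      then show False using \<open>?e \<noteq> {}\<close> by simp
    qed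
    \<comment> \<open>Purity of \<open>T'\<close> gives a \<open>d\<close>-cell \<open>h\<close>
      above \<open>q ?e\<close>. Lifted to \<open>T\<close>, it comes from a face above
      \<open>?e\<close>; the number of labels shows that this face is \<open>?e\<close>, so
      \<open>h = q ?e\<close>.\<close>
    then have "facets_above d T' (q ?e) \<noteq> {}"
      using assms(3) unfolding pseudomanifold_def by blast
    then obtain h where h: "h \<in> k_cells T' d" "face_le T' (q ?e) h" by (auto simp: facets_above_def)
    have hf: "h \<in> faces T'" using h(1) k_cells_iff[OF T'] by blast
    then obtain x y where xy: "x \<in> faces T" "y \<in> faces T" "q x = q ?e" "q y = h" "face_le T x y"
      using q_leD[OF eT hf h(2)] by blast
    have x: "x = ?e" using q_full[OF u xy(1,3)] .
    have "y \<in> p ` nodes d W" using xy(2) model_image[OF m] by simp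
    then obtain b B where y: "y = p (b, B)" "b \<in> W" "B \<subseteq> {..d}" by (auto simp: nodes_def)
    then obtain C where C: "C \<subseteq> B" "?e = p (b, C)"
      using xy(5) model_face_le[OF m y(2,3) full[OF u]] unfolding x by blast
    have Cd: "C \<subseteq> {..d}" using C y by blast
    then have "card {..d} = card C" using card_eq[OF u y(2) order_refl _ C(2)] by blast
    then have "C = {..d}" using card_subset_eq[OF finite_atMost Cd] by simp
    then have "B = C" using C(1) y(3) by blast
    then have "h = q ?e" using C y(1) xy(4) by simp
    then have "card (lower_interval T' (q ?e)) = 2 ^ (d + 1)" using h(1) k_cells_iff[OF T'] by blast
    then have "card ((\<lambda>A. ?p (u, A)) ` Pow {..d}) = card (Pow {..d})"
      unfolding low_full[OF u] by (simp add: card_Pow)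
    then show ?thesis by (intro eq_card_imp_inj_on) simp_all
  qed
  have glue_q: "?p (w, A) = ?p (v', f ` A)" if A: "A \<subseteq> S" for A
  proof -
    note n = pair_nodes[OF A]
    have "?R (p (w, A)) (p (v', f ` A))" using low\<sigma> A \<phi>f by auto
    then have "equivclp ?R (p (w, A)) (p (v', f ` A))" by (rule r_into_equivclp)
    then show ?thesis using q_eq[OF pm[OF n(1)] pm[OF n(2)]] by simp
  qed
  \<comment> \<open>Inside one simplex the step would collapse the distinct facets \<open>S\<close>
    and \<open>S'\<close>, against injectivity.\<close>
  have "w \<noteq> v'"
  proof
    assume "w = v'"
    then have "?p (w, S) = ?p (w, S')" using glue_q[of S] fS(1) by simp
    then have "S = S'" using inj_onD[OF inj'[OF w(1)]] w(2) v'(2) by blast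
    then show False using F(2) w(4) v'(4) \<open>w = v'\<close> by simp
  qed
  have dat: "gluing_data d W w S v' f"
    using w(1,2) v'(1,2) cS fS \<open>w \<noteq> v'\<close> by (simp add: gluing_data_def)
  have gg: "?g \<in> gluings d W" using gluing_data_glue_mem[OF dat] .
  have G': "insert ?g G \<subseteq> gluings d W" using G gg by blast
  have "\<exists>A\<subseteq>S. F = p (w, A)"
  proof -
    have "F \<in> lower_interval T \<sigma>" using F(1,3) k_cells_iff[OF T] by (auto simp: lower_interval_def)
    then show ?thesis unfolding low\<sigma> by blast
  qed
  then obtain A where A: "A \<subseteq> S" "F = p (w, A)" by blast
  have Ad: "A \<subseteq> {..d}" using A(1) w(2) by blast
  have "card A = d - 2 + 1" using model_k_cell[OF T m w(1) Ad] F(1) A(2) by blast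
  then have cA: "card A = d - 1" using assms(1) by simp
  \<comment> \<open>That \<open>\<phi>\<close> fixes the faces of \<open>F\<close> says that both
    label sets name the same face of \<open>T\<close>, which is what \<open>joins\<close>
    demands.\<close>
  have "((w, B), (v', f ` B)) \<in> eqv G" if B: "B \<subseteq> A" for B
  proof -
    have "p (w, B) \<in> lower_interval T F" using model_lower[OF m w(1) Ad] A(2) B by blast
    then have "p (w, B) = p (v', f ` B)" using fixF \<phi>f[of B] A(1) B by auto
    moreover have "B \<subseteq> S" using A(1) B by blast
    ultimately show ?thesis using model_eq[OF m pair_nodes[of B]] by blast
  qed
  then have "joins d W G w S v' f A"
    using dat unused fS(1) A(1) cA by (simp add: joins_def)
  then have avail: "?g \<in> ridge_gluings d W G" unfolding ridge_gluings_def by blast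
  have from_eqv: "?p x = ?p y" if "(x, y) \<in> eqv (insert ?g G)" for x y
  proof (rule eqv_respects[OF _ that])
    fix h x y assume h: "h \<in> insert ?g G" "(x, y) \<in> h"
    show "?p x = ?p y"
    proof (cases "h \<in> G")
      case True
      have "x \<in> nodes d W" "y \<in> nodes d W" using gluing_nodes[OF subsetD[OF G True] h(2)] .
      then have "p x = p y" using model_eq[OF m] eqv_glue[OF True h(2)] by blast
      then show ?thesis by simp
    next
      case False
      then have "(x, y) \<in> ?g" using h by simp
      then obtain C where "C \<subseteq> S" "x = (w, C) \<and> y = (v', f ` C) \<or> x = (v', f ` C) \<and> y = (w, C)"
        unfolding mem_glue by blast
      then show ?thesis using glue_q[of C] by auto
    qed
  qed
  have old: "(x, y) \<in> eqv (insert ?g G)" if "x \<in> nodes d W" "y \<in> nodes d W" "p x = p y" for x y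
    using that model_eq[OF m] eqv_mono[of G "insert ?g G"] by blast
  have link: "((w, C), (v', f ` C)) \<in> eqv (insert ?g G)" "((v', f ` C), (w, C)) \<in> eqv (insert ?g G)"
    if "C \<subseteq> S" for C
  proof -
    have "((w, C), (v', f ` C)) \<in> ?g" "((v', f ` C), (w, C)) \<in> ?g"
      using that unfolding mem_glue by blast+
    then show "((w, C), (v', f ` C)) \<in> eqv (insert ?g G)" "((v', f ` C), (w, C)) \<in> eqv (insert ?g G)"
      using eqv_glue[of ?g "insert ?g G"] by simp_all
  qed
  have to_eqv: "(x, y) \<in> eqv (insert ?g G)"
    if xy: "x \<in> nodes d W" "y \<in> nodes d W" "?p x = ?p y" for x y
  proof -
    have "equivclp ?R (p x) (p y)" using q_eq[OF pm[OF xy(1)] pm[OF xy(2)]] xy(3) by simp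
    \<comment> \<open>A face of \<open>T\<close> has many nodes, and each generating step starts at
      a particular one; hence the claim for all \<open>z\<close>.\<close>
    then have "\<forall>z\<in>nodes d W. p z = p y \<longrightarrow> (x, z) \<in> eqv (insert ?g G)"
    proof (induction rule: equivclp_induct)
      case base
      then show ?case using old[OF xy(1)] by simp
    next
      case (step a b)
      have "\<exists>C\<subseteq>S. a = p (w, C) \<and> b = p (v', f ` C) \<or> b = p (w, C) \<and> a = p (v', f ` C)"
        using step.hyps(2) \<phi>f unfolding low\<sigma> by auto
      then obtain C where C: "C \<subseteq> S"
        "a = p (w, C) \<and> b = p (v', f ` C) \<or> b = p (w, C) \<and> a = p (v', f ` C)" by blast
      note n = pair_nodes[OF C(1)]
      from C(2) obtain z0 z1 where z: "z0 \<in> nodes d W" "z1 \<in> nodes d W" "p z0 = a" "p z1 = b"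
        "(z0, z1) \<in> eqv (insert ?g G)"
        using n link[OF C(1)] by metis
      have "(x, z1) \<in> eqv (insert ?g G)" using step.IH z eqv_trans by blast
      then show ?case using old[OF z(2)] z(4) eqv_trans by metis
    qed
    then show ?thesis using xy(2) by blast
  qed
  have m': "model d T' W (insert ?g G) ?p"
    unfolding model_def
  proof (intro conjI ballI allI impI)
    have "?p ` nodes d W = q ` p ` nodes d W" by (simp only: image_image)
    then show "?p ` nodes d W = faces T'" using model_image[OF m] qimg by simp
    show "?p x = ?p y \<longleftrightarrow> (x, y) \<in> eqv (insert ?g G)" if "x \<in> nodes d W" "y \<in> nodes d W" for x y
      using to_eqv[OF that] from_eqv by blast
    show "inj_on (\<lambda>A. ?p (u, A)) (Pow {..d})" if "u \<in> W" for u using inj'[OF that] .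
    show "lower_interval T' (?p (u, B)) = (\<lambda>A. ?p (u, A)) ` Pow B"
      if u: "u \<in> W" and B: "B \<subseteq> {..d}" for u B
    proof -
      have uB: "(u, B) \<in> nodes d W" using u B by (simp add: mem_nodes)
      have uf: "?p (u, B) \<in> faces T'" using q_mem[OF pm[OF uB]] .
      show ?thesis
      proof
        show "lower_interval T' (?p (u, B)) \<subseteq> (\<lambda>A. ?p (u, A)) ` Pow B"
        proof
          fix e assume "e \<in> lower_interval T' (?p (u, B))"
          then have "e \<in> faces T'" "face_le T' e (?p (u, B))" by (auto simp: lower_interval_def)
          then obtain x y where xy: "x \<in> faces T" "y \<in> faces T" "q x = e" "q y = ?p (u, B)"
            "face_le T x y" using q_leD[OF _ uf, of e] by blast
          have "y \<in> p ` nodes d W" using xy(2) model_image[OF m] by simp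
          then obtain b C where y: "y = p (b, C)" "b \<in> W" "C \<subseteq> {..d}" by (auto simp: nodes_def)
          have "x \<in> lower_interval T (p (b, C))" using xy y(1) by (simp add: lower_interval_def)
          then obtain D where D: "D \<subseteq> C" "x = p (b, D)" using model_lower[OF m y(2,3)] by blast
          have "(b, C) \<in> nodes d W" using y by (simp add: mem_nodes)
          then have "((b, C), (u, B)) \<in> eqv (insert ?g G)" using to_eqv uB xy(4) y(1) by simp
          \<comment> \<open>The relation was lifted at some other representative
            \<open>(b, C)\<close>; its smaller face is carried along the chain to
            \<open>(u, B)\<close>.\<close>
          then obtain E where E: "E \<subseteq> B" "((b, D), (u, E)) \<in> eqv (insert ?g G)"
            using eqv_transport[OF G' _ D(1)] by force
          then have "e = ?p (u, E)" using from_eqv[OF E(2)] D(2) xy(3) by simp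
          then show "e \<in> (\<lambda>A. ?p (u, A)) ` Pow B" using E(1) by blast
        qed
        show "(\<lambda>A. ?p (u, A)) ` Pow B \<subseteq> lower_interval T' (?p (u, B))"
        proof
          fix e assume "e \<in> (\<lambda>A. ?p (u, A)) ` Pow B"
          then obtain C where C: "C \<subseteq> B" "e = ?p (u, C)" by blast
          have "p (u, C) \<in> lower_interval T (p (u, B))" using model_lower[OF m u B] C(1) by blast
          then have c: "p (u, C) \<in> faces T" "face_le T (p (u, C)) (p (u, B))"
            by (auto simp: lower_interval_def)
          then show "e \<in> lower_interval T' (?p (u, B))"
            using q_mem[OF c(1)] q_leI[OF c(1) pm[OF uB]] C(2) by (simp add: lower_interval_def)
        qed
      qed
    qed
  qed
  have "valid d W (insert ?g G)"
    using valid_insertI[OF m' v gg ridge_gluings_unused(1)[OF avail]] .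
  then show ?thesis using avail m' by blast
qed

section \<open>From constructions to codes and isomorphism types\<close>

lemma local_construction_model:
  assumes "2 \<le> d" "local_construction d C N k T"
  shows "\<exists>(W, M)\<in>codes d N. \<exists>p. model d (T k) W M p"
proof -
  have d1: "1 \<le> d" using assms(1) by simp
  have lc: "1 \<le> N" "N \<le> k" "\<And>i. i \<in> {1..k} \<Longrightarrow> pseudomanifold d (T i)" "is_simplex d (T 1)"
    "\<And>i. i \<in> {1..<N} \<Longrightarrow> glue_step d (T i) (T (i + 1))"
    "\<And>i. i \<in> {N..<k} \<Longrightarrow> identify_step d (T i) (T (i + 1))"
    using assms(2) unfolding local_construction_def by blast+
  have tree: "\<exists>W p. grows (children d) {[]} W \<and> finite W \<and> card W = i \<and>
      model d (T i) W (tree_gluings d W) p \<and> valid d W (tree_gluings d W)"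
    if "1 \<le> i" "i \<le> N" for i
    using that
  proof (induction i rule: dec_induct)
    case base
    obtain p where p: "model d (T 1) {[]} {} p" using model_simplex[OF lc(4)] by blast
    have e: "tree_gluings d {[]} = {}" by (simp add: tree_gluings_def)
    have "valid d {[]} {}" by (rule model_valid[OF p]) simp_all
    then have "grows (children d) {[]} {[]} \<and> finite {[] :: nat list} \<and> card {[] :: nat list} = 1 \<and>
      model d (T 1) {[]} (tree_gluings d {[]}) p \<and> valid d {[]} (tree_gluings d {[]})"
      unfolding e using p grows.base by simp
    then show ?case by blast
  next
    case (step i)
    then obtain W p where IH: "grows (children d) {[]} W" "finite W" "card W = i"
      "model d (T i) W (tree_gluings d W) p" "valid d W (tree_gluings d W)" by auto
    have pm: "pseudomanifold d (T i)" "pseudomanifold d (T (i + 1))" "glue_step d (T i) (T (i + 1))"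
      using lc(2,3,5) step.hyps step.prems by simp_all
    obtain u p' where u: "u \<in> children d W" "model d (T (i + 1)) (insert u W) (tree_gluings d (insert u W)) p'"
      "valid d (insert u W) (tree_gluings d (insert u W))"
      using model_glue_step[OF d1 pm IH(4,5,1)] by blast
    have "u \<notin> W" using u(1) by (simp add: children_def)
    then have "grows (children d) {[]} (insert u W) \<and> finite (insert u W) \<and> card (insert u W) = Suc i \<and>
      model d (T (Suc i)) (insert u W) (tree_gluings d (insert u W)) p' \<and>
      valid d (insert u W) (tree_gluings d (insert u W))"
      using u IH grows.step[OF IH(1) u(1)] by simp
    then show ?case by blast
  qed
  obtain W p0 where W: "grows (children d) {[]} W" "finite W" "card W = N"
    and p0: "model d (T N) W (tree_gluings d W) p0" "valid d W (tree_gluings d W)"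
    using tree[OF lc(1)] by auto
  have "\<exists>M p. grows (ridge_gluings d W) (tree_gluings d W) M \<and> model d (T i) W M p \<and> valid d W M"
    if "N \<le> i" "i \<le> k" for i
    using that
  proof (induction i rule: dec_induct)
    case base
    show ?case using p0 grows.base by blast
  next
    case (step i)
    then obtain M p where IH: "grows (ridge_gluings d W) (tree_gluings d W) M"
      "model d (T i) W M p" "valid d W M" by auto
    have pm: "pseudomanifold d (T i)" "pseudomanifold d (T (i + 1))" "identify_step d (T i) (T (i + 1))"
      using lc(1,3,6) step.hyps step.prems by simp_all
    obtain g p' where "g \<in> ridge_gluings d W M" "model d (T (i + 1)) W (insert g M) p'"
      "valid d W (insert g M)"
      using model_identify_step[OF assms(1) pm IH(2,3)] by blast
    then show ?case using grows.step[OF IH(1)] by auto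
  qed
  then obtain M p where M: "grows (ridge_gluings d W) (tree_gluings d W) M" "model d (T k) W M p"
    "valid d W M" using lc(2) by blast
  have "(W, M) \<in> codes d N" using W M by (simp add: codes_def)
  then show ?thesis using M(2) by blast
qed

text \<open>Below each simplex the isomorphism comes from a bijection of vertices. These local
  bijections agree because each is determined by the images of singletons, which define the global
  map \<open>f\<close>.\<close>

lemma order_iso_imp_cpx_iso:
  assumes "simplicial_cpx C" "simplicial_cpx C'" "order_iso C (\<subseteq>) C' (\<subseteq>) \<phi>"
  shows "cpx_iso C C'"
proof -
  have b: "bij_betw \<phi> C C'" and le: "\<And>s t. s \<in> C \<Longrightarrow> t \<in> C \<Longrightarrow> s \<subseteq> t \<longleftrightarrow> \<phi> s \<subseteq> \<phi> t"
    using assms(3) by (auto simp: order_iso_def)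
  have down: "t \<in> C" if "s \<in> C" "t \<subseteq> s" for s t using assms(1) that by (auto simp: simplicial_cpx_def)
  have down': "t \<in> C'" if "s \<in> C'" "t \<subseteq> s" for s t using assms(2) that by (auto simp: simplicial_cpx_def)
  have img: "\<phi> ` C = C'" using bij_betw_imp_surj_on[OF b] .
  have inj: "inj_on \<phi> C" using bij_betw_imp_inj_on[OF b] .
  have restr: "\<phi> ` Pow s = Pow (\<phi> s)" if s: "s \<in> C" for s
  proof
    show "\<phi> ` Pow s \<subseteq> Pow (\<phi> s)" using le down[OF s] s by blast
    show "Pow (\<phi> s) \<subseteq> \<phi> ` Pow s"
    proof
      fix t assume t: "t \<in> Pow (\<phi> s)"
      then have "t \<in> C'" using down' img s by blast
      then obtain r where r: "r \<in> C" "t = \<phi> r" using img by blast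
      then have "r \<subseteq> s" using le[OF r(1) s] t by simp
      then show "t \<in> \<phi> ` Pow s" using r by blast
    qed
  qed
  have piece: "\<exists>f. bij_betw f s (\<phi> s) \<and> (\<forall>A\<subseteq>s. \<phi> A = f ` A)" if s: "s \<in> C" for s
  proof -
    have "Pow s \<subseteq> C" using down[OF s] by blast
    then have "order_iso (Pow s) (\<subseteq>) (Pow (\<phi> s)) (\<subseteq>) \<phi>"
      using order_iso_restrict[OF assms(3)] restr[OF s] by metis
    then show ?thesis using order_iso_Pow by metis
  qed
  define f where "f v = the_elem (\<phi> {v})" for v
  have f: "\<phi> {v} = {f v}" if "{v} \<in> C" for v
    using piece[OF that] by (auto simp: f_def)
  have eq: "\<phi> s = f ` s" if s: "s \<in> C" for s
  proof -
    obtain h where h: "\<forall>A\<subseteq>s. \<phi> A = h ` A" using piece[OF s] by blast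
    have "h v = f v" if "v \<in> s" for v
      using h f[of v] down[OF s, of "{v}"] that by auto
    then have "h ` s = f ` s" by (intro image_cong) auto
    then show ?thesis using h by simp
  qed
  have "inj_on f (\<Union>C)"
  proof (rule inj_onI)
    fix u v assume uv: "u \<in> \<Union>C" "v \<in> \<Union>C" "f u = f v"
    have "{u} \<in> C" "{v} \<in> C" using uv down by blast+
    then have "{u} = {v}" using f uv(3) inj_onD[OF inj, of "{u}" "{v}"] by simp
    then show "u = v" by simp
  qed
  moreover have "(\<lambda>s. f ` s) ` C = C'" using eq img by (metis image_cong)
  ultimately show ?thesis unfolding cpx_iso_def by blast
qed

lemma cpx_iso_trans:
  assumes "cpx_iso C C'" "cpx_iso C' C''"
  shows "cpx_iso C C''"
proof -
  obtain f where f: "inj_on f (\<Union>C)" "(\<lambda>s. f ` s) ` C = C'" using assms(1) by (auto simp: cpx_iso_def)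
  obtain g where g: "inj_on g (\<Union>C')" "(\<lambda>s. g ` s) ` C' = C''" using assms(2) by (auto simp: cpx_iso_def)
  have "f ` \<Union>C = \<Union>C'" using f(2) by blast
  then have "inj_on (g \<circ> f) (\<Union>C)" using f(1) g(1) by (simp add: comp_inj_on)
  moreover have "(\<lambda>s. (g \<circ> f) ` s) ` C = C''"
    unfolding g(2)[symmetric] f(2)[symmetric] by (simp add: image_image image_comp)
  ultimately show ?thesis unfolding cpx_iso_def by blast
qed

lemma cpx_iso_sym:
  assumes "cpx_iso C C'"
  shows "cpx_iso C' C"
proof -
  obtain f where f: "inj_on f (\<Union>C)" "(\<lambda>s. f ` s) ` C = C'" using assms by (auto simp: cpx_iso_def)
  have im: "f ` \<Union>C = \<Union>C'" using f(2) by blast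
  have "inj_on (inv_into (\<Union>C) f) (\<Union>C')" unfolding im[symmetric] by (rule inj_on_inv_into) simp
  moreover have "inv_into (\<Union>C) f ` f ` s = s" if "s \<in> C" for s
    using inv_into_image_cancel[OF f(1), of s] that by blast
  then have "(\<lambda>s. inv_into (\<Union>C) f ` s) ` C' = C"
    unfolding f(2)[symmetric] by (simp add: image_image)
  ultimately show ?thesis unfolding cpx_iso_def by blast
qed

text \<open>A sphere may have many codes, and a code fixes it only up to isomorphism; hence the
  relation \<open>Q\<close> instead of a function. Picking any sphere with a given code maps the
  codes onto the types, since two spheres with one code have face posets that are quotients of the
  same simplices by the same relation.\<close>

lemma LC_sphere_types_codes:
  assumes "2 \<le> d" "finite (codes d N)"
  shows "finite (LC_sphere_types d N)" "card (LC_sphere_types d N) \<le> card (codes d N)"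
proof -
  let ?cls = "\<lambda>C. {(C, C'). cpx_iso C C'} `` {C}"
  define Q where "Q C c \<longleftrightarrow> c \<in> codes d N \<and> (\<exists>(K :: (nat \<Rightarrow> real) cell_complex) p \<phi>.
    model d K (fst c) (snd c) p \<and> order_iso (faces K) (face_le K) C (\<subseteq>) \<phi>)"
    for C :: "nat set set" and c
  have ex: "\<exists>c. Q C c" if C: "C \<in> LC_spheres d N" for C
  proof -
    obtain k T where T: "local_construction d C N k T"
      using C by (auto simp: LC_spheres_def LC_def)
    then obtain \<phi> where "order_iso (faces (T k)) (face_le (T k)) C (\<subseteq>) \<phi>"
      unfolding local_construction_def by blast
    moreover obtain W M p where "(W, M) \<in> codes d N" "model d (T k) W M p"
      using local_construction_model[OF assms(1) T] by blast
    ultimately have "Q C (W, M)" unfolding Q_def fst_conv snd_conv by blast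
    then show ?thesis by blast
  qed
  have iso: "cpx_iso C C'" if CC: "C \<in> LC_spheres d N" "C' \<in> LC_spheres d N" "Q C c" "Q C' c" for C C' c
  proof -
    obtain K p \<phi> where K: "model d (K :: (nat \<Rightarrow> real) cell_complex) (fst c) (snd c) p"
      "order_iso (faces K) (face_le K) C (\<subseteq>) \<phi>"
      using CC(3) unfolding Q_def by blast
    obtain K' p' \<phi>' where K': "model d (K' :: (nat \<Rightarrow> real) cell_complex) (fst c) (snd c) p'"
      "order_iso (faces K') (face_le K') C' (\<subseteq>) \<phi>'"
      using CC(4) unfolding Q_def by blast
    obtain \<psi> where "order_iso (faces K) (face_le K) (faces K') (face_le K') \<psi>"
      using model_order_iso[OF K(1) K'(1)] by blast
    then show ?thesis
      using order_iso_imp_cpx_iso[OF _ _ order_iso_comp[OF order_iso_comp[OF order_iso_inv[OF K(2)]] K'(2)]]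
        CC(1,2) by (auto simp: LC_spheres_def simplicial_sphere_def)
  qed
  define h where "h c = ?cls (SOME C. C \<in> LC_spheres d N \<and> Q C c)" for c
  have "LC_sphere_types d N \<subseteq> h ` codes d N"
  proof
    fix X assume "X \<in> LC_sphere_types d N"
    then obtain C where C: "C \<in> LC_spheres d N" "X = ?cls C"
      unfolding LC_sphere_types_def by (rule quotientE)
    obtain c where c: "Q C c" using ex[OF C(1)] by blast
    let ?C = "SOME C. C \<in> LC_spheres d N \<and> Q C c"
    have "?C \<in> LC_spheres d N \<and> Q ?C c" by (rule someI[of _ C]) (use C c in blast)
    then have "cpx_iso C ?C" using iso C(1) c by blast
    then have "?cls C = ?cls ?C" using cpx_iso_trans cpx_iso_sym by blast
    then show "X \<in> h ` codes d N" using C(2) c by (auto simp: h_def Q_def)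
  qed
  then show "finite (LC_sphere_types d N)" "card (LC_sphere_types d N) \<le> card (codes d N)"
    using assms(2) finite_subset surj_card_le by blast+
qed

theorem theorem2:
  fixes d :: nat
  assumes "2 \<le> d"
  shows "\<forall>\<^sub>F N in sequentially.
           finite (LC_sphere_types d N) \<and> card (LC_sphere_types d N) \<le> 2 ^ (d\<^sup>2 * N)"
proof (rule eventually_sequentiallyI)
  fix N :: nat assume N: "8 \<le> N"
  show "finite (LC_sphere_types d N) \<and> card (LC_sphere_types d N) \<le> 2 ^ (d\<^sup>2 * N)"
    using LC_sphere_types_codes[OF assms card_codes(1)[OF assms N]] card_codes(2)[OF assms N]
    by simp
qed

end
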